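(* Let $G$ be a countable discrete group acting on a second countable, locally compact, Hausdorff topological space $X$, let $Y\subset X$ be a clopen subset with $GY=X$, and let $N\colon G\to(0,+\infty)$ be a homomorphism, with associated dynamics $\sigma$ on $C^*_r(G\boxtimes Y)$. Suppose there exist a sequence $\{Y_n\}_{n=1}^\infty$ of Borel subsets of $Y$ and a sequence $\{g_n\}_{n=1}^\infty$ of elements of $G$ such that $\bigcup_{n=1}^\infty Y_n$ contains the set of points in $Y$ with nontrivial isotropy, and $N(g_n)\ne1$ and $g_nY_n=Y_n$ for all $n\ge1$. Let $\beta\ne0$, let $S$ be a subset of $G$, and let $Y_0\subset Y$ be a nonempty Borel set such that (i) $gY_0\cap Y_0=\emptyset$ for $g\in G\setminus\{e\}$; (ii) $SY_0\subset Y$; (iii) if $gY_0\cap Y\ne\emptyset$ then $g\in S$; (iv) $Y\setminus SU\subset\bigcup_nY_n$ for every open set $U$ containing $Y_0$; (v) $\zeta_S(\beta):=\sum_{s\in S}N(s)^{-\beta}<\infty$. Then: (1) the map $\varphi=\mu_*\circ E\mapsto\zeta_S(\beta)\mu|_{Y_0}$ is an affine isomorphism between the $\sigma$-KMS$_\beta$-states on $C^*_r(G\boxtimes Y)$ and the Borel probability measures on $Y_0$; the inverse map is given by $\nu\mapsto\mu_*\circ E$, where the measure $\mu$ on $Y$ is defined by $$\mu(Z)=\zeta_S(\beta)^{-1}\sum_{s\in S}N(s)^{-\beta}\nu(s^{-1}Z\cap Y_0)\quad\text{for Borel } Z\subset Y;\qquad( * )$$ (2) if $\mu$ is the measure on $Y$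 defined by a probability measure $\nu$ on $Y_0$ by $( * )$, and $H_S$ is the subspace of $L^2(Y,d\mu)$ consisting of functions $f$ such that $f(sy)=f(y)$ for $y\in Y_0$ and $s\in S$, then for $f\in H_S$ we have $$\|f\|_2^2=\zeta_S(\beta)\int_{Y_0}|f(y)|^2d\mu(y);$$ furthermore, the orthogonal projection $P\colon L^2(Y,d\mu)\to H_S$ is given by $$Pf|_{Sy}=\zeta_S(\beta)^{-1}\sum_{s\in S}N(s)^{-\beta}f(sy)\quad\text{for } y\in Y_0.$$
   Context: $G\boxtimes Y=\{(g,x)\mid x\in Y,\ gx\in Y\}$ is a subgroupoid of the transformation groupoid $G\times X$, and $C^*_r(G\boxtimes Y)=\mathbf 1_Y(C_0(X)\rtimes_rG)\mathbf 1_Y$ is its reduced C$^*$-algebra, where $\mathbf 1_Y$ is the characteristic function of $Y$. The dynamics is $\sigma_t(f)(g,x)=N(g)^{it}f(g,x)$ for $t\in\mathbb R$ and $f\in C_c(G\boxtimes Y)$. For $\beta\in\mathbb R$, a $\sigma$-KMS$_\beta$-state is a $\sigma$-invariant state $\varphi$ such that $\varphi(ab)=\varphi(b\sigma_{i\beta}(a))$ for $a$ and $b$ in a set of $\sigma$-analytic elements with dense linear span. $E\colon C_0(X)\rtimes_rG\to C_0(X)$ is the canonical conditional expectation: with $u_g$ the unitary in the multiplier algebra corresponding to $g\in G$, $E(fu_g)=f$ if $g=e$ and $0$ otherwise; it maps $C^*_r(G\boxtimes Y)$ onto $C_0(Y)$. For a measure $\mu$, $\mu_*$ denotes the functional $f\mapsto\int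 f\,d\mu$, and $\mu_*\circ E$ is regarded as a functional on $C^*_r(G\boxtimes Y)$. Whenever there are Borel subsets $Y_n$ of $Y$ and elements $g_n\in G$ ($n\ge1$) such that $\bigcup_{n=1}^\infty Y_n$ contains the set of points in $Y$ with nontrivial isotropy, and $N(g_n)\ne1$ and $g_nY_n=Y_n$ for all $n\ge1$, every $\sigma$-KMS$_\beta$-state with $\beta\neq 0$ is of the form $\mu_*\circ E$ for a unique Borel probability measure $\mu$ on $Y$. A point $x$ has nontrivial isotropy if $gx=x$ for some $g\ne e$ in $G$. For subsets, $SU=\bigcup_{s\in S}sU$ and $Sy=\{sy\mid s\in S\}$. *)

theory Defs
  imports "HOL-Probability.Probability_Measure"
begin

section \<open>The Hilbert space of square-summable families\<close>

typedef 'i ell2 = "{\<xi> :: 'i \<Rightarrow> complex. (\<lambda>i. (cmod (\<xi> i))\<^sup>2) summable_on UNIV}"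
  morphisms coef Abs_ell2
  by (rule exI[of _ "\<lambda>_. 0"]) simp

setup_lifting type_definition_ell2

lemma ell2_summable: "(\<lambda>i. (cmod (coef \<xi> i))\<^sup>2) summable_on UNIV"
  using coef by blast

lemma ell2_eqI: "(\<And>i. coef \<xi> i = coef \<eta> i) \<Longrightarrow> \<xi> = \<eta>"
  by (simp add: coef_inject[symmetric] fun_eq_iff)

lemma sq_summable_add:
  assumes "(\<lambda>i. (cmod (f i))\<^sup>2) summable_on UNIV" "(\<lambda>i. (cmod (g i))\<^sup>2) summable_on UNIV"
  shows "(\<lambda>i. (cmod (f i + g i))\<^sup>2) summable_on UNIV"
proof (rule summable_on_comparison_test)
  show "(\<lambda>i. 2 * (cmod (f i))\<^sup>2 + 2 * (cmod (g i))\<^sup>2) summable_on UNIV"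
    by (intro summable_on_add summable_on_cmult_right assms)
next
  fix i
  have "(cmod (f i + g i))\<^sup>2 \<le> (cmod (f i) + cmod (g i))\<^sup>2"
    by (intro power_mono norm_triangle_ineq) auto
  also have "\<dots> \<le> 2 * (cmod (f i))\<^sup>2 + 2 * (cmod (g i))\<^sup>2"
    using sum_squares_bound[of "cmod (f i)" "cmod (g i)"] by (simp add: power2_sum)
  finally show "(cmod (f i + g i))\<^sup>2 \<le> 2 * (cmod (f i))\<^sup>2 + 2 * (cmod (g i))\<^sup>2" .
qed auto

lemma sq_summable_mult_bounded:
  assumes "(\<lambda>i. (cmod (f i))\<^sup>2) summable_on UNIV" "\<And>i. cmod (m i) \<le> B"
  shows "(\<lambda>i. (cmod (m i * f i))\<^sup>2) summable_on UNIV"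
proof (rule summable_on_comparison_test)
  show "(\<lambda>i. B\<^sup>2 * (cmod (f i))\<^sup>2) summable_on UNIV"
    by (intro summable_on_cmult_right assms)
  show "(cmod (m i * f i))\<^sup>2 \<le> B\<^sup>2 * (cmod (f i))\<^sup>2" for i
    using power_mono[OF assms(2)[of i], of 2]
    by (simp add: norm_mult power_mult_distrib mult_right_mono)
qed auto

lemma sq_summable_prod:
  assumes "(\<lambda>i. (cmod (f i))\<^sup>2) summable_on UNIV" "(\<lambda>i. (cmod (g i))\<^sup>2) summable_on UNIV"
  shows "(\<lambda>i. f i * cnj (g i)) summable_on UNIV"
proof -
  have "(\<lambda>i. norm (f i * cnj (g i))) summable_on UNIV"
    by (rule abs_summable_product) (use assms in \<open>simp_all add: norm_mult power2_eq_square\<close>)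
  then show ?thesis by (rule abs_summable_summable)
qed

text \<open>The inner product is linear in the first variable.\<close>

definition cinner :: "'i ell2 \<Rightarrow> 'i ell2 \<Rightarrow> complex" where
  "cinner \<xi> \<eta> = (\<Sum>\<^sub>\<infinity>i. coef \<xi> i * cnj (coef \<eta> i))"

lemma cinner_self: "cinner \<xi> \<xi> = of_real (\<Sum>\<^sub>\<infinity>i. (cmod (coef \<xi> i))\<^sup>2)"
proof -
  have "((\<lambda>i. complex_of_real ((cmod (coef \<xi> i))\<^sup>2)) has_sum
      of_real (\<Sum>\<^sub>\<infinity>i. (cmod (coef \<xi> i))\<^sup>2)) UNIV"
    by (intro has_sum_of_real has_sum_infsum ell2_summable)
  then show ?thesis
    by (simp add: cinner_def complex_norm_square[symmetric] infsumI del: of_real_power)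
qed

instantiation ell2 :: (type) real_inner
begin

lift_definition zero_ell2 :: "'a ell2" is "\<lambda>_. 0" by simp

lift_definition plus_ell2 :: "'a ell2 \<Rightarrow> 'a ell2 \<Rightarrow> 'a ell2" is "\<lambda>\<xi> \<eta> i. \<xi> i + \<eta> i"
  by (rule sq_summable_add)

lift_definition uminus_ell2 :: "'a ell2 \<Rightarrow> 'a ell2" is "\<lambda>\<xi> i. - \<xi> i"
  by simp

definition "\<xi> - \<eta> = \<xi> + - (\<eta> :: 'a ell2)"

lift_definition scaleR_ell2 :: "real \<Rightarrow> 'a ell2 \<Rightarrow> 'a ell2" is "\<lambda>r \<xi> i. of_real r * \<xi> i"
  by (rule sq_summable_mult_bounded) auto

definition "inner \<xi> \<eta> = Re (cinner \<xi> \<eta>)" for \<xi> \<eta> :: "'a ell2"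

definition "norm \<xi> = sqrt (inner \<xi> \<xi>)" for \<xi> :: "'a ell2"

definition "dist \<xi> \<eta> = norm (\<xi> - \<eta>)" for \<xi> \<eta> :: "'a ell2"

definition "sgn \<xi> = inverse (norm \<xi>) *\<^sub>R \<xi>" for \<xi> :: "'a ell2"

definition uniformity_ell2 :: "('a ell2 \<times> 'a ell2) filter" where
  "uniformity_ell2 = (INF e\<in>{0<..}. principal {(\<xi>, \<eta>). dist \<xi> \<eta> < e})"

definition open_ell2 :: "'a ell2 set \<Rightarrow> bool" where
  "open_ell2 U \<longleftrightarrow> (\<forall>x\<in>U. \<forall>\<^sub>F (x', y) in uniformity. x' = x \<longrightarrow> y \<in> U)"

instance
proof
  fix x y z :: "'a ell2" and r s :: real
  show "x + y + z = x + (y + z)" "x + y = y + x" "0 + x = x" "- x + x = 0"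
    by (transfer; simp add: algebra_simps)+
  show "x - y = x + - y"
    by (rule minus_ell2_def)
  show "r *\<^sub>R (x + y) = r *\<^sub>R x + r *\<^sub>R y" "(r + s) *\<^sub>R x = r *\<^sub>R x + s *\<^sub>R x"
    "r *\<^sub>R s *\<^sub>R x = (r * s) *\<^sub>R x" "1 *\<^sub>R x = x"
    by (transfer; simp add: algebra_simps)+
  show "dist x y = norm (x - y)" "sgn x = inverse (norm x) *\<^sub>R x" "norm x = sqrt (inner x x)"
    by (simp_all add: dist_ell2_def sgn_ell2_def norm_ell2_def)
  show "uniformity = (INF e\<in>{0<..}. principal {(x, y :: 'a ell2). dist x y < e})"
    by (rule uniformity_ell2_def)
  show "open U = (\<forall>x\<in>U. \<forall>\<^sub>F (x', y) in uniformity. x' = x \<longrightarrow> y \<in> U)" for U :: "'a ell2 set"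
    by (rule open_ell2_def)
  have prod: "(\<lambda>i. coef u i * cnj (coef v i)) summable_on UNIV" for u v :: "'a ell2"
    by (intro sq_summable_prod ell2_summable)
  have "cinner y x = cnj (cinner x y)"
    by (simp add: cinner_def infsum_cnj[symmetric] mult.commute)
  then show "inner x y = inner y x"
    by (simp add: inner_ell2_def)
  have "cinner (x + y) z = cinner x z + cinner y z"
    unfolding cinner_def plus_ell2.rep_eq
    by (simp add: infsum_add[OF prod prod, symmetric] algebra_simps)
  then show "inner (x + y) z = inner x z + inner y z"
    by (simp add: inner_ell2_def)
  have "cinner (r *\<^sub>R x) y = of_real r * cinner x y"
    unfolding cinner_def scaleR_ell2.rep_eq
    by (simp add: infsum_cmult_right'[symmetric] mult.assoc)
  then show "inner (r *\<^sub>R x) y = r * inner x y"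
    by (simp add: inner_ell2_def)
  have sq: "inner x x = (\<Sum>\<^sub>\<infinity>i. (cmod (coef x i))\<^sup>2)"
    by (simp add: inner_ell2_def cinner_self)
  show "0 \<le> inner x x"
    unfolding sq by (rule infsum_nonneg) simp
  show "inner x x = 0 \<longleftrightarrow> x = 0"
  proof
    assume "inner x x = 0"
    then have "(\<Sum>\<^sub>\<infinity>i. (cmod (coef x i))\<^sup>2) \<le> 0" by (simp add: sq)
    then have "(cmod (coef x i))\<^sup>2 = 0" for i
      by (rule nonneg_infsum_le_0D) (auto intro: ell2_summable)
    then show "x = 0" by (intro ell2_eqI) (simp add: zero_ell2.rep_eq)
  qed (simp add: inner_ell2_def cinner_def zero_ell2.rep_eq)
qed

end

lemma norm_ell2_sq: "(norm \<xi>)\<^sup>2 = (\<Sum>\<^sub>\<infinity>i. (cmod (coef \<xi> i))\<^sup>2)"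
  by (simp add: power2_norm_eq_inner inner_ell2_def cinner_self)

lift_definition ket :: "'i \<Rightarrow> 'i ell2" is "\<lambda>i j. if j = i then 1 else 0"
proof -
  fix i :: 'i
  have "(\<lambda>j. (cmod (if j = i then 1 else 0))\<^sup>2) summable_on UNIV \<longleftrightarrow>
        (\<lambda>j. 1 :: real) summable_on {i}"
    by (rule summable_on_cong_neutral) auto
  then show "(\<lambda>j. (cmod (if j = i then 1 else 0))\<^sup>2) summable_on UNIV" by simp
qed

lemma cinner_ket: "cinner \<xi> (ket i) = coef \<xi> i"
proof -
  have "cinner \<xi> (ket i) = (\<Sum>\<^sub>\<infinity>j\<in>{i}. coef \<xi> j)"
    unfolding cinner_def ket.rep_eq by (rule infsum_cong_neutral) auto
  then show ?thesis by simp
qed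


section \<open>Operators\<close>

type_synonym 'i op = "'i ell2 \<Rightarrow>\<^sub>L 'i ell2"

text \<open>Multiplication operators. Unbounded symbols are sent to \<open>0\<close>.\<close>

lift_definition mult_vec :: "('i \<Rightarrow> complex) \<Rightarrow> 'i ell2 \<Rightarrow> 'i ell2" is
  "\<lambda>m \<xi> i. if bounded (range m) then m i * \<xi> i else 0"
proof -
  fix m \<xi> :: "'i \<Rightarrow> complex"
  assume *: "(\<lambda>i. (cmod (\<xi> i))\<^sup>2) summable_on UNIV"
  show "(\<lambda>i. (cmod (if bounded (range m) then m i * \<xi> i else 0))\<^sup>2) summable_on UNIV"
  proof (cases "bounded (range m)")
    case True
    then obtain B where "\<And>i. cmod (m i) \<le> B" unfolding bounded_iff by auto
    with True show ?thesis using sq_summable_mult_bounded[OF *, of m B] by simp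
  qed simp
qed

lift_definition mult_op :: "('i \<Rightarrow> complex) \<Rightarrow> 'i op" is mult_vec
proof -
  fix m :: "'i \<Rightarrow> complex"
  obtain B where B: "\<And>i. cmod (if bounded (range m) then m i else 0) \<le> B" "B \<ge> 0"
  proof (cases "bounded (range m)")
    case True
    then obtain B where "\<And>i. cmod (m i) \<le> B" unfolding bounded_iff by auto
    moreover from this[of undefined] have "B \<ge> 0" using norm_ge_zero order_trans by blast
    ultimately show ?thesis using that[of B] True by simp
  qed (use that[of 0] in simp)
  show "bounded_linear (mult_vec m)"
  proof (rule bounded_linear_intro)
    show "mult_vec m (x + y) = mult_vec m x + mult_vec m y" for x y
      by transfer (simp add: fun_eq_iff algebra_simps)
    show "mult_vec m (r *\<^sub>R x) = r *\<^sub>R mult_vec m x" for r x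
      by transfer (simp add: fun_eq_iff algebra_simps)
    fix x :: "'i ell2"
    have "(norm (mult_vec m x))\<^sup>2 \<le> (\<Sum>\<^sub>\<infinity>i. B\<^sup>2 * (cmod (coef x i))\<^sup>2)"
      unfolding norm_ell2_sq
    proof (rule infsum_mono)
      show "(\<lambda>i. (cmod (coef (mult_vec m x) i))\<^sup>2) summable_on UNIV"
        by (rule ell2_summable)
      show "(\<lambda>i. B\<^sup>2 * (cmod (coef x i))\<^sup>2) summable_on UNIV"
        by (intro summable_on_cmult_right ell2_summable)
      show "(cmod (coef (mult_vec m x) i))\<^sup>2 \<le> B\<^sup>2 * (cmod (coef x i))\<^sup>2" for i
        using power_mono[OF B(1)[of i], of 2]
        by (auto simp: mult_vec.rep_eq norm_mult power_mult_distrib mult_right_mono split: if_splits)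
    qed
    also have "\<dots> = (norm x * B)\<^sup>2"
      by (simp add: infsum_cmult_right' norm_ell2_sq power_mult_distrib)
    finally show "norm (mult_vec m x) \<le> norm x * B"
      by (rule power2_le_imp_le) (simp add: B(2))
  qed
qed

lemma coef_mult_op: "bounded (range m) \<Longrightarrow> coef (mult_op m \<xi>) i = m i * coef \<xi> i"
  by (simp add: mult_op.rep_eq mult_vec.rep_eq)

text \<open>
  Operators are only a real vector space for the type class hierarchy, so multiplication by
  complex scalars is written separately.
\<close>

definition cscale_op :: "complex \<Rightarrow> 'i op \<Rightarrow> 'i op" where
  "cscale_op c a = mult_op (\<lambda>_. c) o\<^sub>L a"

definition cspan_op :: "'i op set \<Rightarrow> 'i op set" where
  "cspan_op D = span {cscale_op c a | c a. a \<in> D}"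

definition adj_op :: "'i op \<Rightarrow> 'i op" where
  "adj_op a = (THE b. \<forall>\<xi> \<eta>. cinner (blinfun_apply a \<xi>) \<eta> = cinner \<xi> (blinfun_apply b \<eta>))"


section \<open>The reduced crossed product and its corner\<close>

text \<open>
  A group is a type of class \<open>group_add\<close>; this class is not commutative, and its operation,
  unit and inverses are written \<open>g + h\<close>, \<open>0\<close>, \<open>- g\<close>.
\<close>

definition continuous_action :: "('g::group_add \<Rightarrow> 'x::topological_space \<Rightarrow> 'x) \<Rightarrow> bool" where
  "continuous_action act \<longleftrightarrow>
     (\<forall>x. act 0 x = x) \<and> (\<forall>g h x. act (g + h) x = act g (act h x)) \<and>
     (\<forall>g. continuous_on UNIV (act g))"

definition C0_functions :: "('x::topological_space \<Rightarrow> complex) set" where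
  "C0_functions = {f. continuous_on UNIV f \<and> (\<forall>e>0. compact {x. e \<le> cmod (f x)})}"

lift_definition trans_vec :: "'g::group_add \<Rightarrow> ('g \<times> 'x) ell2 \<Rightarrow> ('g \<times> 'x) ell2" is
  "\<lambda>g \<xi> (h, x). \<xi> (- g + h, x)"
proof -
  fix g :: 'g and \<xi> :: "'g \<times> 'x \<Rightarrow> complex"
  assume *: "(\<lambda>i. (cmod (\<xi> i))\<^sup>2) summable_on UNIV"
  have "bij_betw (\<lambda>(h, x). (- g + h, x)) UNIV (UNIV :: ('g \<times> 'x) set)"
    by (rule bij_betwI[where g = "\<lambda>(h, x). (g + h, x)"]) (auto simp: add.assoc[symmetric])
  from summable_on_reindex_bij_betw[OF this, of "\<lambda>i. (cmod (\<xi> i))\<^sup>2"] *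
  show "(\<lambda>i. (cmod (case i of (h, x) \<Rightarrow> \<xi> (- g + h, x)))\<^sup>2) summable_on UNIV"
    by (simp add: case_prod_unfold)
qed

text \<open>
  The regular representation on \<open>\<ell>\<^sup>2(G \<times> X) = \<ell>\<^sup>2(G) \<otimes> \<ell>\<^sup>2(X)\<close> induced by the faithful
  representation of \<open>C\<^sub>0(X)\<close> by multiplication operators on \<open>\<ell>\<^sup>2(X)\<close>.
\<close>

lift_definition trans_op :: "'g::group_add \<Rightarrow> ('g \<times> 'x) op" is trans_vec
proof -
  fix g :: 'g
  have bij: "bij_betw (\<lambda>(h, x). (- g + h, x)) UNIV (UNIV :: ('g \<times> 'x) set)"
    by (rule bij_betwI[where g = "\<lambda>(h, x). (g + h, x)"]) (auto simp: add.assoc[symmetric])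
  show "bounded_linear (trans_vec g :: ('g \<times> 'x) ell2 \<Rightarrow> _)"
  proof (rule bounded_linear_intro)
    show "trans_vec g (x + y) = trans_vec g x + trans_vec g y" for x y :: "('g \<times> 'x) ell2"
      by transfer (simp add: fun_eq_iff)
    show "trans_vec g (r *\<^sub>R x) = r *\<^sub>R trans_vec g x" for r and x :: "('g \<times> 'x) ell2"
      by transfer (simp add: fun_eq_iff)
    show "norm (trans_vec g x) \<le> norm x * 1" for x :: "('g \<times> 'x) ell2"
    proof -
      have "(norm (trans_vec g x))\<^sup>2 = (norm x)\<^sup>2"
        unfolding norm_ell2_sq trans_vec.rep_eq
        using infsum_reindex_bij_betw[OF bij, of "\<lambda>i. (cmod (coef x i))\<^sup>2"]
        by (simp add: case_prod_unfold)
      then show ?thesis by simp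
    qed
  qed
qed

lemma coef_trans_op: "coef (trans_op g \<xi>) (h, x) = coef \<xi> (- g + h, x)"
  by (simp add: trans_op.rep_eq trans_vec.rep_eq)

definition fun_op :: "('g \<Rightarrow> 'x \<Rightarrow> 'x) \<Rightarrow> ('x \<Rightarrow> complex) \<Rightarrow> ('g \<times> 'x) op" where
  "fun_op act f = mult_op (\<lambda>(h, x). f (act h x))"

lemma coef_fun_op:
  assumes "bounded (range f)"
  shows "coef (fun_op act f \<xi>) (h, x) = f (act h x) * coef \<xi> (h, x)"
proof -
  have "bounded (range (\<lambda>(h, x). f (act h x)))"
    by (rule bounded_subset[OF assms]) auto
  then show ?thesis by (simp add: fun_op_def coef_mult_op)
qed

lemma covariance:
  assumes "continuous_action act" "bounded (range f)"
  shows "trans_op g o\<^sub>L fun_op act f = fun_op act (\<lambda>x. f (act (- g) x)) o\<^sub>L trans_op g"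
proof -
  have b: "bounded (range (\<lambda>x. f (act (- g) x)))"
    by (rule bounded_subset[OF assms(2)]) auto
  have "act (- g + h) x = act (- g) (act h x)" for h x
    using assms(1) by (simp add: continuous_action_def)
  then show ?thesis
    by (intro blinfun_eqI ell2_eqI) (auto simp: coef_trans_op coef_fun_op[OF b] coef_fun_op[OF assms(2)])
qed

text \<open>
  The real span is already a complex subspace, since \<open>C\<^sub>0(X)\<close> is closed under complex scalars.
\<close>

definition crossed_product ::
    "('g::group_add \<Rightarrow> 'x::topological_space \<Rightarrow> 'x) \<Rightarrow> ('g \<times> 'x) op set" where
  "crossed_product act = closure (span {fun_op act f o\<^sub>L trans_op g | f g. f \<in> C0_functions})"

text \<open>
  The corner of the crossed product by \<open>1\<^sub>Y\<close>. A function \<open>f \<in> C\<^sub>c(G \<boxtimes> Y)\<close>, extended by zero,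
  corresponds to the finite sum over \<open>g\<close> of \<open>f(g, g\<^sup>-\<^sup>1 \<cdot>) u\<^sub>g\<close>, so a function of the form
  \<open>f u\<^sub>g\<close> lives on \<open>{g} \<times> X\<close>.
\<close>

definition groupoid_algebra ::
    "('g::group_add \<Rightarrow> 'x::topological_space \<Rightarrow> 'x) \<Rightarrow> 'x set \<Rightarrow> ('g \<times> 'x) op set" where
  "groupoid_algebra act Y =
     (\<lambda>a. fun_op act (indicator Y) o\<^sub>L a o\<^sub>L fun_op act (indicator Y)) ` crossed_product act"

text \<open>
  In this representation the canonical conditional expectation is the diagonal matrix entry
  at \<open>(e, x)\<close>.
\<close>

definition cond_exp :: "('g::group_add \<times> 'x) op \<Rightarrow> 'x \<Rightarrow> complex" where
  "cond_exp a x = cinner (a (ket (0, x))) (ket (0, x))"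

lemma C0_bounded:
  assumes "f \<in> C0_functions"
  shows "bounded (range f)"
proof -
  let ?K = "{x. 1 \<le> cmod (f x)}"
  have "compact (f ` ?K)"
    using assms unfolding C0_functions_def
    by (intro compact_continuous_image) (auto intro: continuous_on_subset)
  then have "bounded (f ` ?K \<union> cball 0 1)"
    by (simp add: compact_imp_bounded)
  then show ?thesis by (rule bounded_subset) (auto simp: not_le)
qed

lemma cond_exp_generator:
  assumes "continuous_action act" "f \<in> C0_functions"
  shows "cond_exp (fun_op act f o\<^sub>L trans_op g) x = (if g = 0 then f x else 0)"
  using assms(1)
  by (auto simp: cond_exp_def cinner_ket coef_fun_op[OF C0_bounded[OF assms(2)]] coef_trans_op
      ket.rep_eq continuous_action_def)


section \<open>Dynamics and KMS states\<close>

text \<open>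
  The dynamics is implemented by the unitaries multiplying the coefficient at \<open>(h, x)\<close> by
  \<open>N(h)\<^bsup>it\<^esup>\<close>. On \<open>f u\<^sub>g\<close> it is multiplication by \<open>N(g)\<^bsup>it\<^esup>\<close>, see \<open>dynamics_generator\<close>,
  and it is isometric, so it is the continuous extension of the dynamics on \<open>C\<^sub>c(G \<boxtimes> Y)\<close>.
\<close>

definition phase_op :: "('g \<Rightarrow> real) \<Rightarrow> real \<Rightarrow> ('g \<times> 'x) op" where
  "phase_op N t = mult_op (\<lambda>(h, x). complex_of_real (N h) powr (\<i> * of_real t))"

definition dynamics :: "('g \<Rightarrow> real) \<Rightarrow> real \<Rightarrow> ('g \<times> 'x) op \<Rightarrow> ('g \<times> 'x) op" where
  "dynamics N t a = phase_op N t o\<^sub>L a o\<^sub>L phase_op N (- t)"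

lemma coef_phase_op:
  assumes "\<And>g. 0 < N g"
  shows "coef (phase_op N t \<xi>) (h, x) = of_real (N h) powr (\<i> * of_real t) * coef \<xi> (h, x)"
proof -
  have "cmod (complex_of_real (N h) powr (\<i> * of_real t)) = 1" for h
    using assms[of h] by (simp add: norm_powr_real_powr)
  then have "bounded (range (\<lambda>(h, x :: 'b). complex_of_real (N h) powr (\<i> * of_real t)))"
    unfolding bounded_iff by (intro exI[of _ 1]) auto
  then show ?thesis by (simp add: phase_op_def coef_mult_op)
qed

lemma dynamics_generator:
  fixes N :: "'g::group_add \<Rightarrow> real"
  assumes "\<And>g. 0 < N g" "\<And>g h. N (g + h) = N g * N h" "f \<in> C0_functions"
  shows "dynamics N t (fun_op act f o\<^sub>L trans_op g) =
           cscale_op (of_real (N g) powr (\<i> * of_real t)) (fun_op act f o\<^sub>L trans_op g)"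
proof -
  have *: "of_real (N h) powr (\<i> * of_real t) * of_real (N (- g + h)) powr - (\<i> * of_real t)
      = (of_real (N g) powr (\<i> * of_real t) :: complex)" for h
  proof -
    have "N h = N g * N (- g + h)"
      using assms(2)[of g "- g + h"] by (simp add: add.assoc[symmetric])
    then have "(of_real (N h) powr (\<i> * of_real t) :: complex) =
        of_real (N g) powr (\<i> * of_real t) * of_real (N (- g + h)) powr (\<i> * of_real t)"
      using assms(1)[of g] assms(1)[of "- g + h"] by (simp add: powr_times_real)
    then show ?thesis
      using assms(1)[of "- g + h"] by (simp add: powr_minus)
  qed
  show ?thesis
    unfolding dynamics_def cscale_op_def
    by (intro blinfun_eqI ell2_eqI)
      (auto simp: coef_phase_op[OF assms(1)] coef_fun_op[OF C0_bounded[OF assms(3)]]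
        coef_trans_op coef_mult_op *[simplified])
qed

text \<open>
  Functionals on a set \<open>A\<close> of operators are represented by functions on all operators that
  vanish outside \<open>A\<close>.
\<close>

definition is_state :: "'i op set \<Rightarrow> ('i op \<Rightarrow> complex) \<Rightarrow> bool" where
  "is_state A \<phi> \<longleftrightarrow>
     (\<forall>a. a \<notin> A \<longrightarrow> \<phi> a = 0) \<and>
     (\<forall>a\<in>A. \<forall>b\<in>A. \<phi> (a + b) = \<phi> a + \<phi> b) \<and>
     (\<forall>a\<in>A. \<forall>c. \<phi> (cscale_op c a) = c * \<phi> a) \<and>
     (\<forall>a\<in>A. \<phi> (adj_op a o\<^sub>L a) \<in> \<real>\<^sub>\<ge>\<^sub>0) \<and>
     bdd_above {cmod (\<phi> a) | a. a \<in> A \<and> norm a \<le> 1} \<and>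
     Sup {cmod (\<phi> a) | a. a \<in> A \<and> norm a \<le> 1} = 1"

definition entire_extension ::
    "'i op set \<Rightarrow> (real \<Rightarrow> 'i op \<Rightarrow> 'i op) \<Rightarrow> 'i op \<Rightarrow> (complex \<Rightarrow> 'i op) \<Rightarrow> bool" where
  "entire_extension A \<sigma> a F \<longleftrightarrow>
     (\<forall>z. F z \<in> A) \<and> (\<forall>t. F (of_real t) = \<sigma> t a) \<and>
     (\<forall>z. \<exists>D. (F has_derivative (\<lambda>w. cscale_op w D)) (at z))"

definition analytic_elements :: "'i op set \<Rightarrow> (real \<Rightarrow> 'i op \<Rightarrow> 'i op) \<Rightarrow> 'i op set" where
  "analytic_elements A \<sigma> = {a \<in> A. \<exists>F. entire_extension A \<sigma> a F}"

text \<open>The value \<open>\<sigma>\<^sub>z(a)\<close> for complex \<open>z\<close>; the extension is unique by the identity theorem.\<close>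

definition analytic_value ::
    "'i op set \<Rightarrow> (real \<Rightarrow> 'i op \<Rightarrow> 'i op) \<Rightarrow> complex \<Rightarrow> 'i op \<Rightarrow> 'i op" where
  "analytic_value A \<sigma> z a = (SOME F. entire_extension A \<sigma> a F) z"

definition is_KMS_state ::
    "'i op set \<Rightarrow> (real \<Rightarrow> 'i op \<Rightarrow> 'i op) \<Rightarrow> real \<Rightarrow> ('i op \<Rightarrow> complex) \<Rightarrow> bool" where
  "is_KMS_state A \<sigma> \<beta> \<phi> \<longleftrightarrow>
     is_state A \<phi> \<and> (\<forall>t. \<forall>a\<in>A. \<phi> (\<sigma> t a) = \<phi> a) \<and>
     (\<exists>D \<subseteq> analytic_elements A \<sigma>. closure (cspan_op D) = A \<and>
        (\<forall>a\<in>D. \<forall>b\<in>D. \<phi> (a o\<^sub>L b) = \<phi> (b o\<^sub>L analytic_value A \<sigma> (\<i> * of_real \<beta>) a)))"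

definition KMS_states ::
    "('g::group_add \<Rightarrow> 'x::topological_space \<Rightarrow> 'x) \<Rightarrow> 'x set \<Rightarrow> ('g \<Rightarrow> real) \<Rightarrow> real \<Rightarrow>
     (('g \<times> 'x) op \<Rightarrow> complex) set" where
  "KMS_states act Y N \<beta> = {\<phi>. is_KMS_state (groupoid_algebra act Y) (dynamics N) \<beta> \<phi>}"


section \<open>Measures\<close>

definition prob_measures :: "'x::topological_space set \<Rightarrow> 'x measure set" where
  "prob_measures Z = {\<mu>. prob_space \<mu> \<and> sets \<mu> = sets (restrict_space borel Z)}"

text \<open>The functional \<open>\<mu>\<^sub>* \<circ> E\<close> on \<open>C\<^sup>*\<^sub>r(G \<boxtimes> Y)\<close>.\<close>

definition measure_state ::
    "('g::group_add \<Rightarrow> 'x::topological_space \<Rightarrow> 'x) \<Rightarrow> 'x set \<Rightarrow> 'x measure \<Rightarrow>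
     ('g \<times> 'x) op \<Rightarrow> complex" where
  "measure_state act Y \<mu> a =
     (if a \<in> groupoid_algebra act Y then (\<integral>x. cond_exp a x \<partial>\<mu>) else 0)"

definition state_measure ::
    "('g::group_add \<Rightarrow> 'x::topological_space \<Rightarrow> 'x) \<Rightarrow> 'x set \<Rightarrow>
     (('g \<times> 'x) op \<Rightarrow> complex) \<Rightarrow> 'x measure" where
  "state_measure act Y \<phi> = (THE \<mu>. \<mu> \<in> prob_measures Y \<and> \<phi> = measure_state act Y \<mu>)"

definition zeta :: "('g \<Rightarrow> real) \<Rightarrow> 'g set \<Rightarrow> real \<Rightarrow> real" where
  "zeta N S \<beta> = (\<Sum>\<^sub>\<infinity>s\<in>S. N s powr - \<beta>)"

definition induced_measure ::
    "('g::group_add \<Rightarrow> 'x::topological_space \<Rightarrow> 'x) \<Rightarrow> 'x set \<Rightarrow> 'x set \<Rightarrow> ('g \<Rightarrow> real) \<Rightarrow>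
     'g set \<Rightarrow> real \<Rightarrow> 'x measure \<Rightarrow> 'x measure" where
  "induced_measure act Y Y0 N S \<beta> \<nu> =
     measure_of Y (sets (restrict_space borel Y))
       (\<lambda>Z. ennreal (inverse (zeta N S \<beta>)) *
            (\<Sum>\<^sub>\<infinity>s\<in>S. ennreal (N s powr - \<beta>) * emeasure \<nu> (act (- s) ` Z \<inter> Y0)))"

definition restricted_measure ::
    "('g::group_add \<Rightarrow> 'x::topological_space \<Rightarrow> 'x) \<Rightarrow> 'x set \<Rightarrow> 'x set \<Rightarrow> ('g \<Rightarrow> real) \<Rightarrow>
     'g set \<Rightarrow> real \<Rightarrow> (('g \<times> 'x) op \<Rightarrow> complex) \<Rightarrow> 'x measure" where
  "restricted_measure act Y Y0 N S \<beta> \<phi> =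
     scale_measure (ennreal (zeta N S \<beta>)) (restrict_space (state_measure act Y \<phi>) Y0)"

definition induced_state ::
    "('g::group_add \<Rightarrow> 'x::topological_space \<Rightarrow> 'x) \<Rightarrow> 'x set \<Rightarrow> 'x set \<Rightarrow> ('g \<Rightarrow> real) \<Rightarrow>
     'g set \<Rightarrow> real \<Rightarrow> 'x measure \<Rightarrow> ('g \<times> 'x) op \<Rightarrow> complex" where
  "induced_state act Y Y0 N S \<beta> \<nu> = measure_state act Y (induced_measure act Y Y0 N S \<beta> \<nu>)"


section \<open>Square-integrable functions\<close>

text \<open>Elements of \<open>L\<^sup>2\<close> are represented by functions, identified when equal almost everywhere.\<close>

definition L2_functions :: "'x measure \<Rightarrow> ('x \<Rightarrow> complex) set" where
  "L2_functions M = {f \<in> borel_measurable M. integrable M (\<lambda>x. (cmod (f x))\<^sup>2)}"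

definition L2_inner :: "'x measure \<Rightarrow> ('x \<Rightarrow> complex) \<Rightarrow> ('x \<Rightarrow> complex) \<Rightarrow> complex" where
  "L2_inner M f g = (\<integral>x. f x * cnj (g x) \<partial>M)"

definition L2_norm :: "'x measure \<Rightarrow> ('x \<Rightarrow> complex) \<Rightarrow> real" where
  "L2_norm M f = sqrt (\<integral>x. (cmod (f x))\<^sup>2 \<partial>M)"

definition is_orthogonal_projection ::
    "'x measure \<Rightarrow> ('x \<Rightarrow> complex) set \<Rightarrow> (('x \<Rightarrow> complex) \<Rightarrow> 'x \<Rightarrow> complex) \<Rightarrow> bool" where
  "is_orthogonal_projection M H P \<longleftrightarrow>
     (\<forall>f \<in> L2_functions M. P f \<in> H \<and> (\<forall>h\<in>H. L2_inner M (\<lambda>x. f x - P f x) h = 0))"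

definition invariant_L2 ::
    "('g \<Rightarrow> 'x \<Rightarrow> 'x) \<Rightarrow> 'x set \<Rightarrow> 'g set \<Rightarrow> 'x measure \<Rightarrow> ('x \<Rightarrow> complex) set" where
  "invariant_L2 act Y0 S M =
     {f \<in> L2_functions M. \<exists>f' \<in> borel_measurable M.
        (AE x in M. f x = f' x) \<and> (\<forall>y\<in>Y0. \<forall>s\<in>S. f' (act s y) = f' y)}"

end

theory Submission
  imports Defs "HOL-Probability.Probability_Mass_Function" "HOL-Complex_Analysis.Conformal_Mappings"
begin

text \<open>
  The algebra is spanned by the elements \<open>f u\<^sub>g\<close>, which are eigenvectors of the dynamics. The KMS
  condition therefore says that \<open>\<phi>(a f u\<^sub>g) = N(g)\<^sup>\<beta> \<phi>(f u\<^sub>g a)\<close> for all \<open>a\<close>. On functions this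
  gives, by the Riesz representation theorem, a probability measure with
  \<open>\<mu>(g W) = N(g)\<^sup>-\<^sup>\<beta> \<mu>(W)\<close> whenever \<open>W\<close> and \<open>g W\<close> lie in \<open>Y\<close>. Each \<open>Y\<^sub>n\<close> is null for such a measure, hence
  so is the set of points with nontrivial isotropy; since functions are in the centralizer of
  \<open>\<phi>\<close>, this forces \<open>\<phi>(f u\<^sub>g) = 0\<close> for \<open>g \<noteq> e\<close>, and KMS states correspond to measures with the above
  scaling property. Outer regularity and (iv) show that these measures are carried by the
  disjoint translates \<open>s Y\<^sub>0\<close>, so they are the images of \<open>\<nu> \<times> p\<close> under \<open>(y, s) \<mapsto> s y\<close>,
  where \<open>p(s) = N(s)\<^sup>-\<^sup>\<beta> / \<zeta>\<close> on \<open>S\<close>. In this picture the projection averages over \<open>p\<close>, and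
  the second part is Fubini's theorem.
\<close>

section \<open>Functions vanishing at infinity\<close>

text \<open>Two features shape the argument. First, \<open>A\<close> may have no unit when
  \<open>Y\<close> is not compact, so the total mass of a measure is not a value of the state. It is
  read off from the norm of the state, \<open>cond_exp\<close> being contractive, and in the
  converse direction from functions tending to the indicator of \<open>Y\<close>. Second,
  \<open>Y\<close> is not invariant, so scaling is only meaningful for sets whose translate stays in
  \<open>Y\<close>. Conditions (ii) and (iii) repair this: for \<open>y\<close> in \<open>Y0\<close>
  the point \<open>act s y\<close> lies in \<open>Y\<close> exactly when \<open>s\<close> is in
  \<open>S\<close>. Hence the sum over \<open>S\<close> defining the induced measure is a sum over
  the whole group when evaluated inside \<open>Y\<close>, and translating the summation index
  produces the factor \<open>N g powr - \<beta>\<close>. The factor \<open>zeta N S \<beta>\<close>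
  in the restriction map is the inverse of the weight of the neutral element, the only index whose
  translate of \<open>Y0\<close> meets \<open>Y0\<close>. Measures are compared on squares of
  functions throughout, because the product of a generator carried by \<open>g\<close> with a
  suitable one carried by \<open>- g\<close> is such a square.\<close>

definition C0 :: "('x::topological_space \<Rightarrow> 'b::real_normed_vector) set" where
  "C0 = {f. continuous_on UNIV f \<and> (\<forall>e>0. compact {x. e \<le> norm (f x)})}"

text \<open>The given definition is complex-valued. \<open>C0\<close> leaves the codomain open,
  since Urysohn functions and the Riesz theorem are about real functions.\<close>

lemma C0_functions_eq: "C0_functions = C0"
  by (simp add: C0_functions_def C0_def)

lemma C0_continuous: "f \<in> C0 \<Longrightarrow> continuous_on A f"
  by (auto simp: C0_def intro: continuous_on_subset)

lemma C0_borel: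
  fixes f :: "'x::topological_space \<Rightarrow> 'b::real_normed_vector"
  shows "f \<in> C0 \<Longrightarrow> f \<in> borel_measurable borel"
  by (rule borel_measurable_continuous_onI[OF C0_continuous])

lemma C0_compact: "f \<in> C0 \<Longrightarrow> 0 < e \<Longrightarrow> compact {x. e \<le> norm (f x)}"
  by (auto simp: C0_def)

text \<open>Where \<open>norm (g x)\<close> is at least \<open>e\<close>, one of the two bounds is
  at least \<open>e/2\<close>. So the superlevel set is a closed part of a union of two compact
  sets.\<close>

lemma C0_dominated2:
  assumes f: "f \<in> C0" and h: "h \<in> C0" and g: "continuous_on UNIV g"
    and le: "\<And>x. norm (g x) \<le> norm (f x) + norm (h x)"
  shows "g \<in> C0"
  unfolding C0_def
proof (intro CollectI conjI allI impI g)
  fix e :: real assume e: "0 < e"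
  have "closed {x. e \<le> norm (g x)}"
    by (intro closed_Collect_le continuous_intros g)
  then have "compact (({x. e/2 \<le> norm (f x)} \<union> {x. e/2 \<le> norm (h x)}) \<inter> {x. e \<le> norm (g x)})"
    using C0_compact[OF f, of "e/2"] C0_compact[OF h, of "e/2"] e
    by (intro compact_Int_closed compact_Un) auto
  moreover have "({x. e/2 \<le> norm (f x)} \<union> {x. e/2 \<le> norm (h x)}) \<inter> {x. e \<le> norm (g x)}
      = {x. e \<le> norm (g x)}"
  proof -
    have "e/2 \<le> norm (f x) \<or> e/2 \<le> norm (h x)" if "e \<le> norm (g x)" for x
      using le[of x] that by linarith
    then show ?thesis by auto
  qed
  ultimately show "compact {x. e \<le> norm (g x)}" by simp
qed

lemma C0_dominated:
  assumes f: "f \<in> C0" and g: "continuous_on UNIV g" and le: "\<And>x. norm (g x) \<le> C * norm (f x)"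
  shows "g \<in> C0"
  unfolding C0_def
proof (intro CollectI conjI allI impI g)
  fix e :: real assume e: "0 < e"
  \<comment> \<open>\<open>C\<close> may be zero or negative, while the threshold \<open>e/c\<close>
    needs a positive divisor.\<close>
  define c where "c = max C 1"
  have c: "0 < c" by (simp add: c_def)
  have le': "norm (g x) \<le> c * norm (f x)" for x
    using le[of x] mult_right_mono[of C c "norm (f x)"] by (simp add: c_def)
  have "closed {x. e \<le> norm (g x)}"
    by (intro closed_Collect_le continuous_intros g)
  then have "compact ({x. e/c \<le> norm (f x)} \<inter> {x. e \<le> norm (g x)})"
    using C0_compact[OF f, of "e/c"] e c by (intro compact_Int_closed) auto
  moreover have "{x. e/c \<le> norm (f x)} \<inter> {x. e \<le> norm (g x)} = {x. e \<le> norm (g x)}"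
  proof -
    have "e/c \<le> norm (f x)" if "e \<le> norm (g x)" for x
      using order_trans[OF that le'] c by (simp add: divide_le_eq mult.commute)
    then show ?thesis by auto
  qed
  ultimately show "compact {x. e \<le> norm (g x)}" by simp
qed

lemma C0_0 [simp]: "(\<lambda>_. 0) \<in> C0"
  by (simp add: C0_def not_le)

lemma C0_add: "f \<in> C0 \<Longrightarrow> g \<in> C0 \<Longrightarrow> (\<lambda>x. f x + g x) \<in> C0"
  by (rule C0_dominated2[of f g]) (simp_all add: continuous_on_add C0_continuous norm_triangle_ineq)

lemma C0_diff: "f \<in> C0 \<Longrightarrow> g \<in> C0 \<Longrightarrow> (\<lambda>x. f x - g x) \<in> C0"
  by (rule C0_dominated2[of f g]) (simp_all add: continuous_on_diff C0_continuous norm_triangle_ineq4)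

lemma C0_sum: "(\<And>i. i \<in> I \<Longrightarrow> f i \<in> C0) \<Longrightarrow> (\<lambda>x. \<Sum>i\<in>I. f i x) \<in> C0"
  by (induction I rule: infinite_finite_induct) (auto intro!: C0_add)

lemma C0_mult_bounded:
  fixes f :: "_ \<Rightarrow> 'b::real_normed_algebra"
  assumes "f \<in> C0" "continuous_on UNIV g" "\<And>x. norm (g x) \<le> C"
  shows "(\<lambda>x. g x * f x) \<in> C0" "(\<lambda>x. f x * g x) \<in> C0"
proof -
  have "norm (g x * f x) \<le> C * norm (f x)" "norm (f x * g x) \<le> C * norm (f x)" for x
    using norm_mult_ineq[of "g x" "f x"] norm_mult_ineq[of "f x" "g x"]
      mult_right_mono[OF assms(3)[of x] norm_ge_zero[of "f x"]]
    by (simp_all add: mult.commute)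
  then show "(\<lambda>x. g x * f x) \<in> C0" "(\<lambda>x. f x * g x) \<in> C0"
    by (blast intro: C0_dominated[OF assms(1)] continuous_on_mult assms(2) C0_continuous[OF assms(1)])+
qed

lemma C0_bounded_norm:
  assumes "f \<in> C0"
  obtains B where "0 \<le> B" "\<And>x. norm (f x) \<le> B"
proof -
  let ?K = "{x. 1 \<le> norm (f x)}"
  have "compact (f ` ?K)"
    by (rule compact_continuous_image[OF C0_continuous[OF assms] C0_compact[OF assms]]) simp
  then obtain B where "\<And>x. x \<in> ?K \<Longrightarrow> norm (f x) \<le> B"
    by (metis (no_types, lifting) bounded_iff compact_imp_bounded imageI)
  then have "norm (f x) \<le> max B 1" for x by (cases "x \<in> ?K") (auto simp: le_max_iff_disj)
  then show ?thesis using that[of "max B 1"] by simp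
qed

lemma C0_cmult:
  fixes f :: "_ \<Rightarrow> 'b::real_normed_algebra"
  shows "f \<in> C0 \<Longrightarrow> (\<lambda>x. c * f x) \<in> C0"
  by (rule C0_mult_bounded[where C = "norm c"]) auto

lemma C0_mult:
  fixes f :: "_ \<Rightarrow> 'b::real_normed_algebra"
  assumes "f \<in> C0" "g \<in> C0" shows "(\<lambda>x. f x * g x) \<in> C0"
proof -
  obtain B where "\<And>x. norm (g x) \<le> B" using C0_bounded_norm[OF assms(2)] by blast
  then show ?thesis by (rule C0_mult_bounded(2)[OF assms(1) C0_continuous[OF assms(2)]])
qed

text \<open>An approximation within \<open>e/2\<close> is at least \<open>e/2\<close> wherever
  \<open>g\<close> is at least \<open>e\<close>, which gives compactness; continuity is the uniform
  limit theorem.\<close>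

lemma C0_uniform_limit:
  assumes "\<And>e. 0 < e \<Longrightarrow> \<exists>f\<in>C0. \<forall>x. norm (g x - f x) \<le> e"
  shows "g \<in> C0"
  unfolding C0_def
proof (intro CollectI conjI allI impI)
  have "\<exists>f. f \<in> C0 \<and> (\<forall>x. norm (g x - f x) \<le> inverse (Suc n))" for n
    using assms[of "inverse (Suc n)"] by auto
  then obtain f where f: "\<And>n. f n \<in> C0" "\<And>n x. norm (g x - f n x) \<le> inverse (Suc n)" by metis
  have "uniform_limit UNIV f g sequentially"
  proof (rule uniform_limitI)
    fix e :: real assume "0 < e"
    then have "\<forall>\<^sub>F n in sequentially. inverse (Suc n) < e"
      using LIMSEQ_inverse_real_of_nat by (rule order_tendstoD(2)[rotated])
    then show "\<forall>\<^sub>F n in sequentially. \<forall>x\<in>UNIV. dist (f n x) (g x) < e"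
      by eventually_elim (use f(2) in \<open>auto simp: dist_norm norm_minus_commute intro: le_less_trans\<close>)
  qed
  then show g: "continuous_on UNIV g"
    by (rule uniform_limit_theorem[rotated]) (simp_all add: C0_continuous f)
  fix e :: real assume e: "0 < e"
  obtain h where h: "h \<in> C0" "\<And>x. norm (g x - h x) \<le> e/2" using assms[of "e/2"] e by auto
  have "closed {x. e \<le> norm (g x)}"
    by (intro closed_Collect_le continuous_intros g)
  then have "compact ({x. e/2 \<le> norm (h x)} \<inter> {x. e \<le> norm (g x)})"
    using C0_compact[OF h(1), of "e/2"] e by (intro compact_Int_closed) auto
  moreover have "e/2 \<le> norm (h x)" if "e \<le> norm (g x)" for x
    using h(2)[of x] that norm_triangle_ineq2[of "g x" "h x"] by linarith
  then have "{x. e/2 \<le> norm (h x)} \<inter> {x. e \<le> norm (g x)} = {x. e \<le> norm (g x)}" by auto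
  ultimately show "compact {x. e \<le> norm (g x)}" by simp
qed

lemma C0_of_real: "(f :: _ \<Rightarrow> real) \<in> C0 \<Longrightarrow> (\<lambda>x. of_real (f x) :: 'b::real_normed_algebra_1) \<in> C0"
  by (auto simp: C0_def intro!: continuous_intros)

lemma C0_Re: "f \<in> C0 \<Longrightarrow> (\<lambda>x. Re (f x)) \<in> C0"
  by (rule C0_dominated[where C = 1 and f = f]) (simp_all add: continuous_on_Re C0_continuous abs_Re_le_cmod)

lemma C0_Im: "f \<in> C0 \<Longrightarrow> (\<lambda>x. Im (f x)) \<in> C0"
  by (rule C0_dominated[where C = 1 and f = f]) (simp_all add: continuous_on_Im C0_continuous abs_Im_le_cmod)

text \<open>Every preimage is a union of some of \<open>Y\<close> and \<open>- Y\<close>, both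
  open.\<close>

lemma continuous_on_indicator_clopen:
  assumes "open Y" "closed Y"
  shows "continuous_on A (indicator Y :: _ \<Rightarrow> 'b::{topological_space,zero_neq_one})"
  unfolding continuous_on_open_vimage[OF open_UNIV]
proof -
  have "open (indicator Y -` B :: 'a set)" for B :: "'b set"
  proof -
    have "(indicator Y -` B :: 'a set) = (if 1 \<in> B then Y else {}) \<union> (if 0 \<in> B then - Y else {})"
      by (auto simp: indicator_def of_bool_def split: if_splits)
    then show ?thesis using assms by (auto simp: open_closed)
  qed
  then have "continuous_on UNIV (indicator Y :: _ \<Rightarrow> 'b)"
    by (simp add: continuous_on_open_vimage)
  then show ?thesis by (rule continuous_on_subset) auto
qed

lemma C0_indicator:
  fixes f :: "_ \<Rightarrow> 'b::real_normed_algebra_1"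
  assumes "f \<in> C0" "open Y" "closed Y" shows "(\<lambda>x. indicator Y x * f x) \<in> C0"
  by (rule C0_mult_bounded(1)[OF assms(1) continuous_on_indicator_clopen[OF assms(2,3)], of 1])
    (simp add: indicator_def)

lemma C0_compose_homeo:
  assumes "f \<in> C0" "continuous_on UNIV k" "continuous_on UNIV k'" "\<And>x. k' (k x) = x" "\<And>x. k (k' x) = x"
  shows "(\<lambda>x. f (k x)) \<in> C0"
  unfolding C0_def
proof (intro CollectI conjI allI impI)
  show "continuous_on UNIV (\<lambda>x. f (k x))"
    by (rule continuous_on_compose2[OF C0_continuous[OF assms(1)] assms(2)]) auto
  fix e :: real assume "0 < e"
  then have "compact (k' ` {x. e \<le> norm (f x)})"
    by (intro compact_continuous_image[OF continuous_on_subset[OF assms(3)] C0_compact[OF assms(1)]]) auto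
  moreover have "k' ` {x. e \<le> norm (f x)} = {x. e \<le> norm (f (k x))}"
    using assms(4,5) by (auto simp: image_iff) metis
  ultimately show "compact {x. e \<le> norm (f (k x))}" by simp
qed

text \<open>The function is made to vanish off an open \<open>V\<close> inside a compact
  \<open>K\<close>, so its superlevel sets are closed subsets of \<open>K\<close>.\<close>

lemma Urysohn_C0:
  fixes U :: "'x::t2_space set"
  assumes X: "locally compact (UNIV :: 'x set)" and U: "open U" "x \<in> U"
  obtains g :: "'x \<Rightarrow> real" where "g \<in> C0" "\<And>x. 0 \<le> g x" "\<And>x. g x \<le> 1" "g x = 1" "\<And>x. x \<notin> U \<Longrightarrow> g x = 0"
proof -
  obtain V K where V: "open V" "compact K" "x \<in> V" "V \<subseteq> K" "K \<subseteq> U"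
    using X U unfolding locally_def by (simp add: openin_subtopology) metis
  have lc: "locally_compact_space (euclidean :: 'x topology)"
    unfolding locally_compact_space_def
  proof (intro ballI)
    fix y :: 'x
    obtain V K where "open V" "compact K" "y \<in> V" "V \<subseteq> K"
      using X open_UNIV unfolding locally_def by (simp add: openin_subtopology) (metis UNIV_I open_UNIV)
    then show "\<exists>U K. openin euclidean U \<and> compactin euclidean K \<and> y \<in> U \<and> U \<subseteq> K" by auto
  qed
  have cr: "completely_regular_space (euclidean :: 'x topology)"
    by (rule locally_compact_regular_imp_completely_regular_space[OF lc])
       (simp add: Hausdorff_space_def disjnt_def, meson hausdorff)
  obtain g :: "'x \<Rightarrow> real" where g: "continuous_map euclidean (top_of_set {0..1}) g"
      "g ` (- V) \<subseteq> {0}" "g ` {x} \<subseteq> {1}"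
    by (rule Urysohn_completely_regular_compact_closed[of 0 1 euclidean "{x}" "- V"])
       (use V cr in auto)
  have cont: "continuous_on UNIV g" and g01: "\<And>x. 0 \<le> g x" "\<And>x. g x \<le> 1"
    using g(1) by (auto simp: continuous_map_in_subtopology)
  show ?thesis
  proof (rule that[of g])
    show "g \<in> C0" unfolding C0_def
    proof (intro CollectI conjI allI impI cont)
      fix e :: real assume "0 < e"
      have "compact (K \<inter> {x. e \<le> norm (g x)})"
        by (intro compact_Int_closed V closed_Collect_le continuous_intros cont)
      moreover have "K \<inter> {x. e \<le> norm (g x)} = {x. e \<le> norm (g x)}"
        using g(2) V(4) \<open>0 < e\<close> by force
      ultimately show "compact {x. e \<le> norm (g x)}" by simp
    qed
    show "g y = 0" if "y \<notin> U" for y using g(2) V that by auto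
  qed (use g g01 in auto)
qed

text \<open>By the Lindelof property countably many Urysohn functions already cover
  \<open>U\<close>; a weighted sum of them is positive exactly on \<open>U\<close>.\<close>

lemma open_eq_positive_C0:
  fixes U :: "'x::{second_countable_topology, t2_space} set"
  assumes X: "locally compact (UNIV :: 'x set)" and U: "open U"
  obtains f :: "'x \<Rightarrow> real" where "f \<in> C0" "\<And>x. 0 \<le> f x" "\<And>x. f x \<le> 1" "U = {x. 0 < f x}"
proof -
  have "\<exists>g :: 'x \<Rightarrow> real. g \<in> C0 \<and> (\<forall>x. 0 \<le> g x \<and> g x \<le> 1 \<and> (x \<notin> U \<longrightarrow> g x = 0)) \<and> g x = 1" if "x \<in> U" for x
    using Urysohn_C0[OF X U that] by metis
  then obtain g :: "'x \<Rightarrow> 'x \<Rightarrow> real" where g: "\<And>x. x \<in> U \<Longrightarrow> g x \<in> C0"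
    "\<And>x y. x \<in> U \<Longrightarrow> 0 \<le> g x y \<and> g x y \<le> 1 \<and> (y \<notin> U \<longrightarrow> g x y = 0)" "\<And>x. x \<in> U \<Longrightarrow> g x x = 1"
    by metis
  obtain F where F: "F \<subseteq> (\<lambda>x. {y. 0 < g x y}) ` U" "countable F" "\<Union>F = (\<Union>x\<in>U. {y. 0 < g x y})"
  proof (rule Lindelof[of "(\<lambda>x. {y. 0 < g x y}) ` U"])
    show "open S" if "S \<in> (\<lambda>x. {y. 0 < g x y}) ` U" for S
      using that g(1) by (auto intro!: open_Collect_less continuous_intros C0_continuous)
  qed auto
  obtain D where D: "D \<subseteq> U" "countable D" "F = (\<lambda>x. {y. 0 < g x y}) ` D"
    using countable_subset_image[THEN iffD1, OF conjI[OF F(2,1)]] by blast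
  have cover: "y \<in> U \<longleftrightarrow> (\<exists>x\<in>D. 0 < g x y)" for y
  proof
    assume "y \<in> U"
    then have "y \<in> \<Union>F" unfolding F(3) by (auto intro!: bexI[of _ y] simp: g(3))
    then show "\<exists>x\<in>D. 0 < g x y" using D(3) by auto
  next
    assume "\<exists>x\<in>D. 0 < g x y"
    then show "y \<in> U" using D(1) g(2) by force
  qed
  \<comment> \<open>\<open>from_nat_into\<close> enumerates only nonempty sets; if \<open>D\<close>
    is empty then so is \<open>U\<close>.\<close>
  show ?thesis
  proof (cases "D = {}")
    case True
    then show ?thesis using that[of "\<lambda>_. 0"] cover by auto
  next
    case False
    define h where "h n = g (from_nat_into D n)" for n
    have inD: "from_nat_into D n \<in> U" for n using from_nat_into[OF False, of n] D by auto
    have h: "h n \<in> C0" "0 \<le> h n x" "h n x \<le> 1" for n x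
      unfolding h_def using g inD by auto
    have "range (from_nat_into D) = D" using False D(2) by (rule range_from_nat_into)
    then have coverh: "y \<in> U \<longleftrightarrow> (\<exists>n. 0 < h n y)" for y
      unfolding h_def cover by (metis imageE rangeI)
    \<comment> \<open>The weights sum to 1, so \<open>f\<close> stays below 1, and their geometric
      tails make the partial sums converge uniformly.\<close>
    define f where "f x = (\<Sum>n. (1/2)^Suc n * h n x)" for x
    have b: "(1/2)^Suc n * h n x \<le> (1/2)^Suc n" for n x
      using h(3)[of n x] by (simp)
    have geo: "(\<lambda>n. (1/2::real)^Suc n) sums 1" using power_half_series .
    have summ: "summable (\<lambda>n. (1/2)^Suc n * h n x)" for x
      by (rule summable_comparison_test'[OF sums_summable[OF geo], of 0]) (use b h(2) in auto)
    have f0: "0 \<le> f x" for x unfolding f_def by (intro suminf_nonneg summ) (simp add: h)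
    have f1: "f x \<le> 1" for x unfolding f_def
      using suminf_le[OF b summ sums_summable[OF geo], of x] geo by (simp add: sums_iff)
    have pos: "0 < f x \<longleftrightarrow> (\<exists>n. 0 < h n x)" for x unfolding f_def
      using suminf_pos_iff[OF summ, of x] h(2)[of _ x] by (simp add: zero_less_mult_iff)
    have "f \<in> C0"
    proof (rule C0_uniform_limit)
      fix e :: real assume e: "0 < e"
      obtain m where m: "(1/2::real)^m < e" using real_arch_pow_inv[of e "1/2"] e by auto
      let ?s = "\<lambda>x. \<Sum>n<m. (1/2)^Suc n * h n x"
      have "norm (f x - ?s x) \<le> e" for x
      proof -
        have "f x - ?s x = (\<Sum>n. (1/2)^Suc (n + m) * h (n + m) x)"
          unfolding f_def using suminf_split_initial_segment[OF summ, of x m] by simp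
        moreover have "\<dots> \<le> (\<Sum>n. (1/2)^m * (1/2)^Suc n)"
        proof (rule suminf_le)
          show "(1/2)^Suc (n + m) * h (n + m) x \<le> (1/2)^m * (1/2)^Suc n" for n
            using b[of "n+m" x] by (simp add: power_add)
          show "summable (\<lambda>n. (1/2)^Suc (n + m) * h (n + m) x)"
            using summable_ignore_initial_segment[OF summ, of m x] by simp
          show "summable (\<lambda>n. (1/2::real)^m * (1/2)^Suc n)"
            by (intro summable_mult sums_summable[OF geo])
        qed
        moreover have "(\<Sum>n. (1/2)^m * (1/2)^Suc n) = (1/2::real)^m"
          using sums_mult[OF geo, of "(1/2)^m"] by (simp add: sums_iff)
        moreover have "0 \<le> (\<Sum>n. (1/2)^Suc (n + m) * h (n + m) x)"
          using summable_ignore_initial_segment[OF summ, of m x] h(2) by (intro suminf_nonneg) auto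
        ultimately show ?thesis using m by simp
      qed
      moreover have "?s \<in> C0" by (intro C0_sum C0_cmult h)
      ultimately show "\<exists>s\<in>C0. \<forall>x. norm (f x - s x) \<le> e" by (intro bexI[of _ ?s]) auto
    qed
    then show ?thesis using that[of f] f0 f1 coverh pos by (auto simp: set_eq_iff)
  qed
qed

text \<open>Off the compact set where \<open>h 0\<close> is at least \<open>e\<close>, monotonicity
  suffices; on it a finite subcover does.\<close>

lemma C0_Dini:
  fixes h :: "nat \<Rightarrow> 'x::topological_space \<Rightarrow> real"
  assumes h: "\<And>n. h n \<in> C0" and dec: "\<And>x. decseq (\<lambda>n. h n x)" and lim: "\<And>x. (\<lambda>n. h n x) \<longlonglongrightarrow> 0" and e: "0 < e"
  shows "\<exists>n. \<forall>x. h n x < e"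
proof -
  have K: "compact {x. e \<le> norm (h 0 x)}" using C0_compact[OF h e] .
  have cover: "{x. e \<le> norm (h 0 x)} \<subseteq> (\<Union>n\<in>UNIV. {x. h n x < e})"
  proof
    fix x
    obtain n where "h n x < e"
      using order_tendstoD(2)[OF lim e, of x] by (auto simp: eventually_sequentially)
    then show "x \<in> (\<Union>n\<in>UNIV. {x. h n x < e})" by blast
  qed
  have op: "open {x. h n x < e}" for n
    using C0_continuous[OF h[of n]] by (intro open_Collect_less continuous_on_const)
  obtain N where N: "finite N" "{x. e \<le> norm (h 0 x)} \<subseteq> (\<Union>n\<in>N. {x. h n x < e})"
    using compactE_image[OF K op cover] by metis
  \<comment> \<open>Inserting 0 keeps \<open>Max\<close> defined when the finite subcover is
    empty.\<close>
  have "h (Max (insert 0 N)) x < e" for x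
  proof (cases "e \<le> norm (h 0 x)")
    case True
    then have "x \<in> (\<Union>n\<in>N. {x. h n x < e})" by (intro subsetD[OF N(2)] CollectI)
    then obtain n where "n \<in> N" "h n x < e" by blast
    moreover have "h (Max (insert 0 N)) x \<le> h n x"
      by (rule decseqD[OF dec]) (simp add: N(1) \<open>n \<in> N\<close>)
    ultimately show ?thesis by simp
  next
    case False
    moreover have "h (Max (insert 0 N)) x \<le> h 0 x"
      by (rule decseqD[OF dec]) simp
    ultimately show ?thesis by auto
  qed
  then show ?thesis by blast
qed

section \<open>Finite Borel measures\<close>

lemma saturate_square_range:
  assumes "0 \<le> (c :: real)"
  shows "0 \<le> (real n * c / (1 + real n * c))\<^sup>2" "(real n * c / (1 + real n * c))\<^sup>2 \<le> 1"
proof -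
  have "0 \<le> real n * c" using assms by simp
  then have "0 \<le> real n * c / (1 + real n * c)" "real n * c / (1 + real n * c) \<le> 1"
    by (auto simp: divide_le_eq)
  then show "0 \<le> (real n * c / (1 + real n * c))\<^sup>2" "(real n * c / (1 + real n * c))\<^sup>2 \<le> 1"
    by (auto simp: power_le_one)
qed

text \<open>The map sending \<open>c\<close> to \<open>n c / (1 + n c)\<close> tends to the
  indicator of positivity, so the mass of an open set is a limit of integrals of squares of
  \<open>C0\<close> functions.\<close>

lemma saturate_LIMSEQ:
  fixes K :: "'x::topological_space measure"
  assumes K: "finite_measure K" "sets K = sets borel" and f: "continuous_on UNIV f" "\<And>x. 0 \<le> f x"
  shows "(\<lambda>n. \<integral>x. (real n * f x / (1 + real n * f x))\<^sup>2 \<partial>K) \<longlonglongrightarrow> measure K {x. 0 < f x}"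
proof -
  interpret finite_measure K by fact
  have [measurable]: "f \<in> borel_measurable K"
    using borel_measurable_continuous_onI[OF f(1)] K(2) by (simp cong: measurable_cong_sets)
  have sp: "space K = UNIV" using sets_eq_imp_space_eq[OF K(2)] by simp
  have "(\<lambda>n. \<integral>x. (real n * f x / (1 + real n * f x))\<^sup>2 \<partial>K) \<longlonglongrightarrow> (\<integral>x. indicator {x. 0 < f x} x \<partial>K)"
  proof (rule integral_dominated_convergence[where w = "\<lambda>_. 1"])
    have *: "(\<lambda>n. (real n * f x / (1 + real n * f x))\<^sup>2) \<longlonglongrightarrow> indicator {x. 0 < f x} x" for x
    proof (cases "f x = 0")
      case False
      then have "0 < f x" using f(2)[of x] by simp
      moreover have "(\<lambda>n. (real n * c / (1 + real n * c))\<^sup>2) \<longlonglongrightarrow> 1" if "0 < c" for c :: real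
        using that by real_asymp
      ultimately show ?thesis by simp
    qed simp
    then show "AE x in K. (\<lambda>n. (real n * f x / (1 + real n * f x))\<^sup>2) \<longlonglongrightarrow> indicator {x. 0 < f x} x"
      by simp
    have "norm ((real n * f x / (1 + real n * f x))\<^sup>2) \<le> 1" for n x
      using saturate_square_range[OF f(2)] by simp
    then show "AE x in K. norm ((real n * f x / (1 + real n * f x))\<^sup>2) \<le> 1" for n by simp
  qed (auto simp: sp)
  moreover have "{x. 0 < f x} \<in> sets K"
    using f(1) by (auto simp: K(2) intro!: borel_open open_Collect_less continuous_intros)
  ultimately show ?thesis by simp
qed

lemma C0_saturate:
  fixes f :: "'x::topological_space \<Rightarrow> real"
  assumes f: "f \<in> C0" "\<And>x. 0 \<le> f x"
  shows "(\<lambda>x. real n * f x / (1 + real n * f x)) \<in> C0"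
proof (rule C0_dominated[OF f(1), where C = "real n"])
  have pos: "0 < 1 + real n * f x" for x using f(2)[of x] by (simp add: add_pos_nonneg)
  then have "1 + real n * f x \<noteq> 0" for x by (metis less_irrefl)
  then show "continuous_on UNIV (\<lambda>x. real n * f x / (1 + real n * f x))"
    using C0_continuous[OF f(1)] by (intro continuous_intros) auto
  show "norm (real n * f x / (1 + real n * f x)) \<le> real n * norm (f x)" for x
    using pos[of x] f(2)[of x] mult_left_mono[of 1 "1 + real n * f x" "real n * f x"]
    by (simp add: divide_le_eq)
qed

text \<open>Squares suffice because indicators of open sets are limits of squares; open sets then
  form an intersection-stable generator.\<close>

lemma finite_borel_measure_eqI:
  fixes M N :: "'x::{second_countable_topology, t2_space} measure"
  assumes X: "locally compact (UNIV :: 'x set)"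
    and M: "finite_measure M" "sets M = sets borel" and N: "finite_measure N" "sets N = sets borel"
    and eq: "\<And>f :: 'x \<Rightarrow> real. f \<in> C0 \<Longrightarrow> (\<And>x. 0 \<le> f x) \<Longrightarrow> (\<integral>x. (f x)\<^sup>2 \<partial>M) = (\<integral>x. (f x)\<^sup>2 \<partial>N)"
  shows "M = N"
proof -
  interpret M: finite_measure M by fact
  interpret N: finite_measure N by fact
  have open_eq: "emeasure M U = emeasure N U" if U: "open U" for U
  proof -
    obtain f :: "'x \<Rightarrow> real" where f: "f \<in> C0" "\<And>x. 0 \<le> f x" "U = {x. 0 < f x}"
      using open_eq_positive_C0[OF X U] by metis
    have "(\<integral>x. (real n * f x / (1 + real n * f x))\<^sup>2 \<partial>M) = (\<integral>x. (real n * f x / (1 + real n * f x))\<^sup>2 \<partial>N)" for n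
      by (rule eq[OF C0_saturate[OF f(1,2)]]) (use f(2) in \<open>simp add: divide_nonneg_nonneg\<close>)
    then have "measure M U = measure N U"
      using saturate_LIMSEQ[OF M C0_continuous[OF f(1)] f(2)] saturate_LIMSEQ[OF N C0_continuous[OF f(1)] f(2)] f(3)
      by (simp add: LIMSEQ_unique)
    then show ?thesis by (simp add: M.emeasure_eq_measure N.emeasure_eq_measure)
  qed
  show ?thesis
  proof (rule measure_eqI_generator_eq[where E = "{S. open S}" and \<Omega> = UNIV and A = "\<lambda>_. UNIV"])
    show "Int_stable {S :: 'x set. open S}" by (auto simp: Int_stable_def)
  qed (auto simp: M N open_eq borel_def)
qed

text \<open>The functions serve twice: as coordinates of an embedding for outer regularity, and to
  separate points when fixed points are cut away.\<close>

lemma C0_basis: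
  assumes X: "locally compact (UNIV :: 'x::{second_countable_topology, t2_space} set)"
  obtains h :: "nat \<Rightarrow> 'x::{second_countable_topology, t2_space} \<Rightarrow> real"
    where "\<And>n. h n \<in> C0" "\<And>U x. open U \<Longrightarrow> x \<in> U \<Longrightarrow> \<exists>n. 0 < h n x \<and> {y. 0 < h n y} \<subseteq> U"
proof -
  obtain B :: "'x set set" where B: "countable B" "topological_basis B"
    using ex_countable_basis by blast
  have ne: "B \<noteq> {}" using B(2) unfolding topological_basis_def by (metis UNIV_not_empty Union_empty open_UNIV subset_empty)
  define b where "b = from_nat_into B"
  have rb: "range b = B" unfolding b_def by (rule range_from_nat_into[OF ne B(1)])
  have "\<exists>h :: 'x \<Rightarrow> real. h \<in> C0 \<and> b n = {x. 0 < h x}" for n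
  proof -
    have "open (b n)" using rb topological_basis_open[OF B(2)] by blast
    then show ?thesis using open_eq_positive_C0[OF X] by metis
  qed
  then obtain h :: "nat \<Rightarrow> 'x \<Rightarrow> real" where h: "\<And>n. h n \<in> C0" "\<And>n. b n = {x. 0 < h n x}" by metis
  have "\<exists>n. 0 < h n x \<and> {y. 0 < h n y} \<subseteq> U" if U: "open U" "x \<in> U" for U x
  proof -
    obtain C where C: "C \<in> B" "x \<in> C" "C \<subseteq> U"
      using topological_basisE[OF B(2) U] by metis
    then obtain n where "C = b n" using rb by blast
    then show ?thesis using C h(2) by blast
  qed
  then show ?thesis using that h(1) by blast
qed

text \<open>
  Outer regularity is pulled back from \<open>\<real>\<^sup>\<nat>\<close> along the map whose coordinates are the
  functions of \<open>C0_basis\<close>; this map generates the topology of the space.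
\<close>

lemma finite_borel_measure_outer_regular:
  fixes M :: "'x::{second_countable_topology, t2_space} measure"
  assumes X: "locally compact (UNIV :: 'x set)"
    and M: "finite_measure M" "sets M = sets borel" and Z: "Z \<in> sets borel" and e: "0 < e"
  obtains U where "open U" "Z \<subseteq> U" "measure M U < measure M Z + e"
proof -
  interpret finite_measure M by fact
  obtain h :: "nat \<Rightarrow> 'x \<Rightarrow> real" where h: "\<And>n. h n \<in> C0"
    "\<And>U x. open U \<Longrightarrow> x \<in> U \<Longrightarrow> \<exists>n. 0 < h n x \<and> {y. 0 < h n y} \<subseteq> U"
    using C0_basis[OF X] by blast
  define \<iota> where "\<iota> = (\<lambda>x n. h n x)"
  have cont: "continuous_on UNIV \<iota>"
    unfolding \<iota>_def by (intro continuous_on_coordinatewise_then_product C0_continuous[OF h(1)])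
  have pull: "\<exists>W \<in> sets borel. Z = \<iota> -` W" if "Z \<in> sets borel" for Z
  proof -
    have "Z \<in> sigma_sets UNIV {S. open S}" using that by (simp add: borel_def)
    then show ?thesis
    proof (induction rule: sigma_sets.induct)
      case (Basic U)
      then have "open U" by simp
      \<comment> \<open>The positivity sets contained in \<open>U\<close> cover \<open>U\<close>, so
        \<open>U\<close> is the preimage of a union of open half-spaces.\<close>
      have "open {z :: nat \<Rightarrow> real. 0 < z n}" for n
        by (intro open_Collect_less continuous_on_const continuous_on_product_coordinates)
      then have op: "open (\<Union>n\<in>{n. {y. 0 < h n y} \<subseteq> U}. {z :: nat \<Rightarrow> real. 0 < z n})" by blast
      have "U = \<iota> -` (\<Union>n\<in>{n. {y. 0 < h n y} \<subseteq> U}. {z. 0 < z n})"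
      proof -
        have "\<exists>n. {y. 0 < h n y} \<subseteq> U \<and> 0 < h n x" if "x \<in> U" for x
          using h(2)[OF \<open>open U\<close> that] by blast
        then show ?thesis by (auto simp: \<iota>_def)
      qed
      then show ?case using borel_open[OF op] by blast
    next
      case Empty
      then show ?case by (intro bexI[of _ "{}"]) auto
    next
      case (Compl a)
      then obtain W where "W \<in> sets borel" "a = \<iota> -` W" by blast
      then show ?case by (intro bexI[of _ "- W"]) auto
    next
      case (Union a)
      then obtain W where "\<And>i. W i \<in> sets borel" "\<And>i. a i = \<iota> -` W i" by metis
      then show ?case by (intro bexI[of _ "\<Union>i. W i"]) auto
    qed
  qed
  obtain W where W: "W \<in> sets borel" "Z = \<iota> -` W" using pull[OF Z] by blast
  have meas: "\<iota> \<in> M \<rightarrow>\<^sub>M borel"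
    using borel_measurable_continuous_onI[OF cont] M(2) by (simp cong: measurable_cong_sets)
  have sp: "space M = UNIV" using sets_eq_imp_space_eq[OF M(2)] by simp
  interpret D: finite_measure "distr M borel \<iota>" by (rule finite_measure_distr[OF meas])
  have "emeasure (distr M borel \<iota>) W = (INF U\<in>{U. W \<subseteq> U \<and> open U}. emeasure (distr M borel \<iota>) U)"
    by (rule outer_regular) (auto simp: W meas D.emeasure_eq_measure)
  also have "emeasure (distr M borel \<iota>) W = emeasure M Z"
    by (simp add: emeasure_distr[OF meas W(1)] W(2) sp)
  finally have "(INF U\<in>{U. W \<subseteq> U \<and> open U}. emeasure (distr M borel \<iota>) U) < emeasure M Z + ennreal e"
    using e by (auto simp: emeasure_eq_measure simp flip: ennreal_plus intro!: exI[of _ UNIV])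
  then obtain V where V: "W \<subseteq> V" "open V" "emeasure (distr M borel \<iota>) V < emeasure M Z + ennreal e"
    unfolding INF_less_iff by blast
  show ?thesis
  proof (rule that[of "\<iota> -` V"])
    show "open (\<iota> -` V)" using cont V(2) by (simp add: continuous_on_open_vimage)
    show "Z \<subseteq> \<iota> -` V" using V(1) W(2) by auto
    have "emeasure M (\<iota> -` V) < emeasure M Z + ennreal e"
      using V(3) by (simp add: emeasure_distr[OF meas] borel_open[OF V(2)] sp)
    then show "measure M (\<iota> -` V) < measure M Z + e"
      using e by (simp add: emeasure_eq_measure ennreal_less_iff flip: ennreal_plus)
  qed
qed

section \<open>The Riesz representation theorem\<close>

lemma C0_max: "f \<in> C0 \<Longrightarrow> g \<in> C0 \<Longrightarrow> (\<lambda>x. max (f x) (g x) :: real) \<in> C0"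
  by (rule C0_dominated2[of f g]) (auto simp: continuous_on_max C0_continuous)

lemma C0_min: "f \<in> C0 \<Longrightarrow> g \<in> C0 \<Longrightarrow> (\<lambda>x. min (f x) (g x) :: real) \<in> C0"
  by (rule C0_dominated2[of f g]) (auto simp: continuous_on_min C0_continuous)

lemma C0_min_const:
  assumes "f \<in> C0" "\<And>x. 0 \<le> f x" "0 \<le> c" shows "(\<lambda>x. min (f x) c :: real) \<in> C0"
  by (rule C0_dominated[OF assms(1), where C = 1])
    (use assms in \<open>simp_all add: continuous_on_min C0_continuous\<close>)

text \<open>Half-open strips are used so that differences split into disjoint strips and the family
  is a semiring.\<close>

definition between :: "('x \<Rightarrow> real) \<Rightarrow> ('x \<Rightarrow> real) \<Rightarrow> ('x \<times> real) set" where
  "between f g = {(x, t). f x \<le> t \<and> t < g x}"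

lemma between_slice: "Pair x -` between f g = {f x..<g x}"
  by (auto simp: between_def)

text \<open>
  The Riesz representation theorem is obtained as in Dudley's proof of the Daniell--Stone theorem:
  the functional gives the area between the graphs of two functions, Dini's theorem makes these
  areas countably additive, and Caratheodory's theorem extends them to a measure on
  \<open>X \<times> \<real>\<close>. The measure of \<open>Z\<close> is then that of \<open>Z \<times> [0,1)\<close>.
\<close>

locale C0_functional =
  fixes L :: "('x::{second_countable_topology, t2_space} \<Rightarrow> real) \<Rightarrow> real" and B :: real
  assumes X: "locally compact (UNIV :: 'x set)"
    and add: "f \<in> C0 \<Longrightarrow> g \<in> C0 \<Longrightarrow> L (\<lambda>x. f x + g x) = L f + L g"
    and scale: "f \<in> C0 \<Longrightarrow> L (\<lambda>x. c * f x) = c * L f"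
    and pos: "f \<in> C0 \<Longrightarrow> (\<And>x. 0 \<le> f x) \<Longrightarrow> 0 \<le> L f"
    and bd: "f \<in> C0 \<Longrightarrow> (\<And>x. 0 \<le> f x) \<Longrightarrow> (\<And>x. f x \<le> 1) \<Longrightarrow> L f \<le> B"
begin

lemma zero: "L (\<lambda>x. 0) = 0"
  using scale[of "\<lambda>x. 0" 0] by simp

lemma diff: "f \<in> C0 \<Longrightarrow> g \<in> C0 \<Longrightarrow> L (\<lambda>x. f x - g x) = L f - L g"
  using add[of f "\<lambda>x. (-1) * g x"] scale[of g "-1"] C0_cmult[of g "-1"] by simp

lemma sum: "(\<And>i. i \<in> I \<Longrightarrow> f i \<in> C0) \<Longrightarrow> L (\<lambda>x. \<Sum>i\<in>I. f i x) = (\<Sum>i\<in>I. L (f i))"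
proof (induction I rule: infinite_finite_induct)
  case (insert i I)
  then have "L (\<lambda>x. f i x + (\<Sum>i\<in>I. f i x)) = L (f i) + L (\<lambda>x. \<Sum>i\<in>I. f i x)"
    by (intro add C0_sum) auto
  then show ?case using insert by simp
qed (simp_all add: zero)

lemma mono: "f \<in> C0 \<Longrightarrow> g \<in> C0 \<Longrightarrow> (\<And>x. f x \<le> g x) \<Longrightarrow> L f \<le> L g"
  using pos[OF C0_diff, of g f] diff[of g f] by simp

lemma B_nonneg: "0 \<le> B"
  using bd[of "\<lambda>_. 0"] zero by simp

definition ordered_pair :: "('x \<Rightarrow> real) \<Rightarrow> ('x \<Rightarrow> real) \<Rightarrow> bool" where
  "ordered_pair f g \<longleftrightarrow> f \<in> C0 \<and> g \<in> C0 \<and> (\<forall>x. f x \<le> g x)"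

definition area :: "('x \<Rightarrow> real) \<Rightarrow> ('x \<Rightarrow> real) \<Rightarrow> ennreal" where
  "area f g = ennreal (L (\<lambda>x. g x - f x))"

definition area_measure :: "('x \<times> real) measure" where
  "area_measure = extend_measure UNIV {(f, g). ordered_pair f g} (\<lambda>(f, g). between f g) (\<lambda>(f, g). area f g)"

lemma semiring: "semiring_of_sets UNIV {between f g | f g. ordered_pair f g}"
proof
  have "between (\<lambda>_. 0) (\<lambda>_ :: 'x. 0) = {}" "ordered_pair (\<lambda>_. 0) (\<lambda>_ :: 'x. 0)"
    by (auto simp: between_def ordered_pair_def)
  then show "{} \<in> {between f g | f g. ordered_pair f g}" by blast
next
  fix a b assume "a \<in> {between f g | f g. ordered_pair f g}" "b \<in> {between f g | f g. ordered_pair f g}"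
  then obtain f g f' g' where ab: "a = between f g" "ordered_pair f g" "b = between f' g'" "ordered_pair f' g'"
    by blast
  \<comment> \<open>The outer maximum in \<open>?v\<close> keeps the pair ordered at points where
    the intersection has an empty slice.\<close>
  let ?u = "\<lambda>x. max (f x) (f' x)" and ?v = "\<lambda>x. max (max (f x) (f' x)) (min (g x) (g' x))"
  have "a \<inter> b = between ?u ?v" by (auto simp: ab between_def less_max_iff_disj)
  moreover have "ordered_pair ?u ?v"
    using ab by (auto simp: ordered_pair_def intro!: C0_max C0_min)
  ultimately show "a \<inter> b \<in> {between f g | f g. ordered_pair f g}" by blast
  \<comment> \<open>The difference consists of the part of the first strip below \<open>f'\<close>
    and the part from \<open>g'\<close> upward, both clipped to lie between \<open>f\<close> and
    \<open>g\<close>.\<close>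
  let ?w = "\<lambda>x. max (f x) (min (g x) (f' x))" and ?z = "\<lambda>x. min (g x) (max (f x) (g' x))"
  have wz: "ordered_pair f ?w" "ordered_pair ?z g"
    using ab by (auto simp: ordered_pair_def intro!: C0_max C0_min)
  have "a - b = between f ?w \<union> between ?z g"
    by (auto simp: ab between_def less_max_iff_disj min_le_iff_disj not_le)
  moreover have "between f ?w \<inter> between ?z g = {}"
  proof -
    have "False" if "t < ?w x" "?z x \<le> t" for x t
    proof -
      have "t < f x \<or> t < g x \<and> t < f' x" "g x \<le> t \<or> f x \<le> t \<and> g' x \<le> t"
        using that by (auto simp: less_max_iff_disj min_le_iff_disj)
      moreover have "f x \<le> g x" "f' x \<le> g' x" using ab(2,4) by (auto simp: ordered_pair_def)
      ultimately show ?thesis by linarith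
    qed
    then show ?thesis by (auto simp: between_def)
  qed
  ultimately show "\<exists>C\<subseteq>{between f g | f g. ordered_pair f g}. finite C \<and> disjoint C \<and> a - b = \<Union> C"
    using wz by (intro exI[of _ "{between f ?w, between ?z g}"]) (auto simp: disjoint_def)
qed auto

lemma measure_between_slice:
  "ordered_pair f g \<Longrightarrow> measure lborel (Pair x -` between f g) = g x - f x"
  by (simp add: between_slice ordered_pair_def)

text \<open>Heights are Lebesgue measures of vertical slices, so countable additivity on each slice
  gives the sum.\<close>

lemma between_UN_sums:
  assumes "\<And>n. ordered_pair (a n) (b n)" "ordered_pair f g"
    and "disjoint_family (\<lambda>n. between (a n) (b n))" "(\<Union>n. between (a n) (b n)) = between f g"
  shows "(\<lambda>n. b n x - a n x) sums (g x - f x)"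
proof -
  have "(\<lambda>n. measure lborel (Pair x -` between (a n) (b n))) sums measure lborel (\<Union>n. Pair x -` between (a n) (b n))"
  proof (rule measure_UNION)
    show "disjoint_family (\<lambda>n. Pair x -` between (a n) (b n))"
      using assms(3) by (auto simp: disjoint_family_on_def)
    have "(\<Union>n. Pair x -` between (a n) (b n)) = {f x..<g x}"
      unfolding between_slice[symmetric] assms(4)[symmetric] by auto
    then show "emeasure lborel (\<Union>n. Pair x -` between (a n) (b n)) \<noteq> \<infinity>"
      using assms(2) by (simp add: ordered_pair_def)
  qed (auto simp: between_slice)
  moreover have "(\<Union>n. Pair x -` between (a n) (b n)) = Pair x -` between f g"
    unfolding assms(4)[symmetric] by auto
  ultimately show ?thesis using measure_between_slice[OF assms(1)] measure_between_slice[OF assms(2)] by simp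
qed

lemma area_sums:
  assumes op: "\<And>n. ordered_pair (a n) (b n)" "ordered_pair f g"
    and "disjoint_family (\<lambda>n. between (a n) (b n))" "(\<Union>n. between (a n) (b n)) = between f g"
  shows "(\<Sum>n. area (a n) (b n)) = area f g"
proof -
  have ab: "(\<lambda>x. b n x - a n x) \<in> C0" "a n x \<le> b n x" for n x
    using op(1)[of n] by (auto simp: ordered_pair_def intro: C0_diff)
  have fg: "(\<lambda>x. g x - f x) \<in> C0" "f x \<le> g x" for x
    using op(2) by (auto simp: ordered_pair_def intro: C0_diff)
  \<comment> \<open>The height not yet covered after \<open>n\<close> strips; it decreases pointwise
    to 0.\<close>
  define h where "h n x = (g x - f x) - (\<Sum>i<n. b i x - a i x)" for n x
  have hC0: "h n \<in> C0" for n unfolding h_def by (intro C0_diff[OF fg(1)] C0_sum ab)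
  have lim: "(\<lambda>n. h n x) \<longlonglongrightarrow> 0" for x
    using tendsto_diff[OF tendsto_const between_UN_sums[OF assms, unfolded sums_def, of x], of "g x - f x"]
    by (simp add: h_def)
  have dec: "decseq (\<lambda>n. h n x)" for x
    by (rule decseq_SucI) (use ab(2)[of _ x] in \<open>simp add: h_def\<close>)
  have h0: "0 \<le> h n x" for n x using decseq_ge[OF dec lim] .
  have Lh: "L (h n) = L (\<lambda>x. g x - f x) - (\<Sum>i<n. L (\<lambda>x. b i x - a i x))" for n
    unfolding h_def using diff[OF fg(1) C0_sum[of "{..<n}", OF ab(1)]] sum[of "{..<n}", OF ab(1)] by simp
  have "(\<lambda>n. L (h n)) \<longlonglongrightarrow> 0"
  proof (rule LIMSEQ_I)
    fix r :: real assume r: "0 < r"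
    \<comment> \<open>A remainder below \<open>e\<close> has value at most \<open>e * B\<close>,
      which is below \<open>r\<close>; adding 1 covers the case \<open>B = 0\<close>.\<close>
    define e where "e = r / (B + 1)"
    have e: "0 < e" using r B_nonneg by (simp add: e_def)
    obtain n where n: "\<And>x. h n x < e" using C0_Dini[OF hC0 dec lim e] by blast
    have "norm (L (h m) - 0) < r" if "n \<le> m" for m
    proof -
      have hm: "h m x \<le> e" for x using n[of x] decseqD[OF dec that, of x] by linarith
      have "L (\<lambda>x. inverse e * h m x) \<le> B"
        by (intro bd C0_cmult hC0) (use e h0 hm in \<open>auto simp: field_simps\<close>)
      then have "inverse e * L (h m) \<le> B" unfolding scale[OF hC0] .
      then have "L (h m) \<le> e * B" using e by (simp add: field_simps)
      also have "\<dots> < r" using r B_nonneg by (simp add: e_def field_simps)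
      finally show ?thesis using pos[OF hC0[of m] h0] by simp
    qed
    then show "\<exists>no. \<forall>n\<ge>no. norm (L (h n) - 0) < r" by blast
  qed
  from tendsto_diff[OF tendsto_const this, of "L (\<lambda>x. g x - f x)"]
  have "(\<lambda>n. L (\<lambda>x. b n x - a n x)) sums L (\<lambda>x. g x - f x)"
    by (simp add: Lh sums_def)
  then have "(\<lambda>n. area (a n) (b n)) sums area f g"
    unfolding area_def using ab fg by (subst sums_ennreal) (auto intro!: pos)
  then show ?thesis by (simp add: sums_iff)
qed

text \<open>On an empty slice the set forgets both endpoints but not their difference, so the area
  is a function of the set alone.\<close>

lemma between_eq_imp:
  assumes "ordered_pair f g" "ordered_pair f' g'" "between f g = between f' g'"
  shows "g x - f x = g' x - f' x"
  using measure_between_slice[OF assms(1)] measure_between_slice[OF assms(2)] assms(3) by simp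

lemma area_measure_between:
  assumes "ordered_pair f g"
  shows "emeasure area_measure (between f g) = area f g" "between f g \<in> sets area_measure"
proof -
  show "emeasure area_measure (between f g) = area f g"
  proof (rule extend_measure_caratheodory_pair[OF area_measure_def assms semiring])
    show "area f g = area f' g'" if "ordered_pair f g" "ordered_pair f' g'" "between f g = between f' g'" for f g f' g'
      using between_eq_imp[OF that] by (simp add: area_def)
    show "area f g = 0" if "ordered_pair f g" "between f g = {}" for f g
    proof -
      have "ordered_pair (\<lambda>_. 0) (\<lambda>_. 0)" "between (\<lambda>_. 0) (\<lambda>_ :: 'x. 0) = {}"
        by (auto simp: between_def ordered_pair_def)
      then have "g x - f x = 0 - 0" for x using that by (intro between_eq_imp) auto
      then show ?thesis by (simp add: area_def zero)
    qed
  qed (auto intro: area_sums)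
  show "between f g \<in> sets area_measure"
    unfolding area_measure_def using assms by (subst sets_extend_measure) (auto intro: sigma_sets.Basic)
qed

lemma space_area_measure: "space area_measure = UNIV"
  unfolding area_measure_def by (rule space_extend_measure) simp

text \<open>If \<open>U\<close> is the positivity set of \<open>f\<close>, the strips under
  \<open>min (n f) 1\<close> increase to the cylinder, and their areas are values of
  \<open>L\<close> on functions between 0 and 1.\<close>

lemma cylinder:
  assumes U: "open U"
  shows "U \<times> {0..<1} \<in> sets area_measure" "emeasure area_measure (U \<times> {0..<1}) \<le> ennreal B"
proof -
  obtain f :: "'x \<Rightarrow> real" where f: "f \<in> C0" "\<And>x. 0 \<le> f x" "U = {x. 0 < f x}"
    using open_eq_positive_C0[OF X U] by metis
  let ?A = "\<lambda>n. between (\<lambda>_. 0) (\<lambda>x. min (real n * f x) 1)"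
  have C0: "(\<lambda>x. min (real n * f x) 1) \<in> C0" for n
    by (rule C0_min_const) (auto intro: C0_cmult simp: f)
  have op: "ordered_pair (\<lambda>_. 0) (\<lambda>x. min (real n * f x) 1)" for n
    using f(2) C0 by (auto simp: ordered_pair_def)
  have eq: "U \<times> {0..<1} = (\<Union>n. ?A n)"
  proof (intro equalityI subsetI)
    fix z :: "'x \<times> real" assume "z \<in> U \<times> {0..<1}"
    then obtain x and t :: real where z: "z = (x, t)" "0 < f x" "0 \<le> t" "t < 1" using f(3) by auto
    obtain n where "t < real n * f x" using reals_Archimedean3[OF z(2)] by blast
    then show "z \<in> (\<Union>n. ?A n)" using z by (auto simp: between_def)
  next
    fix z assume "z \<in> (\<Union>n. ?A n)"
    then obtain n x and t :: real where z: "z = (x, t)" "0 \<le> t" "t < real n * f x" "t < 1" by (auto simp: between_def)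
    then have "0 < real n * f x" by linarith
    then have "0 < f x" using f(2)[of x] by (simp add: zero_less_mult_iff)
    then show "z \<in> U \<times> {0..<1}" using z f(3) by auto
  qed
  have sets: "range ?A \<subseteq> sets area_measure" using area_measure_between(2)[OF op] by auto
  show "U \<times> {0..<1} \<in> sets area_measure" unfolding eq using sets by auto
  have "mono ?A"
  proof (rule monoI)
    fix m n :: nat assume "m \<le> n"
    then have "real m * f x \<le> real n * f x" for x using f(2) by (intro mult_right_mono) auto
    then show "?A m \<subseteq> ?A n" by (auto simp: between_def intro: less_le_trans)
  qed
  then have "emeasure area_measure (U \<times> {0..<1}) = (SUP n. emeasure area_measure (?A n))"
    unfolding eq by (rule SUP_emeasure_incseq[OF sets, symmetric])
  also have "\<dots> \<le> ennreal B"
  proof (rule SUP_least)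
    fix n show "emeasure area_measure (?A n) \<le> ennreal B"
      unfolding area_measure_between(1)[OF op] area_def
      using bd[OF C0[of n]] f(2) by (intro ennreal_leI) auto
  qed
  finally show "emeasure area_measure (U \<times> {0..<1}) \<le> ennreal B" .
qed

definition rep_measure :: "'x measure" where
  "rep_measure = distr (restrict_space area_measure (UNIV \<times> {0..<1})) borel fst"

lemma fst_measurable: "fst \<in> restrict_space area_measure (UNIV \<times> {0..<1}) \<rightarrow>\<^sub>M borel"
proof (rule borel_measurableI)
  fix S :: "'x set" assume S: "open S"
  have "fst -` S \<inter> (UNIV \<times> {0..<1}) = (S \<times> {0..<1} :: ('x \<times> real) set)" by auto
  then show "fst -` S \<inter> space (restrict_space area_measure (UNIV \<times> {0..<1})) \<in> sets (restrict_space area_measure (UNIV \<times> {0..<1}))"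
    using cylinder(1)[OF S] by (auto simp: space_restrict_space space_area_measure sets_restrict_space)
qed

lemma sets_rep_measure [simp, measurable_cong]: "sets rep_measure = sets borel"
  by (simp add: rep_measure_def)

lemma emeasure_rep_measure:
  assumes Z: "Z \<in> sets borel"
  shows "emeasure rep_measure Z = emeasure area_measure (Z \<times> {0..<1})" "Z \<times> {0..<1} \<in> sets area_measure"
proof -
  let ?R = "restrict_space area_measure (UNIV \<times> {0..<1})"
  have eq: "fst -` Z \<inter> space ?R = (Z \<times> {0..<1} :: ('x \<times> real) set)"
    by (auto simp: space_restrict_space space_area_measure)
  have sR: "sets ?R = {A \<in> sets area_measure. A \<subseteq> UNIV \<times> {0..<1}}"
    using cylinder(1)[OF open_UNIV] by (simp add: sets_restrict_space_iff sets_restrict_space Int_commute) (auto simp: image_iff)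
  then show "Z \<times> {0..<1} \<in> sets area_measure"
    using measurable_sets[OF fst_measurable Z] unfolding eq by auto
  show "emeasure rep_measure Z = emeasure area_measure (Z \<times> {0..<1})"
    unfolding rep_measure_def emeasure_distr[OF fst_measurable Z] eq
    using cylinder(1)[OF open_UNIV] by (intro emeasure_restrict_space) (auto simp: space_area_measure)
qed

lemma emeasure_rep_measure_UNIV: "emeasure rep_measure UNIV \<le> ennreal B"
  using cylinder(2)[OF open_UNIV] emeasure_rep_measure(1)[of UNIV] by simp

lemma finite_rep_measure: "finite_measure rep_measure"
proof
  have "space rep_measure = UNIV" by (simp add: rep_measure_def)
  moreover have "emeasure rep_measure UNIV < \<infinity>"
    by (rule le_less_trans[OF emeasure_rep_measure_UNIV]) simp
  ultimately show "emeasure rep_measure (space rep_measure) \<noteq> \<infinity>" by simp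
qed

text \<open>Compare the strip under the graph of \<open>g\<close> with the cylinder over
  \<open>Z\<close>.\<close>

lemma rep_measure_sandwich:
  assumes g: "g \<in> C0" "\<And>x. 0 \<le> g x" "\<And>x. g x \<le> 1" and Z: "Z \<in> sets borel"
  shows "(\<And>x. x \<notin> Z \<Longrightarrow> g x = 0) \<Longrightarrow> L g \<le> measure rep_measure Z"
    and "(\<And>x. x \<in> Z \<Longrightarrow> g x = 1) \<Longrightarrow> measure rep_measure Z \<le> L g"
proof -
  interpret finite_measure rep_measure by (rule finite_rep_measure)
  have op: "ordered_pair (\<lambda>_. 0) g" using g by (auto simp: ordered_pair_def)
  have ar: "area (\<lambda>_. 0) g = ennreal (L g)" by (simp add: area_def)
  have L0: "0 \<le> L g" by (rule pos[OF g(1,2)])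
  show "L g \<le> measure rep_measure Z" if "\<And>x. x \<notin> Z \<Longrightarrow> g x = 0"
  proof -
    have "between (\<lambda>_. 0) g \<subseteq> Z \<times> {0..<1}"
      using that g(3) by (force simp: between_def intro: less_le_trans)
    from emeasure_mono[OF this emeasure_rep_measure(2)[OF Z]]
    have "ennreal (L g) \<le> ennreal (measure rep_measure Z)"
      unfolding area_measure_between(1)[OF op] emeasure_rep_measure(1)[OF Z, symmetric] ar emeasure_eq_measure .
    then show ?thesis by simp
  qed
  show "measure rep_measure Z \<le> L g" if "\<And>x. x \<in> Z \<Longrightarrow> g x = 1"
  proof -
    have "Z \<times> {0..<1} \<subseteq> between (\<lambda>_. 0) g" using that by (auto simp: between_def)
    from emeasure_mono[OF this area_measure_between(2)[OF op]]
    have "ennreal (measure rep_measure Z) \<le> ennreal (L g)"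
      unfolding area_measure_between(1)[OF op] emeasure_rep_measure(1)[OF Z, symmetric] ar emeasure_eq_measure .
    then show ?thesis using L0 by simp
  qed
qed

lemma integral_rep_measure_01:
  assumes f: "f \<in> C0" "\<And>x. 0 \<le> f x" "\<And>x. f x \<le> 1"
  shows "integrable rep_measure f" "(\<integral>x. f x \<partial>rep_measure) = L f"
proof -
  interpret finite_measure rep_measure by (rule finite_rep_measure)
  have int01: "integrable rep_measure g" if "g \<in> C0" "\<And>x. 0 \<le> g x" "\<And>x. g x \<le> 1" for g :: "'x \<Rightarrow> real"
    by (rule integrable_const_bound[where B = 1])
      (use that C0_borel[OF that(1)] in \<open>auto cong: measurable_cong_sets\<close>)
  show "integrable rep_measure f" by (rule int01[OF f])
  have "\<bar>L f - (\<integral>x. f x \<partial>rep_measure)\<bar> \<le> measure rep_measure UNIV / real (Suc m)" for m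
  proof -
    define n where "n = Suc m"
    have n: "0 < real n" by (simp add: n_def)
    \<comment> \<open>The layer of \<open>f\<close> between the levels \<open>k/n\<close> and
      \<open>(k+1)/n\<close>, stretched to height 1: it is 0 where \<open>f\<close> is at most
      \<open>k/n\<close> and 1 where \<open>f\<close> exceeds \<open>(k+1)/n\<close>.\<close>
    define g where "g k x = real n * (min (f x) (Suc k / n) - min (f x) (k / n))" for k x
    define a where "a k = measure rep_measure {x. real k / n < f x}" for k
    have gC0: "g k \<in> C0" for k
      unfolding g_def by (intro C0_cmult C0_diff C0_min_const f) auto
    have kn: "real k / n \<le> Suc k / n" "real (Suc k) / n = real k / n + 1 / n" for k
      using n by (auto simp: field_simps)
    have g01: "0 \<le> g k x" "g k x \<le> 1" for k x
    proof -
      show "0 \<le> g k x" unfolding g_def using n kn(1)[of k] by (intro mult_nonneg_nonneg) auto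
      have "min (f x) (Suc k / n) - min (f x) (k / n) \<le> 1 / n"
      proof -
        have "min c (q + d) - min c q \<le> d" if "0 \<le> d" for c q d :: real
          using that by (simp add: min_def)
        from this[of "1 / n" "f x" "k / n"] show ?thesis unfolding kn(2) by simp
      qed
      then show "g k x \<le> 1" unfolding g_def using n by (simp add: field_simps)
    qed
    have Zb: "{x. real k / n < f x} \<in> sets borel" for k
      by (intro borel_open open_Collect_less continuous_on_const C0_continuous[OF f(1)])
    have up: "g k x = 0" if "x \<notin> {x. real k / n < f x}" for k x
      using that kn(1)[of k] by (simp add: g_def)
    have lo: "g k x = 1" if "x \<in> {x. real (Suc k) / n < f x}" for k x
    proof -
      have "0 < 1 / real n" using n by simp
      moreover have "real k / n + 1 / n < f x" using that unfolding kn(2) by simp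
      ultimately have "min (f x) (Suc k / n) = real k / n + 1 / n" "min (f x) (k / n) = k / n"
        unfolding kn(2) by (intro min_absorb2, linarith)+
      then show ?thesis using n by (simp add: g_def)
    qed
    have L_bd: "L (g k) \<le> a k" "a (Suc k) \<le> L (g k)" for k
      unfolding a_def using rep_measure_sandwich[OF gC0 g01 Zb] up lo by blast+
    have I_bd: "(\<integral>x. g k x \<partial>rep_measure) \<le> a k" "a (Suc k) \<le> (\<integral>x. g k x \<partial>rep_measure)" for k
    proof -
      have ind: "integrable rep_measure (indicator {x. real k / n < f x} :: 'x \<Rightarrow> real)"
        "(\<integral>x. indicator {x. real k / n < f x} x \<partial>rep_measure) = a k" for k
        using Zb[of k] by (auto simp: a_def emeasure_eq_measure)
      have "(\<integral>x. g k x \<partial>rep_measure) \<le> (\<integral>x. indicator {x. real k / n < f x} x \<partial>rep_measure)"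
      proof (rule integral_mono[OF int01[OF gC0 g01] ind(1)])
        show "g k x \<le> indicator {x. real k / n < f x} x" for x
          using up[of x k] g01(2)[of k x] by (auto simp: indicator_def)
      qed
      then show "(\<integral>x. g k x \<partial>rep_measure) \<le> a k" by (simp only: ind)
      have "(\<integral>x. indicator {x. real (Suc k) / n < f x} x \<partial>rep_measure) \<le> (\<integral>x. g k x \<partial>rep_measure)"
      proof (rule integral_mono[OF ind(1) int01[OF gC0 g01]])
        show "indicator {x. real (Suc k) / n < f x} x \<le> g k x" for x
          using lo[of x k] g01(1)[of k x] by (auto simp: indicator_def)
      qed
      then show "a (Suc k) \<le> (\<integral>x. g k x \<partial>rep_measure)" by (simp only: ind)
    qed
    have tele: "f x = (\<Sum>k<n. g k x) / n" for x
    proof -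
      have "(\<Sum>k<n. g k x) = real n * (\<Sum>k<n. min (f x) (Suc k / n) - min (f x) (k / n))"
        unfolding g_def by (simp add: sum_distrib_left)
      also have "(\<Sum>k<n. min (f x) (Suc k / n) - min (f x) (k / n)) = min (f x) (real n / n) - min (f x) (real 0 / n)"
        by (rule sum_lessThan_telescope)
      also have "\<dots> = f x" using f(2,3)[of x] n by (simp add: min_def)
      finally show ?thesis using n by simp
    qed
    have Lf: "L f = (\<Sum>k<n. L (g k)) / n"
    proof -
      have "f = (\<lambda>x. (1 / n) * (\<Sum>k<n. g k x))" using tele by (simp add: fun_eq_iff)
      then have "L f = L (\<lambda>x. (1 / n) * (\<Sum>k<n. g k x))" by (rule arg_cong)
      also have "\<dots> = (1 / n) * L (\<lambda>x. \<Sum>k<n. g k x)" by (rule scale[OF C0_sum[of "{..<n}", OF gC0]])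
      also have "L (\<lambda>x. \<Sum>k<n. g k x) = (\<Sum>k<n. L (g k))" by (rule sum[OF gC0])
      finally show ?thesis by simp
    qed
    have If: "(\<integral>x. f x \<partial>rep_measure) = (\<Sum>k<n. (\<integral>x. g k x \<partial>rep_measure)) / n"
    proof -
      have "(\<integral>x. f x \<partial>rep_measure) = (\<integral>x. (\<Sum>k<n. g k x) / n \<partial>rep_measure)"
        by (rule Bochner_Integration.integral_cong[OF refl tele])
      also have "\<dots> = (\<integral>x. (\<Sum>k<n. g k x) \<partial>rep_measure) / n" by (rule integral_divide_zero)
      also have "(\<integral>x. (\<Sum>k<n. g k x) \<partial>rep_measure) = (\<Sum>k<n. (\<integral>x. g k x \<partial>rep_measure))"
        by (rule Bochner_Integration.integral_sum[OF int01[OF gC0 g01]])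
      finally show ?thesis .
    qed
    \<comment> \<open>For each layer both numbers lie between \<open>a (Suc k)\<close> and
      \<open>a k\<close>. These gaps telescope to at most the total mass, and division by
      \<open>n\<close> makes the error vanish.\<close>
    have "\<bar>(\<Sum>k<n. L (g k)) - (\<Sum>k<n. (\<integral>x. g k x \<partial>rep_measure))\<bar> \<le> (\<Sum>k<n. a k - a (Suc k))"
      unfolding sum_subtractf[symmetric]
    proof (rule order_trans[OF sum_abs sum_mono])
      fix k show "\<bar>L (g k) - (\<integral>x. g k x \<partial>rep_measure)\<bar> \<le> a k - a (Suc k)"
        using L_bd[of k] I_bd[of k] by linarith
    qed
    also have "\<dots> = a 0 - a n" by (rule sum_lessThan_telescope')
    also have "\<dots> \<le> measure rep_measure UNIV"
    proof -
      have "0 \<le> a n" by (simp add: a_def)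
      moreover have "a 0 \<le> measure rep_measure UNIV" unfolding a_def by (rule finite_measure_mono) auto
      ultimately show ?thesis by simp
    qed
    finally have "\<bar>(\<Sum>k<n. L (g k)) - (\<Sum>k<n. (\<integral>x. g k x \<partial>rep_measure))\<bar> / n \<le> measure rep_measure UNIV / n"
      by (rule divide_right_mono) simp
    then show ?thesis unfolding Lf If n_def[symmetric] diff_divide_distrib[symmetric] abs_divide by simp
  qed
  moreover have "(\<lambda>m. measure rep_measure UNIV / real (Suc m)) \<longlonglongrightarrow> 0"
    unfolding divide_inverse by (rule tendsto_mult_right_zero[OF LIMSEQ_inverse_real_of_nat])
  ultimately have "\<bar>L f - (\<integral>x. f x \<partial>rep_measure)\<bar> \<le> 0"
    by (intro LIMSEQ_le_const) auto
  then show "(\<integral>x. f x \<partial>rep_measure) = L f" by simp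
qed

lemma integral_rep_measure_nonneg:
  assumes f: "f \<in> C0" "\<And>x. 0 \<le> f x"
  shows "integrable rep_measure f \<and> (\<integral>x. f x \<partial>rep_measure) = L f"
proof -
  obtain c where c: "0 \<le> c" "\<And>x. norm (f x) \<le> c" using C0_bounded_norm[OF f(1)] by metis
  define d where "d = c + 1"
  have d: "0 < d" using c by (simp add: d_def)
  let ?g = "\<lambda>x. inverse d * f x"
  have g: "?g \<in> C0" "\<And>x. 0 \<le> ?g x" "\<And>x. ?g x \<le> 1"
  proof -
    show "?g x \<le> 1" for x using c(2)[of x] d f(2)[of x] by (simp add: field_simps d_def)
  qed (use f d in \<open>auto intro: C0_cmult\<close>)
  have "f = (\<lambda>x. d * ?g x)" using d by auto
  moreover have "integrable rep_measure (\<lambda>x. d * ?g x)"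
    "(\<integral>x. d * ?g x \<partial>rep_measure) = L (\<lambda>x. d * ?g x)"
    using integral_rep_measure_01[OF g] scale[OF g(1), of d] by auto
  ultimately show ?thesis by simp
qed

lemma integral_rep_measure:
  assumes f: "f \<in> C0"
  shows "integrable rep_measure f" "(\<integral>x. f x \<partial>rep_measure) = L f"
proof -
  let ?p = "\<lambda>x. max (f x) 0" and ?m = "\<lambda>x. max (0 - f x) 0"
  have p: "?p \<in> C0" "?m \<in> C0" by (intro C0_max C0_diff f C0_0)+
  have eq: "f = (\<lambda>x. ?p x - ?m x)" by (rule ext) (simp add: max_def)
  note * = integral_rep_measure_nonneg[OF p(1)] integral_rep_measure_nonneg[OF p(2)]
  show "integrable rep_measure f" by (subst eq) (use * in simp)
  have "(\<integral>x. ?p x - ?m x \<partial>rep_measure) = L ?p - L ?m" using * by simp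
  also have "\<dots> = L (\<lambda>x. ?p x - ?m x)" by (rule diff[OF p, symmetric])
  finally show "(\<integral>x. f x \<partial>rep_measure) = L f" unfolding eq[symmetric] .
qed

end

section \<open>Operators on square-summable families\<close>

lemma coef_add [simp]: "coef (x + y) i = coef x i + coef y i" by (simp add: plus_ell2.rep_eq)
lemma coef_zero [simp]: "coef 0 i = 0" by (simp add: zero_ell2.rep_eq)
lemma coef_uminus [simp]: "coef (- x) i = - coef x i" by (simp add: uminus_ell2.rep_eq)
lemma coef_diff [simp]: "coef (x - y) i = coef x i - coef y i"
  by (simp only: minus_ell2_def coef_add coef_uminus) simp
lemma coef_scaleR [simp]: "coef (r *\<^sub>R x) i = of_real r * coef x i" by (simp add: scaleR_ell2.rep_eq)
lemma coef_sum [simp]: "coef (\<Sum>j\<in>J. f j) i = (\<Sum>j\<in>J. coef (f j) i)"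
  by (induction J rule: infinite_finite_induct) auto
lemma coef_ket: "coef (ket i) j = (if j = i then 1 else 0)" by (simp add: ket.rep_eq)

lemma bounded_range_const [simp]: "bounded (range (\<lambda>_. c))" by (simp add: bounded_iff)

lemma coef_scalar [simp]: "coef (mult_op (\<lambda>_. c) \<xi>) i = c * coef \<xi> i"
  by (rule coef_mult_op) simp

lemma coef_cscale [simp]: "coef (cscale_op c a \<xi>) i = c * coef (a \<xi>) i"
  by (simp add: cscale_op_def)

lemma op_eqI: fixes a b :: "'i op" shows "(\<And>\<xi> i. coef (a \<xi>) i = coef (b \<xi>) i) \<Longrightarrow> a = b"
  by (intro blinfun_eqI ell2_eqI)

lemma cscale_add: "cscale_op c (a + b) = cscale_op c a + cscale_op c b"
  by (rule op_eqI) (simp add: blinfun.add_left algebra_simps)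
lemma cscale_cscale [simp]: "cscale_op c (cscale_op d a) = cscale_op (c * d) a"
  by (rule op_eqI) (simp add: algebra_simps)
lemma cscale_of_real: "cscale_op (of_real r) a = r *\<^sub>R a"
  by (rule op_eqI) (simp add: blinfun.scaleR_left)
lemma cscale_0 [simp]: "cscale_op c 0 = 0" "cscale_op 0 a = 0"
  by (rule op_eqI, simp)+
lemma cscale_1 [simp]: "cscale_op 1 a = a" by (rule op_eqI) simp
lemma cscale_compose_left: "cscale_op c a o\<^sub>L b = cscale_op c (a o\<^sub>L b)"
  by (rule op_eqI) simp

lemma cinner_summable: "(\<lambda>i. coef x i * cnj (coef y i)) summable_on UNIV"
  by (intro sq_summable_prod ell2_summable)

lemma cinner_add_left: "cinner (x + y) z = cinner x z + cinner y z"
  unfolding cinner_def by (simp add: infsum_add[OF cinner_summable cinner_summable, symmetric] algebra_simps)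

lemma cinner_commute: "cinner y x = cnj (cinner x y)"
  by (simp add: cinner_def infsum_cnj[symmetric] mult.commute)

lemma cinner_add_right: "cinner z (x + y) = cinner z x + cinner z y"
  by (metis cinner_add_left cinner_commute complex_cnj_add)

lemma cinner_scalar_left: "cinner (mult_op (\<lambda>_. c) x) y = c * cinner x y"
  unfolding cinner_def by (simp add: mult.assoc infsum_cmult_right')

lemma cinner_scalar_right: "cinner x (mult_op (\<lambda>_. c) y) = cnj c * cinner x y"
  by (metis cinner_commute cinner_scalar_left complex_cnj_mult complex_cnj_cnj)

lemma cinner_0_left [simp]: "cinner 0 y = 0" by (simp add: cinner_def)

lemma cinner_diff_left: "cinner (x - y) z = cinner x z - cinner y z"
  by (metis add_diff_cancel cinner_add_left diff_add_cancel)

lemma cinner_sum_left: "cinner (\<Sum>j\<in>J. f j) z = (\<Sum>j\<in>J. cinner (f j) z)"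
  by (induction J rule: infinite_finite_induct) (auto simp: cinner_add_left)

lemma cinner_self_norm: "cinner x x = of_real ((norm x)\<^sup>2)"
  by (simp add: cinner_self norm_ell2_sq)

lemma norm_scalar: "norm (mult_op (\<lambda>_. c) x) = cmod c * norm x"
proof -
  have "(norm (mult_op (\<lambda>_. c) x))\<^sup>2 = (cmod c * norm x)\<^sup>2"
    by (simp add: norm_ell2_sq norm_mult power_mult_distrib infsum_cmult_right')
  then show ?thesis by (simp add: power2_eq_iff_nonneg)
qed

lemma cinner_Cauchy_Schwarz: "cmod (cinner x y) \<le> norm x * norm y"
proof (cases "cinner x y = 0")
  case False
  \<comment> \<open>This phase makes the inner product real and nonnegative, so the real
    Cauchy-Schwarz inequality applies.\<close>
  define c where "c = cnj (cinner x y) / cmod (cinner x y)"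
  have c: "cmod c = 1" using False by (simp add: c_def norm_divide)
  have "c * cinner x y = of_real (cmod (cinner x y))"
    using False by (simp add: c_def complex_norm_square[symmetric] power2_eq_square mult.commute field_simps)
  then have "cmod (cinner x y) = inner (mult_op (\<lambda>_. c) x) y"
    by (simp add: inner_ell2_def cinner_scalar_left)
  also have "\<dots> \<le> norm x * norm y"
    using norm_cauchy_schwarz[of "mult_op (\<lambda>_. c) x" y] by (simp add: norm_scalar c)
  finally show ?thesis .
qed (simp)

lemma norm_ket [simp]: "norm (ket i) = 1"
proof -
  have "complex_of_real ((norm (ket i))\<^sup>2) = of_real 1"
    unfolding cinner_self_norm[symmetric] cinner_ket coef_ket by simp
  then have "(norm (ket i))\<^sup>2 = 1" unfolding of_real_eq_iff .
  then show ?thesis using norm_ge_zero[of "ket i"] unfolding power2_eq_1_iff by linarith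
qed

lemma coef_le_norm: "cmod (coef x i) \<le> norm x"
  using cinner_Cauchy_Schwarz[of x "ket i"] by (simp add: cinner_ket)

lemma norm_mult_op_le:
  assumes "\<And>i. cmod (m i) \<le> B"
  shows "norm (mult_op m) \<le> B"
proof -
  have B: "0 \<le> B" using assms norm_ge_zero order_trans by blast
  have bdd: "bounded (range m)" unfolding bounded_iff using assms by auto
  show ?thesis
  proof (rule norm_blinfun_bound[OF B])
    fix x
    have "(norm (mult_op m x))\<^sup>2 \<le> (\<Sum>\<^sub>\<infinity>i. B\<^sup>2 * (cmod (coef x i))\<^sup>2)"
      unfolding norm_ell2_sq
    proof (rule infsum_mono)
      show "(\<lambda>i. B\<^sup>2 * (cmod (coef x i))\<^sup>2) summable_on UNIV"
        by (intro summable_on_cmult_right ell2_summable)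
      show "(cmod (coef (mult_op m x) i))\<^sup>2 \<le> B\<^sup>2 * (cmod (coef x i))\<^sup>2" for i
        using power_mono[OF assms[of i], of 2]
        by (simp add: coef_mult_op[OF bdd] norm_mult power_mult_distrib mult_right_mono)
    qed (rule ell2_summable)
    also have "\<dots> = (B * norm x)\<^sup>2"
      by (simp add: infsum_cmult_right' norm_ell2_sq power_mult_distrib)
    finally show "norm (mult_op m x) \<le> B * norm x"
      by (rule power2_le_imp_le) (simp add: B)
  qed
qed

lemma norm_cscale_op_le: "norm (cscale_op c a) \<le> cmod c * norm a"
  unfolding cscale_op_def
  by (rule order_trans[OF norm_blinfun_compose mult_right_mono]) (auto intro: norm_mult_op_le)

text \<open>The operator type records real linearity only, but existence of an adjoint for
  \<open>cinner\<close> needs complex linearity.\<close>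

definition clinear_op :: "'i op \<Rightarrow> bool" where
  "clinear_op a \<longleftrightarrow> (\<forall>c \<xi>. a (mult_op (\<lambda>_. c) \<xi>) = mult_op (\<lambda>_. c) (a \<xi>))"

definition is_adjoint :: "'i op \<Rightarrow> 'i op \<Rightarrow> bool" where
  "is_adjoint a b \<longleftrightarrow> (\<forall>\<xi> \<eta>. cinner (a \<xi>) \<eta> = cinner \<xi> (b \<eta>))"

lemma is_adjoint_unique:
  assumes "is_adjoint a b" "is_adjoint a b'" shows "b = b'"
proof (rule op_eqI)
  fix \<xi> i
  have "cinner (ket i) (b \<xi>) = cinner (ket i) (b' \<xi>)" using assms by (metis is_adjoint_def)
  then show "coef (b \<xi>) i = coef (b' \<xi>) i"
    using cinner_commute cinner_ket by metis
qed

lemma adj_op_eq: "is_adjoint a b \<Longrightarrow> adj_op a = b"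
  unfolding adj_op_def using is_adjoint_unique unfolding is_adjoint_def by (intro the_equality) blast+

lemma is_adjoint_add: "is_adjoint a b \<Longrightarrow> is_adjoint a' b' \<Longrightarrow> is_adjoint (a + a') (b + b')"
  by (simp add: is_adjoint_def blinfun.add_left cinner_add_left cinner_add_right)

lemma is_adjoint_cscale: "is_adjoint a b \<Longrightarrow> is_adjoint (cscale_op c a) (cscale_op (cnj c) b)"
  by (simp add: is_adjoint_def cscale_op_def cinner_scalar_left cinner_scalar_right)

lemma truncation_close:
  fixes x :: "'i ell2"
  assumes "0 < e"
  obtains F where "finite F" "norm (x - (\<Sum>i\<in>F. mult_op (\<lambda>_. coef x i) (ket i))) < e"
proof -
  have "\<forall>\<^sub>F F in finite_subsets_at_top UNIV. dist (\<Sum>i\<in>F. (cmod (coef x i))\<^sup>2) ((norm x)\<^sup>2) < e\<^sup>2"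
    using has_sum_infsum[OF ell2_summable[of x]] assms unfolding norm_ell2_sq[symmetric] has_sum_def
    by (intro tendstoD) auto
  then obtain F where F: "finite F" "dist (\<Sum>i\<in>F. (cmod (coef x i))\<^sup>2) ((norm x)\<^sup>2) < e\<^sup>2"
    unfolding eventually_finite_subsets_at_top by blast
  define y where "y = (\<Sum>i\<in>F. mult_op (\<lambda>_. coef x i) (ket i))"
  have y: "coef y j = (if j \<in> F then coef x j else 0)" for j
    using F(1) by (simp add: y_def coef_ket if_distrib cong: if_cong)
  have "(norm x)\<^sup>2 = (\<Sum>\<^sub>\<infinity>i. (cmod (coef (x - y) i))\<^sup>2 + (cmod (coef y i))\<^sup>2)"
    unfolding norm_ell2_sq by (rule infsum_cong) (auto simp: y)
  also have "\<dots> = (norm (x - y))\<^sup>2 + (\<Sum>\<^sub>\<infinity>i. (cmod (coef y i))\<^sup>2)"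
    unfolding norm_ell2_sq by (intro infsum_add ell2_summable)
  also have "(\<Sum>\<^sub>\<infinity>i. (cmod (coef y i))\<^sup>2) = (\<Sum>\<^sub>\<infinity>i\<in>F. (cmod (coef x i))\<^sup>2)"
    by (rule infsum_cong_neutral) (auto simp: y)
  finally have "(norm (x - y))\<^sup>2 < e\<^sup>2"
    using F by (simp add: dist_real_def)
  then have "norm (x - y) < e" using assms by (meson power_less_imp_less_base less_imp_le)
  then show ?thesis using that[OF F(1)] y_def by simp
qed

text \<open>\<open>adj_op\<close> is a definite description, so positivity of a state says something
  only once adjoints exist. The coefficients of the adjoint at \<open>\<eta>\<close> must be
  \<open>cinner \<eta> (a (ket i))\<close>; the point is that they are square-summable.\<close>

lemma adjoint_exists:
  fixes a :: "'i op"
  assumes a: "clinear_op a"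
  shows "\<exists>b. is_adjoint a b"
proof -
  have bound: "(\<Sum>i\<in>F. (cmod (cinner \<eta> (a (ket i))))\<^sup>2) \<le> (norm a * norm \<eta>)\<^sup>2" if "finite F" for F \<eta>
  proof -
    define S where "S = (\<Sum>i\<in>F. (cmod (cinner \<eta> (a (ket i))))\<^sup>2)"
    \<comment> \<open>A finite section of the vector sought. Pairing \<open>a v\<close> with
      \<open>\<eta>\<close> returns \<open>S\<close>, the square of its norm, so the norm of
      \<open>v\<close> is at most \<open>norm a * norm \<eta>\<close>.\<close>
    define v where "v = (\<Sum>i\<in>F. mult_op (\<lambda>_. cinner \<eta> (a (ket i))) (ket i))"
    have v: "coef v j = (if j \<in> F then cinner \<eta> (a (ket j)) else 0)" for j
      using that by (simp add: v_def coef_ket if_distrib cong: if_cong)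
    have nv: "(norm v)\<^sup>2 = S"
    proof -
      have "(norm v)\<^sup>2 = (\<Sum>\<^sub>\<infinity>i\<in>F. (cmod (cinner \<eta> (a (ket i))))\<^sup>2)"
        unfolding norm_ell2_sq by (rule infsum_cong_neutral) (auto simp: v)
      then show ?thesis using that by (simp add: S_def)
    qed
    have "cinner (a v) \<eta> = (\<Sum>i\<in>F. cinner \<eta> (a (ket i)) * cinner (a (ket i)) \<eta>)"
      using a unfolding v_def clinear_op_def
      by (simp add: blinfun.sum_right cinner_sum_left cinner_scalar_left)
    also have "\<dots> = of_real S"
      unfolding S_def of_real_sum
    proof (rule sum.cong[OF refl])
      fix i
      show "cinner \<eta> (a (ket i)) * cinner (a (ket i)) \<eta> = of_real ((cmod (cinner \<eta> (a (ket i))))\<^sup>2)"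
        unfolding cinner_commute[of "a (ket i)" \<eta>] complex_norm_square ..
    qed
    finally have "cmod (cinner (a v) \<eta>) = \<bar>S\<bar>" by (simp only: norm_of_real)
    then have "S = cmod (cinner (a v) \<eta>)" by (simp add: S_def sum_nonneg)
    also have "\<dots> \<le> norm a * norm v * norm \<eta>"
      by (rule order_trans[OF cinner_Cauchy_Schwarz mult_right_mono[OF norm_blinfun]]) simp
    finally have "norm v * norm v \<le> norm v * (norm a * norm \<eta>)"
      using nv by (simp add: power2_eq_square algebra_simps)
    then have "norm v \<le> norm a * norm \<eta>"
      by (cases "norm v = 0") (auto simp: mult_le_cancel_left)
    then show ?thesis using nv power_mono[of "norm v" "norm a * norm \<eta>" 2] by (simp add: S_def)
  qed
  have summ: "(\<lambda>i. (cmod (cinner \<eta> (a (ket i))))\<^sup>2) summable_on UNIV" for \<eta>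
    by (rule nonneg_bdd_above_summable_on) (auto intro!: bdd_aboveI2 bound)
  define b where "b \<eta> = Abs_ell2 (\<lambda>i. cinner \<eta> (a (ket i)))" for \<eta>
  have cb: "coef (b \<eta>) i = cinner \<eta> (a (ket i))" for \<eta> i
    unfolding b_def using summ[of \<eta>] by (subst Abs_ell2_inverse) auto
  have "bounded_linear b"
  proof (rule bounded_linear_intro)
    show "b (x + y) = b x + b y" for x y by (rule ell2_eqI) (simp add: cb cinner_add_left)
    show "b (r *\<^sub>R x) = r *\<^sub>R b x" for r x
    proof (rule ell2_eqI)
      fix i
      have "r *\<^sub>R x = mult_op (\<lambda>_. of_real r) x" by (rule ell2_eqI) simp
      then show "coef (b (r *\<^sub>R x)) i = coef (r *\<^sub>R b x) i" by (simp add: cb cinner_scalar_left)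
    qed
    fix x
    have "(norm (b x))\<^sup>2 \<le> (norm a * norm x)\<^sup>2"
      unfolding norm_ell2_sq cb by (rule infsum_le_finite_sums[OF summ bound])
    then show "norm (b x) \<le> norm x * norm a"
      by (simp add: mult.commute power2_le_iff_abs_le abs_mult)
  qed
  then have ap: "blinfun_apply (Blinfun b) = b" by (rule bounded_linear_Blinfun_apply)
  have "cinner (a \<xi>) \<eta> = cinner \<xi> (b \<eta>)" for \<xi> \<eta>
  proof -
    have "cmod (cinner (a \<xi>) \<eta> - cinner \<xi> (b \<eta>)) \<le> e" if e: "0 < e" for e
    proof -
      define K where "K = norm a * norm \<eta> + norm (b \<eta>) + 1"
      have K: "0 < K" by (simp add: K_def add_nonneg_pos)
      obtain F where F: "finite F" "norm (\<xi> - (\<Sum>i\<in>F. mult_op (\<lambda>_. coef \<xi> i) (ket i))) < e / K"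
        using truncation_close[of "e / K" \<xi>] e K by auto
      define y where "y = (\<Sum>i\<in>F. mult_op (\<lambda>_. coef \<xi> i) (ket i))"
      have "cinner (a y) \<eta> = (\<Sum>i\<in>F. coef \<xi> i * cinner (a (ket i)) \<eta>)"
        using a unfolding y_def clinear_op_def
        by (simp add: blinfun.sum_right cinner_sum_left cinner_scalar_left)
      also have "\<dots> = cinner y (b \<eta>)"
      proof -
        have "cinner (ket i) (b \<eta>) = cinner (a (ket i)) \<eta>" for i
          using cinner_commute[of "ket i" "b \<eta>"] cinner_commute[of "a (ket i)" \<eta>] by (simp add: cinner_ket cb)
        then show ?thesis by (simp add: y_def cinner_sum_left cinner_scalar_left)
      qed
      finally have "cinner (a \<xi>) \<eta> - cinner \<xi> (b \<eta>) = cinner (a (\<xi> - y)) \<eta> - cinner (\<xi> - y) (b \<eta>)"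
        by (simp add: blinfun.diff_right cinner_diff_left)
      also have "cmod \<dots> \<le> norm a * norm (\<xi> - y) * norm \<eta> + norm (\<xi> - y) * norm (b \<eta>)"
        by (intro order_trans[OF norm_triangle_ineq4] add_mono cinner_Cauchy_Schwarz
            order_trans[OF cinner_Cauchy_Schwarz mult_right_mono[OF norm_blinfun]]) simp
      also have "\<dots> \<le> norm (\<xi> - y) * K" by (simp add: K_def algebra_simps)
      also have "\<dots> \<le> e" using F(2) K by (simp add: y_def field_simps)
      finally show ?thesis .
    qed
    then have "cmod (cinner (a \<xi>) \<eta> - cinner \<xi> (b \<eta>)) \<le> 0" by (rule field_le_epsilon[of _ 0, simplified])
    then show ?thesis by simp
  qed
  then show ?thesis by (intro exI[of _ "Blinfun b"]) (simp add: is_adjoint_def ap)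
qed

section \<open>Bounded functionals and uniqueness of analytic extensions\<close>

definition csubspace_op :: "'i op set \<Rightarrow> bool" where
  "csubspace_op A \<longleftrightarrow> 0 \<in> A \<and> (\<forall>a\<in>A. \<forall>b\<in>A. a + b \<in> A) \<and> (\<forall>a\<in>A. \<forall>c. cscale_op c a \<in> A)"

lemma csubspace_opD:
  assumes "csubspace_op A"
  shows "0 \<in> A" "a \<in> A \<Longrightarrow> b \<in> A \<Longrightarrow> a + b \<in> A" "a \<in> A \<Longrightarrow> cscale_op c a \<in> A"
    "a \<in> A \<Longrightarrow> b \<in> A \<Longrightarrow> a - b \<in> A" "a \<in> A \<Longrightarrow> r *\<^sub>R a \<in> A"
proof -
  show *: "0 \<in> A" "a \<in> A \<Longrightarrow> b \<in> A \<Longrightarrow> a + b \<in> A" "a \<in> A \<Longrightarrow> cscale_op c a \<in> A" for a b c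
    using assms by (auto simp: csubspace_op_def)
  show "a \<in> A \<Longrightarrow> r *\<^sub>R a \<in> A" for r a using *(3)[of a "of_real r"] by (simp add: cscale_of_real)
  from this[of b "-1"] *(2)[of a "- b"] show "a \<in> A \<Longrightarrow> b \<in> A \<Longrightarrow> a - b \<in> A" by simp
qed

text \<open>Functionals are total functions on operators, so additivity, complex homogeneity and
  boundedness are required only on \<open>A\<close>.\<close>

definition bounded_functional :: "'i op set \<Rightarrow> ('i op \<Rightarrow> complex) \<Rightarrow> bool" where
  "bounded_functional A \<psi> \<longleftrightarrow> (\<forall>a\<in>A. \<forall>b\<in>A. \<psi> (a + b) = \<psi> a + \<psi> b) \<and>
     (\<forall>a\<in>A. \<forall>c. \<psi> (cscale_op c a) = c * \<psi> a) \<and> (\<exists>K. \<forall>a\<in>A. cmod (\<psi> a) \<le> K * norm a)"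

lemma bounded_functionalD:
  assumes "csubspace_op A" "bounded_functional A \<psi>"
  shows "a \<in> A \<Longrightarrow> b \<in> A \<Longrightarrow> \<psi> (a + b) = \<psi> a + \<psi> b" "a \<in> A \<Longrightarrow> \<psi> (cscale_op c a) = c * \<psi> a"
    "a \<in> A \<Longrightarrow> b \<in> A \<Longrightarrow> \<psi> (a - b) = \<psi> a - \<psi> b" "\<psi> 0 = 0" "a \<in> A \<Longrightarrow> \<psi> (r *\<^sub>R a) = of_real r * \<psi> a"
proof -
  show *: "a \<in> A \<Longrightarrow> b \<in> A \<Longrightarrow> \<psi> (a + b) = \<psi> a + \<psi> b" "a \<in> A \<Longrightarrow> \<psi> (cscale_op c a) = c * \<psi> a" for a b c
    using assms(2) by (auto simp: bounded_functional_def)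
  show "a \<in> A \<Longrightarrow> \<psi> (r *\<^sub>R a) = of_real r * \<psi> a" for r a
    using *(2)[of a "of_real r"] by (simp add: cscale_of_real)
  show "a \<in> A \<Longrightarrow> b \<in> A \<Longrightarrow> \<psi> (a - b) = \<psi> a - \<psi> b"
    using *(1)[of "a - b" b] csubspace_opD[OF assms(1)] by simp
  show "\<psi> 0 = 0" using *(2)[of 0 0] csubspace_opD[OF assms(1)] by simp
qed

lemma bounded_functional_eqI:
  assumes A: "csubspace_op A" and \<psi>: "bounded_functional A \<psi>" "bounded_functional A \<psi>'"
    and D: "D \<subseteq> A" "A \<subseteq> closure (cspan_op D)" and eq: "\<And>a. a \<in> D \<Longrightarrow> \<psi> a = \<psi>' a" and a: "a \<in> A"
  shows "\<psi> a = \<psi>' a"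
proof -
  have span: "b \<in> A \<and> \<psi> b = \<psi>' b" if "b \<in> cspan_op D" for b
    using that unfolding cspan_op_def
  proof (induction rule: span_induct_alt)
    case base
    then show ?case
      using bounded_functionalD(4)[OF A \<psi>(1)] bounded_functionalD(4)[OF A \<psi>(2)] csubspace_opD(1)[OF A] by simp
  next
    case (step r x y)
    then obtain c d where x: "x = cscale_op c d" "d \<in> D" by blast
    then have "x \<in> A" "\<psi> x = \<psi>' x"
      using D(1) eq csubspace_opD(3)[OF A] bounded_functionalD(2)[OF A \<psi>(1)] bounded_functionalD(2)[OF A \<psi>(2)]
      by (auto simp: subset_iff)
    then show ?case
      using step bounded_functionalD(1,5)[OF A \<psi>(1)] bounded_functionalD(1,5)[OF A \<psi>(2)] csubspace_opD[OF A]
      by simp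
  qed
  obtain K K' where K: "\<And>a. a \<in> A \<Longrightarrow> cmod (\<psi> a) \<le> K * norm a" "\<And>a. a \<in> A \<Longrightarrow> cmod (\<psi>' a) \<le> K' * norm a"
    using \<psi> unfolding bounded_functional_def by blast
  have "a \<in> closure (cspan_op D)" using D a by auto
  then obtain f where f: "\<And>n. f n \<in> cspan_op D" "f \<longlonglongrightarrow> a" unfolding closure_sequential by blast
  have "(\<lambda>n. norm (a - f n)) \<longlonglongrightarrow> 0"
    using f(2) by (simp add: LIMSEQ_iff norm_minus_commute)
  then have lim: "(\<lambda>n. (K + K') * norm (a - f n)) \<longlonglongrightarrow> 0" by (rule tendsto_mult_right_zero)
  have "cmod (\<psi> a - \<psi>' a) \<le> (K + K') * norm (a - f n)" for n
  proof -
    have "\<psi> a - \<psi>' a = \<psi> (a - f n) - \<psi>' (a - f n)"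
      using span[OF f(1)[of n]] bounded_functionalD(3)[OF A \<psi>(1)] bounded_functionalD(3)[OF A \<psi>(2)] a by simp
    moreover have "a - f n \<in> A" using csubspace_opD(4)[OF A a] span[OF f(1)] by blast
    ultimately show ?thesis using K(1)[of "a - f n"] K(2)[of "a - f n"] norm_triangle_ineq4[of "\<psi> (a - f n)" "\<psi>' (a - f n)"]
      by (simp add: distrib_right)
  qed
  then have "cmod (\<psi> a - \<psi>' a) \<le> 0" by (intro LIMSEQ_le_const[OF lim]) auto
  then show ?thesis by simp
qed

text \<open>
  Both sides are entire and agree on the real line. No bound on strips, hence no
  Phragmen--Lindelof argument, is needed because \<open>\<psi>\<close> is an eigenvector of the dynamics.
\<close>

lemma entire_extension_eigenvector:
  assumes A: "csubspace_op A" "closed A" and \<psi>: "bounded_functional A \<psi>"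
    and F: "entire_extension A \<sigma> a F"
    and eig: "\<And>t. \<psi> (\<sigma> t a) = exp (\<i> * of_real t * l) * \<psi> a"
  shows "\<psi> (F z) = exp (\<i> * z * l) * \<psi> a"
proof -
  have FA: "F z \<in> A" for z using F by (simp add: entire_extension_def)
  obtain K where K: "\<And>a. a \<in> A \<Longrightarrow> cmod (\<psi> a) \<le> K * norm a"
    using \<psi> unfolding bounded_functional_def by blast
  have deriv: "\<exists>d. ((\<lambda>z. \<psi> (F z)) has_field_derivative d) (at z)" for z
  proof -
    obtain D where D: "(F has_derivative (\<lambda>w. cscale_op w D)) (at z)"
      using F unfolding entire_extension_def by blast
    then have lim: "(\<lambda>h. norm (F (z + h) - F z - cscale_op h D) / norm h) \<midarrow>0\<rightarrow> 0"
      by (simp add: has_derivative_at)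
    define r where "r n = inverse (real (Suc n))" for n
    have r: "0 < r n" for n by (simp add: r_def)
    have rlim: "(\<lambda>n. complex_of_real (r n)) \<longlonglongrightarrow> 0"
      using tendsto_of_real[OF LIMSEQ_inverse_real_of_nat, where ?'a = complex] by (simp add: r_def)
    have seq: "filterlim (\<lambda>n. complex_of_real (r n)) (at 0) sequentially"
      unfolding filterlim_at using rlim r by (auto simp: less_imp_neq[symmetric])
    \<comment> \<open>The derivative is a limit of real difference quotients taken in the closed
      space \<open>A\<close>, so \<open>\<psi>\<close> is linear and bounded on it.\<close>
    have DA: "D \<in> A"
    proof (rule closed_sequentially[OF A(2)])
      let ?f = "\<lambda>n. inverse (r n) *\<^sub>R (F (z + of_real (r n)) - F z)"
      show "?f n \<in> A" for n by (intro csubspace_opD[OF A(1)] FA)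
      have "norm (?f n - D) = norm (F (z + of_real (r n)) - F z - cscale_op (of_real (r n)) D)
            / norm (complex_of_real (r n))" for n
      proof -
        have "?f n - D = inverse (r n) *\<^sub>R (F (z + of_real (r n)) - F z - r n *\<^sub>R D)"
          using r[of n] by (simp add: scaleR_diff_right)
        then show ?thesis using r[of n] by (simp add: cscale_of_real divide_inverse)
      qed
      then have "(\<lambda>n. norm (?f n - D)) \<longlonglongrightarrow> 0" using filterlim_compose[OF lim seq] by simp
      then show "?f \<longlonglongrightarrow> D" by (simp add: LIMSEQ_iff)
    qed
    have "((\<lambda>z. \<psi> (F z)) has_derivative (\<lambda>w. \<psi> D * w)) (at z)"
      unfolding has_derivative_at
    proof
      show "bounded_linear ((*) (\<psi> D))" by (rule bounded_linear_mult_right)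
      have le: "norm (norm (\<psi> (F (z + h)) - \<psi> (F z) - \<psi> D * h) / norm h)
          \<le> K * (norm (F (z + h) - F z - cscale_op h D) / norm h)" for h
      proof -
        have "\<psi> (F (z + h)) - \<psi> (F z) - \<psi> D * h = \<psi> (F (z + h) - F z - cscale_op h D)"
          by (simp add: bounded_functionalD[OF A(1) \<psi>] csubspace_opD[OF A(1)] FA DA)
        moreover have "F (z + h) - F z - cscale_op h D \<in> A"
          by (intro csubspace_opD[OF A(1)] FA DA)
        ultimately have "norm (\<psi> (F (z + h)) - \<psi> (F z) - \<psi> D * h) \<le> K * norm (F (z + h) - F z - cscale_op h D)"
          using K by simp
        from divide_right_mono[OF this norm_ge_zero[of h]] show ?thesis by (simp only: real_norm_def abs_divide abs_norm_cancel times_divide_eq_right)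
      qed
      show "(\<lambda>h. norm (\<psi> (F (z + h)) - \<psi> (F z) - \<psi> D * h) / norm h) \<midarrow>0\<rightarrow> 0"
        by (rule Lim_null_comparison[OF always_eventually[OF allI[OF le]] tendsto_mult_right_zero[OF lim]])
    qed
    then show ?thesis by (auto simp: has_field_derivative_def)
  qed
  define G where "G z = \<psi> (F z) - exp (\<i> * z * l) * \<psi> a" for z
  \<comment> \<open>\<open>G\<close> is entire and vanishes on the real line, which accumulates at
    0.\<close>
  have "G z = 0"
  proof (rule analytic_continuation[of G UNIV "range of_real" 0])
    show "G holomorphic_on UNIV"
      unfolding G_def using deriv
      by (intro holomorphic_intros) (auto simp: holomorphic_on_def field_differentiable_def)
    define r where "r n = inverse (real (Suc n))" for n
    have "0 < r n" for n by (simp add: r_def)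
    moreover have "(\<lambda>n. complex_of_real (r n)) \<longlonglongrightarrow> 0"
      using tendsto_of_real[OF LIMSEQ_inverse_real_of_nat, where ?'a = complex] by (simp add: r_def)
    ultimately show "(0::complex) islimpt range of_real"
      unfolding islimpt_sequential
      by (intro exI[of _ "\<lambda>n. complex_of_real (r n)"]) (auto simp: less_imp_neq[symmetric])
    show "G w = 0" if "w \<in> range of_real" for w
      using that F eig by (auto simp: G_def entire_extension_def)
  qed auto
  then show ?thesis by (simp add: G_def)
qed

section \<open>Generators of the groupoid algebra\<close>

lemma subspace_closure:
  fixes V :: "'a::real_normed_vector set"
  assumes "subspace V" shows "subspace (closure V)"
proof (rule subspaceI)
  show "0 \<in> closure V" using subspace_0[OF assms] closure_subset by blast
  show "x + y \<in> closure V" if xy: "x \<in> closure V" "y \<in> closure V" for x y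
  proof -
    obtain f g where "\<And>n. f n \<in> V" "f \<longlonglongrightarrow> x" "\<And>n. g n \<in> V" "g \<longlonglongrightarrow> y"
      using xy unfolding closure_sequential by blast
    then have "\<And>n. f n + g n \<in> V" "(\<lambda>n. f n + g n) \<longlonglongrightarrow> x + y"
      using assms by (auto intro: subspace_add tendsto_add)
    then show ?thesis unfolding closure_sequential by (intro exI conjI allI)
  qed
  show "c *\<^sub>R x \<in> closure V" if x: "x \<in> closure V" for c x
  proof -
    obtain f where "\<And>n. f n \<in> V" "f \<longlonglongrightarrow> x"
      using x unfolding closure_sequential by blast
    then have "\<And>n. c *\<^sub>R f n \<in> V" "(\<lambda>n. c *\<^sub>R f n) \<longlonglongrightarrow> c *\<^sub>R x"
      using assms by (auto intro: subspace_scale tendsto_scaleR)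
    then show ?thesis unfolding closure_sequential by (intro exI conjI allI)
  qed
qed

lemma closure_span_induct [consumes 1, case_names closed zero gen add scale]:
  fixes G :: "'a::real_normed_vector set"
  assumes x: "x \<in> closure (span G)" and "closed {x. P x}" "P 0" "\<And>x. x \<in> G \<Longrightarrow> P x"
    and "\<And>x y. P x \<Longrightarrow> P y \<Longrightarrow> P (x + y)" "\<And>r x. P x \<Longrightarrow> P (r *\<^sub>R x)"
  shows "P x"
proof -
  have "subspace {x. P x}" using assms by (auto intro: subspaceI)
  then have "span G \<subseteq> {x. P x}" using assms by (intro span_minimal) auto
  then show ?thesis using closure_minimal[OF _ assms(2)] x by blast
qed

text \<open>This reduces invariance of \<open>A\<close> under scalars, products and the dynamics to
  a check on generators.\<close>

lemma bounded_linear_closure_span: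
  assumes T: "bounded_linear T" and G: "\<And>x. x \<in> G \<Longrightarrow> T x \<in> closure (span H)" and x: "x \<in> closure (span G)"
  shows "T x \<in> closure (span H)"
  using x
proof (induction rule: closure_span_induct)
  interpret bounded_linear T by fact
  note sub = subspace_closure[OF subspace_span[of H]]
  have "{x. T x \<in> closure (span H)} = T -` closure (span H)" by auto
  then show "closed {x. T x \<in> closure (span H)}"
    by (simp add: continuous_closed_vimage continuous_at_imp_continuous_on linear_continuous_at[OF T])
  show "T 0 \<in> closure (span H)" by (simp add: zero subspace_0[OF sub])
  show "T (x + y) \<in> closure (span H)" if "T x \<in> closure (span H)" "T y \<in> closure (span H)" for x y
    using that by (simp add: add subspace_add[OF sub])
  show "T (r *\<^sub>R x) \<in> closure (span H)" if "T x \<in> closure (span H)" for r x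
    using that by (simp add: scale subspace_scale[OF sub])
qed (rule G)

lemmas bounded_linear_compose_left = bounded_bilinear.bounded_linear_left[OF bounded_bilinear_blinfun_compose]
lemmas bounded_linear_compose_right = bounded_bilinear.bounded_linear_right[OF bounded_bilinear_blinfun_compose]

lemma bounded_linear_cscale: "bounded_linear (cscale_op c)"
  unfolding cscale_op_def by (rule bounded_linear_compose_right)

lemma bounded_linear_cscale_left: "bounded_linear (\<lambda>c. cscale_op c a)"
proof -
  have "(\<lambda>c. cscale_op c a) = (\<lambda>c. Re c *\<^sub>R a + Im c *\<^sub>R cscale_op \<i> a)"
    by (intro ext op_eqI) (auto simp: blinfun.add_left blinfun.scaleR_left complex_eq_iff)
  moreover have "bounded_linear (\<lambda>c. Re c *\<^sub>R a + Im c *\<^sub>R cscale_op \<i> a)"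
    by (intro bounded_linear_add bounded_linear_compose[OF bounded_linear_scaleR_left bounded_linear_Re]
        bounded_linear_compose[OF bounded_linear_scaleR_left bounded_linear_Im])
  ultimately show ?thesis by simp
qed

lemma bounded_linear_coef: "bounded_linear (\<lambda>a :: 'i op. coef (a \<xi>) i)"
proof (rule bounded_linear_intro)
  show "norm (coef (blinfun_apply a \<xi>) i) \<le> norm a * norm \<xi>" for a :: "'i op"
    by (rule order_trans[OF coef_le_norm norm_blinfun])
qed (auto simp: blinfun.add_left blinfun.scaleR_left scaleR_conv_of_real)

lemma clinear_op_iff: "clinear_op a \<longleftrightarrow> (\<forall>c \<xi> i. coef (a (mult_op (\<lambda>_. c) \<xi>)) i = c * coef (a \<xi>) i)"
  unfolding clinear_op_def by (auto intro: ell2_eqI)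

lemma closed_clinear_op: "closed {a :: 'i op. clinear_op a}"
proof -
  have "closed {a :: 'i op. coef (a (mult_op (\<lambda>_. c) \<xi>)) i = c * coef (a \<xi>) i}" for c \<xi> i
    by (intro closed_Collect_eq continuous_on_mult continuous_on_const
        linear_continuous_on bounded_linear_coef)
  then show ?thesis unfolding clinear_op_iff by (intro closed_Collect_all) auto
qed

locale partial_action =
  fixes act :: "'g::{group_add, countable} \<Rightarrow> 'x::{second_countable_topology, t2_space} \<Rightarrow> 'x"
    and Y :: "'x set" and N :: "'g \<Rightarrow> real"
  assumes X: "locally compact (UNIV :: 'x set)"
    and action: "continuous_action act"
    and Y: "open Y" "closed Y"
    and N_pos: "0 < N g" and N_add: "N (g + h) = N g * N h"
begin

lemma act_0 [simp]: "act 0 x = x"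
  and act_add: "act (g + h) x = act g (act h x)"
  and act_cont: "continuous_on B (act g)"
  using action by (auto simp: continuous_action_def intro: continuous_on_subset)

lemma act_inv [simp]: "act (- g) (act g x) = x" "act g (act (- g) x) = x"
  by (simp_all flip: act_add)

lemma N_0: "N 0 = 1" using N_add[of 0 0] N_pos[of 0] by simp

lemma C0_act: "f \<in> C0 \<Longrightarrow> (\<lambda>x. f (act g x)) \<in> C0"
  by (rule C0_compose_homeo[where k' = "act (- g)"]) (auto intro: act_cont)

definition gen :: "('x \<Rightarrow> complex) \<Rightarrow> 'g \<Rightarrow> ('g \<times> 'x) op" where
  "gen f g = fun_op act f o\<^sub>L trans_op g"

lemma coef_gen:
  "f \<in> C0 \<Longrightarrow> coef (gen f g \<xi>) (h, x) = f (act h x) * coef \<xi> (- g + h, x)"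
  unfolding gen_def using C0_bounded[of f] by (simp add: C0_functions_eq coef_fun_op coef_trans_op)

text \<open>\<open>f u_g\<close> lies in the corner exactly when \<open>f\<close> vanishes outside
  the part of \<open>Y\<close> whose translate under \<open>- g\<close> is again in
  \<open>Y\<close>.\<close>

definition supported :: "('x \<Rightarrow> complex) \<Rightarrow> 'g \<Rightarrow> bool" where
  "supported f g \<longleftrightarrow> f \<in> C0 \<and> (\<forall>x. f x \<noteq> 0 \<longrightarrow> x \<in> Y \<and> act (- g) x \<in> Y)"

definition gens :: "('g \<times> 'x) op set" where
  "gens = {gen f g | f g. supported f g}"

lemma supported_C0: "supported f g \<Longrightarrow> f \<in> C0" by (simp add: supported_def)

lemma op_eqI2:
  fixes a b :: "('g \<times> 'x) op"
  shows "(\<And>\<xi> h x. coef (a \<xi>) (h, x) = coef (b \<xi>) (h, x)) \<Longrightarrow> a = b"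
  by (rule op_eqI) auto

text \<open>The covariance relation: moving \<open>f'\<close> to the left of the translation by
  \<open>g\<close> composes it with \<open>act (- g)\<close>.\<close>

lemma gen_mult:
  assumes "f \<in> C0" "f' \<in> C0"
  shows "gen f g o\<^sub>L gen f' g' = gen (\<lambda>x. f x * f' (act (- g) x)) (g + g')"
proof (rule op_eqI2)
  fix \<xi> h x
  have C: "(\<lambda>x. f x * f' (act (- g) x)) \<in> C0" by (intro C0_mult C0_act assms)
  have "- (g + g') + h = - g' + (- g + h)" by (simp only: minus_add add.assoc)
  then show "coef ((gen f g o\<^sub>L gen f' g') \<xi>) (h, x) = coef (gen (\<lambda>x. f x * f' (act (- g) x)) (g + g') \<xi>) (h, x)"
    by (simp add: coef_gen[OF assms(1)] coef_gen[OF assms(2)] coef_gen[OF C] act_add mult.assoc)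
qed

lemma gen_cscale: "f \<in> C0 \<Longrightarrow> cscale_op c (gen f g) = gen (\<lambda>x. c * f x) g"
  by (rule op_eqI2) (simp add: coef_gen C0_cmult mult.assoc)

lemma gen_diff: "f \<in> C0 \<Longrightarrow> f' \<in> C0 \<Longrightarrow> gen f g - gen f' g = gen (\<lambda>x. f x - f' x) g"
  by (rule op_eqI2) (simp add: coef_gen C0_diff blinfun.diff_left algebra_simps)

lemma gen_add: "f \<in> C0 \<Longrightarrow> f' \<in> C0 \<Longrightarrow> gen f g + gen f' g = gen (\<lambda>x. f x + f' x) g"
  by (rule op_eqI2) (simp add: coef_gen C0_add blinfun.add_left algebra_simps)

lemma norm_trans_op: "norm (trans_op g :: ('g \<times> 'x) op) \<le> 1"
proof (rule norm_blinfun_bound)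
  fix \<xi> :: "('g \<times> 'x) ell2"
  have bij: "bij_betw (\<lambda>(h, x). (- g + h, x)) UNIV (UNIV :: ('g \<times> 'x) set)"
    by (rule bij_betwI[where g = "\<lambda>(h, x). (g + h, x)"]) (auto simp: add.assoc[symmetric])
  have "(norm (trans_op g \<xi>))\<^sup>2 = (norm \<xi>)\<^sup>2"
    unfolding norm_ell2_sq
    using infsum_reindex_bij_betw[OF bij, of "\<lambda>i. (cmod (coef \<xi> i))\<^sup>2"]
    by (simp add: case_prod_unfold trans_op.rep_eq trans_vec.rep_eq)
  then show "norm (trans_op g \<xi>) \<le> 1 * norm \<xi>" by simp
qed simp

lemma norm_gen:
  assumes "\<And>x. cmod (f x) \<le> B" shows "norm (gen f g) \<le> B"
proof -
  have B: "0 \<le> B" using assms norm_ge_zero order_trans by blast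
  have "norm (fun_op act f) \<le> B" unfolding fun_op_def by (rule norm_mult_op_le) (use assms in auto)
  then have "norm (fun_op act f) * norm (trans_op g :: ('g \<times> 'x) op) \<le> B * 1"
    using norm_trans_op B by (intro mult_mono) auto
  then show ?thesis unfolding gen_def using norm_blinfun_compose order_trans by fastforce
qed

text \<open>Substitute \<open>g + h\<close> for the group coordinate in the sum defining the inner
  product.\<close>

lemma is_adjoint_gen:
  assumes "f \<in> C0"
  shows "is_adjoint (gen f g) (gen (\<lambda>x. cnj (f (act g x))) (- g))"
  unfolding is_adjoint_def
proof (intro allI)
  fix \<xi> \<eta> :: "('g \<times> 'x) ell2"
  have C: "(\<lambda>x. cnj (f (act g x))) \<in> C0"
    by (rule C0_dominated[OF C0_act[OF assms, of g], where C = 1]) (simp_all add: continuous_on_cnj C0_continuous C0_act assms)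
  have bij: "bij_betw (\<lambda>(h, x). (g + h, x)) UNIV (UNIV :: ('g \<times> 'x) set)"
    by (rule bij_betwI[where g = "\<lambda>(h, x). (- g + h, x)"]) (auto simp: add.assoc[symmetric])
  have "cinner (gen f g \<xi>) \<eta> = (\<Sum>\<^sub>\<infinity>i. (\<lambda>(h, x). f (act h x) * coef \<xi> (- g + h, x) * cnj (coef \<eta> (h, x))) i)"
    unfolding cinner_def by (rule infsum_cong) (auto simp: coef_gen[OF assms])
  also have "\<dots> = (\<Sum>\<^sub>\<infinity>(h, x). f (act (g + h) x) * coef \<xi> (h, x) * cnj (coef \<eta> (g + h, x)))"
    by (subst infsum_reindex_bij_betw[OF bij, symmetric]) (simp add: case_prod_unfold add.assoc[symmetric])
  also have "\<dots> = cinner \<xi> (gen (\<lambda>x. cnj (f (act g x))) (- g) \<eta>)"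
    unfolding cinner_def by (rule infsum_cong) (auto simp: coef_gen[OF C] act_add)
  finally show "cinner (gen f g \<xi>) \<eta> = cinner \<xi> (gen (\<lambda>x. cnj (f (act g x))) (- g) \<eta>)" .
qed

lemma supported_mult:
  assumes "supported f g" "supported f' g'"
  shows "supported (\<lambda>x. f x * f' (act (- g) x)) (g + g')"
proof -
  have "act (- (g + g')) x = act (- g') (act (- g) x)" for x
    by (simp only: minus_add act_add)
  then show ?thesis using assms unfolding supported_def
    by (auto intro!: C0_mult C0_act)
qed

lemma gens_mult: "a \<in> gens \<Longrightarrow> b \<in> gens \<Longrightarrow> a o\<^sub>L b \<in> gens"
  unfolding gens_def using gen_mult[OF supported_C0 supported_C0] supported_mult by blast

lemma supported_cmult: "supported f g \<Longrightarrow> supported (\<lambda>x. c * f x) g"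
  by (auto simp: supported_def intro: C0_cmult)

lemma gens_cscale: "a \<in> gens \<Longrightarrow> cscale_op c a \<in> gens"
  unfolding gens_def using gen_cscale[OF supported_C0] supported_cmult by blast

definition cut :: "('g \<times> 'x) op \<Rightarrow> ('g \<times> 'x) op" where
  "cut a = fun_op act (indicator Y) o\<^sub>L a o\<^sub>L fun_op act (indicator Y)"

lemma bounded_linear_cut: "bounded_linear cut"
  unfolding cut_def
  by (rule bounded_linear_compose[OF bounded_linear_compose_left bounded_linear_compose_right])

text \<open>On the right the indicator acts after translation, hence through
  \<open>act (- g)\<close>; clopenness of \<open>Y\<close> keeps the symbol in
  \<open>C0\<close>.\<close>

lemma cut_gen:
  assumes "f \<in> C0"
  shows "cut (gen f g) = gen (\<lambda>x. indicator Y x * f x * indicator Y (act (- g) x)) g"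
    and "supported (\<lambda>x. indicator Y x * f x * indicator Y (act (- g) x)) g"
proof -
  have b: "bounded (range (indicator Y :: 'x \<Rightarrow> complex))"
    unfolding bounded_iff by (intro exI[of _ 1]) (auto simp: indicator_def)
  have "continuous_on UNIV (\<lambda>x. indicator Y (act (- g) x) :: complex)"
    by (rule continuous_on_compose2[OF continuous_on_indicator_clopen[OF Y] act_cont]) auto
  then have C: "(\<lambda>x. indicator Y x * f x * indicator Y (act (- g) x)) \<in> C0"
    by (intro C0_mult_bounded(2)[where C = 1] C0_indicator assms Y) (auto simp: indicator_def)
  show "cut (gen f g) = gen (\<lambda>x. indicator Y x * f x * indicator Y (act (- g) x)) g"
    unfolding cut_def
    by (rule op_eqI2) (simp add: coef_fun_op[OF b] coef_gen[OF assms] coef_gen[OF C] act_add)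
  show "supported (\<lambda>x. indicator Y x * f x * indicator Y (act (- g) x)) g"
    using C by (auto simp: supported_def indicator_def split: if_splits)
qed

lemma cut_gens: "a \<in> gens \<Longrightarrow> cut a = a"
proof -
  assume "a \<in> gens"
  then obtain f g where a: "a = gen f g" "supported f g" by (auto simp: gens_def)
  have "(\<lambda>x. indicator Y x * f x * indicator Y (act (- g) x)) = f"
    using a(2) by (auto simp: supported_def indicator_def fun_eq_iff)
  then show ?thesis unfolding a using cut_gen(1)[OF supported_C0[OF a(2)], of g] by simp
qed

abbreviation "A \<equiv> groupoid_algebra act Y"

text \<open>The image of a closure need not be closed, but \<open>cut\<close> is bounded and fixes
  \<open>gens\<close>, hence fixes their whole closed span.\<close>

lemma A_eq: "A = closure (span gens)"
proof
  have cp: "crossed_product act = closure (span {gen f g | f g. f \<in> C0})"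
    unfolding crossed_product_def gen_def C0_functions_eq ..
  have A: "A = cut ` crossed_product act" unfolding groupoid_algebra_def cut_def ..
  show "A \<subseteq> closure (span gens)"
    unfolding A cp
  proof (rule image_subsetI, erule bounded_linear_closure_span[OF bounded_linear_cut, rotated])
    fix a assume "a \<in> {gen f g | f g. f \<in> C0}"
    then obtain f g where f: "f \<in> C0" "a = gen f g" by blast
    have "cut a \<in> gens" unfolding f(2) cut_gen(1)[OF f(1)] gens_def using cut_gen(2)[OF f(1)] by blast
    then show "cut a \<in> closure (span gens)" using closure_subset span_base by blast
  qed
  show "closure (span gens) \<subseteq> A"
  proof
    fix a assume a: "a \<in> closure (span gens)"
    have "gens \<subseteq> {gen f g | f g. f \<in> C0}" by (auto simp: gens_def supported_def)
    then have "a \<in> crossed_product act" unfolding cp using a closure_mono[OF span_mono] by blast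
    moreover have "cut a = a"
      using a
    proof (induction rule: closure_span_induct)
      interpret bounded_linear cut by (rule bounded_linear_cut)
      show "closed {a. cut a = a}"
        by (intro closed_Collect_eq linear_continuous_on bounded_linear_cut continuous_on_id)
      show "cut 0 = 0" by (rule zero)
      show "cut (x + y) = x + y" if "cut x = x" "cut y = y" for x y using that by (simp add: add)
      show "cut (r *\<^sub>R x) = r *\<^sub>R x" if "cut x = x" for r x using that by (simp add: scale)
    qed (rule cut_gens)
    ultimately show "a \<in> A" unfolding A by (metis imageI)
  qed
qed

lemma gens_A: "a \<in> gens \<Longrightarrow> a \<in> A"
  unfolding A_eq using closure_subset span_base by blast

lemma gen_A: "supported f g \<Longrightarrow> gen f g \<in> A"
  by (rule gens_A) (auto simp: gens_def)

lemma closed_A: "closed A" by (simp add: A_eq)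

lemma csubspace_A: "csubspace_op A"
  unfolding csubspace_op_def
proof (intro conjI ballI allI)
  note sub = subspace_closure[OF subspace_span[of gens], folded A_eq]
  show "0 \<in> A" by (rule subspace_0[OF sub])
  show "a + b \<in> A" if "a \<in> A" "b \<in> A" for a b using that by (rule subspace_add[OF sub])
  show "cscale_op c a \<in> A" if "a \<in> A" for a c
    using that unfolding A_eq
    by (rule bounded_linear_closure_span[OF bounded_linear_cscale, rotated])
      (auto intro!: gens_A[unfolded A_eq] gens_cscale)
qed

lemma A_mult: assumes "a \<in> A" "b \<in> A" shows "a o\<^sub>L b \<in> A"
proof -
  have *: "a o\<^sub>L b \<in> A" if "a \<in> A" "b \<in> gens" for a b
    using that(1) unfolding A_eq
    by (rule bounded_linear_closure_span[OF bounded_linear_compose_left, rotated])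
      (auto intro!: gens_A[unfolded A_eq] gens_mult that)
  show ?thesis
    using assms(2) unfolding A_eq
    by (rule bounded_linear_closure_span[OF bounded_linear_compose_right, rotated])
      (auto intro!: *[unfolded A_eq] assms(1)[unfolded A_eq])
qed

lemma A_clinear: "a \<in> A \<Longrightarrow> clinear_op a"
  unfolding A_eq
proof (induction rule: closure_span_induct)
  case closed show ?case by (rule closed_clinear_op)
next
  case (gen a)
  then obtain f g where a: "a = gen f g" "supported f g" by (auto simp: gens_def)
  show ?case unfolding clinear_op_iff a
    using coef_gen[OF supported_C0[OF a(2)]] by auto
qed (auto simp: clinear_op_iff blinfun.add_left blinfun.scaleR_left algebra_simps)

lemma A_adjoint: "a \<in> A \<Longrightarrow> is_adjoint a (adj_op a)"
  using adjoint_exists[OF A_clinear] adj_op_eq by metis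

text \<open>\<open>gens\<close> is stable under complex scalars, so its complex span is its real
  span.\<close>

lemma span_gens_dense: "closure (cspan_op gens) = A"
proof -
  have "{cscale_op c a | c a. a \<in> gens} = gens"
    using gens_cscale by auto (metis cscale_1)
  then show ?thesis by (simp add: cspan_op_def A_eq)
qed

section \<open>The conditional expectation and the dynamics on the algebra\<close>

lemma cond_exp_coef: "cond_exp a x = coef (a (ket (0, x))) (0, x)"
  by (simp add: cond_exp_def cinner_ket)

lemma cond_exp_gen: "f \<in> C0 \<Longrightarrow> cond_exp (gen f g) x = (if g = 0 then f x else 0)"
  unfolding gen_def by (rule cond_exp_generator[OF action]) (simp add: C0_functions_eq)

lemma cond_exp_le: "cmod (cond_exp a x) \<le> norm a"
  unfolding cond_exp_coef using order_trans[OF coef_le_norm norm_blinfun, of a "ket (0,x)"] by simp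

lemma cond_exp_add: "cond_exp (a + b) x = cond_exp a x + cond_exp b x"
  by (simp add: cond_exp_coef blinfun.add_left)

lemma cond_exp_diff: "cond_exp (a - b) x = cond_exp a x - cond_exp b x"
  by (simp add: cond_exp_coef blinfun.diff_left)

lemma cond_exp_cscale: "cond_exp (cscale_op c a) x = c * cond_exp a x"
  by (simp add: cond_exp_coef)

text \<open>By contractivity, norm limits become uniform limits of functions, so the generators
  decide.\<close>

lemma cond_exp_C0: "a \<in> A \<Longrightarrow> cond_exp a \<in> C0"
  unfolding A_eq
proof (induction rule: closure_span_induct)
  case closed
  have "a \<in> {a. cond_exp a \<in> C0}" if a: "a \<in> closure {a. cond_exp a \<in> C0}" for a
  proof (intro CollectI C0_uniform_limit)
    fix e :: real assume "0 < e"
    then have "\<exists>b\<in>{a. cond_exp a \<in> C0}. dist b a < e"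
      using a unfolding closure_approachable by simp
    then obtain b where b: "cond_exp b \<in> C0" "dist b a < e" by (elim bexE CollectE)
    have "norm (cond_exp a x - cond_exp b x) \<le> e" for x
      using cond_exp_le[of "a - b" x] b(2) by (simp add: cond_exp_diff dist_norm norm_minus_commute)
    then show "\<exists>f\<in>C0. \<forall>x. norm (cond_exp a x - f x) \<le> e" using b(1) by blast
  qed
  then show ?case by (intro closure_subset_eq[THEN iffD1] subsetI)
next
  case zero
  have "cond_exp (0 :: ('g \<times> 'x) op) = (\<lambda>_. 0)" by (simp add: cond_exp_coef fun_eq_iff)
  then show ?case by simp
next
  case (gen a)
  then obtain f g where a: "a = gen f g" "supported f g" by (auto simp: gens_def)
  have "cond_exp a = (\<lambda>x. if g = 0 then f x else 0)"
    unfolding a by (intro ext cond_exp_gen supported_C0[OF a(2)])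
  then show ?case using supported_C0[OF a(2)] by (cases "g = 0") auto
next
  case (add a b)
  have "cond_exp (a + b) = (\<lambda>x. cond_exp a x + cond_exp b x)" by (intro ext cond_exp_add)
  then show ?case using C0_add[OF add] by simp
next
  case (scale r a)
  have "cond_exp (r *\<^sub>R a) = (\<lambda>x. of_real r * cond_exp a x)"
    by (intro ext) (simp add: cond_exp_coef blinfun.scaleR_left)
  then show ?case using C0_cmult[OF scale] by simp
qed

lemma coef_phase: "coef (phase_op N t \<xi>) i = exp (\<i> * of_real t * of_real (ln (N (fst i)))) * coef \<xi> i"
  using coef_phase_op[OF N_pos, where t = t and \<xi> = \<xi> and h = "fst i" and x = "snd i"] N_pos[of "fst i"]
  by (simp add: powr_def Ln_of_real mult.commute mult.left_commute)

lemma phase_inv: "phase_op N (- t) (phase_op N t \<xi>) = \<xi>"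
  by (rule ell2_eqI) (simp add: coef_phase exp_minus)

lemma dynamics_mult: "dynamics N t (a o\<^sub>L b) = dynamics N t a o\<^sub>L dynamics N t (b :: ('g \<times> 'x) op)"
  unfolding dynamics_def by (rule blinfun_eqI) (simp add: phase_inv)

lemma dynamics_inverse: "dynamics N t (dynamics N (- t) a) = (a :: ('g \<times> 'x) op)"
proof -
  have "phase_op N t (phase_op N (- t) \<xi>) = \<xi>" for \<xi> :: "('g \<times> 'x) ell2"
    using phase_inv[of "- t"] by simp
  then show ?thesis unfolding dynamics_def by (intro blinfun_eqI) simp
qed

lemma bounded_linear_dynamics: "bounded_linear (dynamics N t :: ('g \<times> 'x) op \<Rightarrow> _)"
  unfolding dynamics_def
  by (rule bounded_linear_compose[OF bounded_linear_compose_left bounded_linear_compose_right])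

lemma dynamics_gen:
  assumes "f \<in> C0"
  shows "dynamics N t (gen f g) = cscale_op (exp (\<i> * of_real t * of_real (ln (N g)))) (gen f g)"
proof -
  have "complex_of_real (N g) powr (\<i> * of_real t) = exp (\<i> * of_real t * of_real (ln (N g)))"
    using N_pos[of g] by (simp add: powr_def Ln_of_real mult.commute mult.left_commute)
  then show ?thesis
    unfolding gen_def using dynamics_generator[of N f t act g, OF N_pos N_add] assms
    by (simp only: C0_functions_eq)
qed

lemma dynamics_A: "a \<in> A \<Longrightarrow> dynamics N t a \<in> A"
  unfolding A_eq
proof (erule bounded_linear_closure_span[OF bounded_linear_dynamics, rotated])
  fix a assume "a \<in> gens"
  then obtain f g where a: "a = gen f g" "supported f g" by (auto simp: gens_def)
  show "dynamics N t a \<in> closure (span gens)"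
    unfolding a(1) dynamics_gen[OF supported_C0[OF a(2)]] A_eq[symmetric]
    by (intro csubspace_opD[OF csubspace_A] gen_A a(2))
qed

text \<open>The diagonal entry is taken at the neutral element, where the phase is 1.\<close>

lemma cond_exp_dynamics: "cond_exp (dynamics N t a) x = cond_exp a x"
proof -
  have "phase_op N (- t) (ket (0, x)) = ket (0, x)"
    by (rule ell2_eqI) (auto simp: coef_phase coef_ket N_0)
  then show ?thesis by (simp add: cond_exp_coef dynamics_def coef_phase N_0)
qed

lemma entire_extension_gen:
  assumes "supported f g"
  shows "entire_extension A (dynamics N) (gen f g) (\<lambda>z. cscale_op (exp (\<i> * z * of_real (ln (N g)))) (gen f g))"
  unfolding entire_extension_def
proof (intro conjI allI)
  show "cscale_op (exp (\<i> * z * of_real (ln (N g)))) (gen f g) \<in> A" for z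
    by (intro csubspace_opD[OF csubspace_A] gen_A assms)
  show "cscale_op (exp (\<i> * of_real t * of_real (ln (N g)))) (gen f g) = dynamics N t (gen f g)" for t
    by (rule dynamics_gen[OF supported_C0[OF assms], symmetric])
  fix z
  let ?c = "exp (\<i> * z * of_real (ln (N g))) * (\<i> * of_real (ln (N g)))"
  have "((\<lambda>z. exp (\<i> * z * of_real (ln (N g)))) has_field_derivative ?c) (at z)"
    by (auto intro!: derivative_eq_intros)
  then have "((\<lambda>z. exp (\<i> * z * of_real (ln (N g)))) has_derivative (\<lambda>w. ?c * w)) (at z)"
    by (simp add: has_field_derivative_def)
  from bounded_linear.has_derivative[OF bounded_linear_cscale_left this, of "gen f g"]
  show "\<exists>D. ((\<lambda>z. cscale_op (exp (\<i> * z * of_real (ln (N g)))) (gen f g)) has_derivative (\<lambda>w. cscale_op w D)) (at z)"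
    by (intro exI[of _ "cscale_op ?c (gen f g)"]) (simp add: mult.commute)
qed

text \<open>The extension is picked by \<open>SOME\<close>. Every coefficient functional satisfies
  the eigenvector equation on a generator, so any choice must be the explicit exponential.\<close>

lemma analytic_value_gen:
  assumes "supported f g"
  shows "analytic_value A (dynamics N) z (gen f g) = cscale_op (exp (\<i> * z * of_real (ln (N g)))) (gen f g)"
proof -
  define F where "F = (SOME F. entire_extension A (dynamics N) (gen f g) F)"
  have F: "entire_extension A (dynamics N) (gen f g) F"
    unfolding F_def by (rule someI[of "entire_extension A (dynamics N) (gen f g)", OF entire_extension_gen[OF assms]])
  have "F z = cscale_op (exp (\<i> * z * of_real (ln (N g)))) (gen f g)"
  proof (rule op_eqI)
    fix \<xi> i
    have "bounded_functional A (\<lambda>a. coef (a \<xi>) i)"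
      unfolding bounded_functional_def
    proof (intro conjI ballI allI exI)
      show "cmod (coef (blinfun_apply a \<xi>) i) \<le> norm \<xi> * norm a" for a
        using order_trans[OF coef_le_norm norm_blinfun, of a \<xi> i] by (simp add: mult.commute)
    qed (auto simp: blinfun.add_left)
    then have "coef (F z \<xi>) i = exp (\<i> * z * of_real (ln (N g))) * coef (gen f g \<xi>) i"
      by (rule entire_extension_eigenvector[OF csubspace_A closed_A _ F])
        (simp add: dynamics_gen[OF supported_C0[OF assms]])
    then show "coef (F z \<xi>) i = coef (cscale_op (exp (\<i> * z * of_real (ln (N g)))) (gen f g) \<xi>) i"
      by simp
  qed
  then show ?thesis by (simp add: analytic_value_def F_def)
qed

end

section \<open>States given by measures\<close>

lemma sets_restrict_borel: "Z \<in> sets borel \<Longrightarrow> sets (restrict_space borel Z) = {B \<in> sets borel. B \<subseteq> Z}"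
  by (auto simp: sets_restrict_space)

lemma prob_measuresD:
  assumes "\<mu> \<in> prob_measures Z" "Z \<in> sets borel"
  shows "prob_space \<mu>" "space \<mu> = Z" "sets \<mu> = {B \<in> sets borel. B \<subseteq> Z}"
    "f \<in> borel_measurable borel \<Longrightarrow> f \<in> borel_measurable \<mu>"
    "sets \<mu> = sets (restrict_space borel Z)"
proof -
  show sets: "sets \<mu> = sets (restrict_space borel Z)" and "prob_space \<mu>"
    using assms(1) by (auto simp: prob_measures_def)
  show "space \<mu> = Z" using sets_eq_imp_space_eq[OF sets] by (simp add: space_restrict_space)
  show "sets \<mu> = {B \<in> sets borel. B \<subseteq> Z}" using sets sets_restrict_borel[OF assms(2)] by simp
  show "f \<in> borel_measurable borel \<Longrightarrow> f \<in> borel_measurable \<mu>"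
    using measurable_cong_sets[OF sets refl] measurable_restrict_space1 by blast
qed

lemma (in prob_space) integral_norm_le:
  fixes f :: "'a \<Rightarrow> complex"
  assumes "\<And>x. cmod (f x) \<le> B"
  shows "cmod (integral\<^sup>L M f) \<le> B"
proof (cases "integrable M f")
  case True
  have "cmod (integral\<^sup>L M f) \<le> (\<integral>x. cmod (f x) \<partial>M)" by (rule integral_norm_bound)
  also have "\<dots> \<le> (\<integral>x. B \<partial>M)" using True assms by (intro integral_mono) auto
  also have "\<dots> = B" by (simp add: prob_space)
  finally show ?thesis .
next
  case False
  then show ?thesis using order_trans[OF norm_ge_zero assms] by (simp add: not_integrable_integral_eq)
qed

lemma integral_square_distr:
  fixes f :: "'x::topological_space \<Rightarrow> real"
  assumes "f \<in> borel_measurable borel" "T \<in> M \<rightarrow>\<^sub>M borel"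
  shows "(\<integral>x. (f x)\<^sup>2 \<partial>distr M borel T) = (\<integral>x. (f (T x))\<^sup>2 \<partial>M)"
  by (rule integral_distr[OF assms(2)]) (use assms(1) in measurable)

context partial_action
begin

lemma Y_borel [measurable]: "Y \<in> sets borel" using Y by auto

lemma act_measurable [measurable]: "act g \<in> borel \<rightarrow>\<^sub>M borel"
  by (rule borel_measurable_continuous_onI[OF act_cont])

lemma act_image: "act g ` Z = act (- g) -` Z"
  by (auto simp: image_iff) (metis act_inv(2))

lemma act_image_borel: "Z \<in> sets borel \<Longrightarrow> act g ` Z \<in> sets borel"
  using measurable_sets[OF act_measurable, of Z "- g"] by (simp add: act_image)

lemma act_image_image: "act g ` act h ` Z = act (g + h) ` Z"
  by (simp add: image_image act_add)

text \<open>Measures on \<open>Y\<close> live on the trace sigma-algebra; pushed to the whole space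
  they can be compared by the regularity lemmas and moved by \<open>act g\<close>.\<close>

definition extend :: "'x measure \<Rightarrow> 'x measure" where
  "extend \<mu> = distr \<mu> borel (\<lambda>x. x)"

lemma id_measurable: "\<mu> \<in> prob_measures Y \<Longrightarrow> (\<lambda>x. x) \<in> \<mu> \<rightarrow>\<^sub>M borel"
  by (rule prob_measuresD(4)[OF _ Y_borel]) auto

lemma extend_props:
  assumes "\<mu> \<in> prob_measures Y"
  shows "sets (extend \<mu>) = sets borel" "prob_space (extend \<mu>)"
    "Z \<in> sets borel \<Longrightarrow> emeasure (extend \<mu>) Z = emeasure \<mu> (Z \<inter> Y)"
proof -
  interpret prob_space \<mu> using prob_measuresD[OF assms Y_borel] by blast
  show "sets (extend \<mu>) = sets borel" by (simp add: extend_def)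
  show "prob_space (extend \<mu>)" unfolding extend_def by (rule prob_space_distr[OF id_measurable[OF assms]])
  show "emeasure (extend \<mu>) Z = emeasure \<mu> (Z \<inter> Y)" if "Z \<in> sets borel"
    unfolding extend_def using that id_measurable[OF assms] prob_measuresD(2)[OF assms Y_borel]
    by (subst emeasure_distr) (auto simp: Int_commute)
qed

lemma cond_exp_integrable:
  assumes "\<mu> \<in> prob_measures Y" "a \<in> A" shows "integrable \<mu> (cond_exp a)"
proof -
  interpret prob_space \<mu> using prob_measuresD[OF assms(1) Y_borel] by blast
  show ?thesis
    by (rule integrable_const_bound[where B = "norm a"])
      (auto intro!: cond_exp_le prob_measuresD(4)[OF assms(1) Y_borel] C0_borel[OF cond_exp_C0[OF assms(2)]])
qed

lemma supported_real:
  fixes f :: "'x \<Rightarrow> real"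
  assumes "f \<in> C0" shows "supported (\<lambda>x. of_real (indicator Y x * f x)) 0"
  unfolding supported_def
proof
  show "(\<lambda>x. complex_of_real (indicator Y x * f x)) \<in> C0"
    by (rule C0_of_real[OF C0_indicator[OF assms Y]])
qed (simp add: indicator_def)

lemma measure_state_real:
  fixes f :: "'x \<Rightarrow> real"
  assumes \<mu>: "\<mu> \<in> prob_measures Y" and f: "f \<in> C0"
  shows "measure_state act Y \<mu> (gen (\<lambda>x. of_real (indicator Y x * f x)) 0) = of_real (\<integral>x. f x \<partial>\<mu>)"
proof -
  note s = supported_real[OF f]
  have "(\<integral>x. cond_exp (gen (\<lambda>x. of_real (indicator Y x * f x)) 0) x \<partial>\<mu>) = (\<integral>x. of_real (f x) \<partial>\<mu>)"
    unfolding cond_exp_gen[OF supported_C0[OF s]]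
    by (rule Bochner_Integration.integral_cong[OF refl]) (simp add: prob_measuresD(2)[OF \<mu> Y_borel])
  then show ?thesis unfolding measure_state_def using gen_A[OF s] by simp
qed

lemma C0_square: "(f :: 'x \<Rightarrow> real) \<in> C0 \<Longrightarrow> (\<lambda>x. (f x)\<^sup>2) \<in> C0"
  unfolding power2_eq_square by (rule C0_mult)

text \<open>The state determines the integrals of squares of real \<open>C0\<close> functions, hence
  the extended measure.\<close>

lemma measure_state_inj:
  assumes \<mu>: "\<mu> \<in> prob_measures Y" and \<mu>': "\<mu>' \<in> prob_measures Y"
    and eq: "measure_state act Y \<mu> = measure_state act Y \<mu>'"
  shows "\<mu> = \<mu>'"
proof -
  note e = extend_props[OF \<mu>] and e' = extend_props[OF \<mu>']
  have "extend \<mu> = extend \<mu>'"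
  proof (rule finite_borel_measure_eqI[OF X])
    fix f :: "'x \<Rightarrow> real" assume f: "f \<in> C0"
    have "(\<integral>x. (f x)\<^sup>2 \<partial>\<mu>) = (\<integral>x. (f x)\<^sup>2 \<partial>\<mu>')"
      using measure_state_real[OF \<mu> C0_square[OF f]] measure_state_real[OF \<mu>' C0_square[OF f]] eq
      by (simp only: of_real_eq_iff)
    moreover have "f \<in> borel_measurable borel" by (rule C0_borel[OF f])
    ultimately show "(\<integral>x. (f x)\<^sup>2 \<partial>extend \<mu>) = (\<integral>x. (f x)\<^sup>2 \<partial>extend \<mu>')"
      unfolding extend_def using id_measurable[OF \<mu>] id_measurable[OF \<mu>'] by (simp add: integral_square_distr)
  qed (use e e' in \<open>auto intro: prob_space.finite_measure\<close>)
  show ?thesis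
  proof (rule measure_eqI)
    show "sets \<mu> = sets \<mu>'" using prob_measuresD(5)[OF \<mu> Y_borel] prob_measuresD(5)[OF \<mu>' Y_borel] by simp
    fix Z assume "Z \<in> sets \<mu>"
    then have Z: "Z \<in> sets borel" "Z \<inter> Y = Z" using prob_measuresD(3)[OF \<mu> Y_borel] by auto
    show "emeasure \<mu> Z = emeasure \<mu>' Z"
      using e(3)[OF Z(1)] e'(3)[OF Z(1)] Z(2) \<open>extend \<mu> = extend \<mu>'\<close> by simp
  qed
qed

lemma measure_state_additive:
  assumes "\<mu> \<in> prob_measures Y" "a \<in> A" "b \<in> A"
  shows "measure_state act Y \<mu> (a + b) = measure_state act Y \<mu> a + measure_state act Y \<mu> b"
proof -
  have "cond_exp (a + b) = (\<lambda>x. cond_exp a x + cond_exp b x)" by (intro ext cond_exp_add)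
  then show ?thesis using assms csubspace_opD(2)[OF csubspace_A] cond_exp_integrable
    by (simp add: measure_state_def)
qed

lemma measure_state_cscale:
  assumes "a \<in> A"
  shows "measure_state act Y \<mu> (cscale_op c a) = c * measure_state act Y \<mu> a"
proof -
  have "cond_exp (cscale_op c a) = (\<lambda>x. c * cond_exp a x)" by (intro ext cond_exp_cscale)
  then show ?thesis using assms csubspace_opD(3)[OF csubspace_A] by (simp add: measure_state_def)
qed

lemma measure_state_bound:
  assumes "\<mu> \<in> prob_measures Y" "a \<in> A" shows "cmod (measure_state act Y \<mu> a) \<le> norm a"
  using assms(2) prob_space.integral_norm_le[OF prob_measuresD(1)[OF assms(1) Y_borel] cond_exp_le, of a]
  by (simp add: measure_state_def)

lemma is_state_measure_state:
  assumes \<mu>: "\<mu> \<in> prob_measures Y"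
  shows "is_state A (measure_state act Y \<mu>)"
proof -
  interpret prob_space \<mu> using prob_measuresD[OF \<mu> Y_borel] by blast
  let ?\<phi> = "measure_state act Y \<mu>"
  let ?V = "{cmod (?\<phi> a) | a. a \<in> A \<and> norm a \<le> 1}"
  have ub: "v \<le> 1" if "v \<in> ?V" for v
  proof -
    obtain a where "v = cmod (?\<phi> a)" "a \<in> A" "norm a \<le> 1" using \<open>v \<in> ?V\<close> by blast
    then show ?thesis using order_trans[OF measure_state_bound[OF \<mu>]] by simp
  qed
  then have bdd: "bdd_above ?V" by (rule bdd_aboveI)
  \<comment> \<open>No unit is at hand, so norm 1 is approached along the functions
    \<open>?s n\<close>, which are at most 1 and tend to the indicator of \<open>Y\<close>.\<close>
  obtain f :: "'x \<Rightarrow> real" where f: "f \<in> C0" "\<And>x. 0 \<le> f x" "Y = {x. 0 < f x}"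
    using open_eq_positive_C0[OF X Y(1)] by metis
  let ?s = "\<lambda>n x. (real n * f x / (1 + real n * f x))\<^sup>2"
  have sC0: "?s n \<in> C0" for n by (intro C0_square C0_saturate f)
  have s01: "0 \<le> ?s n x" "?s n x \<le> 1" for n x
    using saturate_square_range[OF f(2)] by blast+
  have lim: "(\<lambda>n. \<integral>x. ?s n x \<partial>\<mu>) \<longlonglongrightarrow> 1"
  proof -
    have "(\<integral>x. ?s n x \<partial>extend \<mu>) = (\<integral>x. ?s n x \<partial>\<mu>)" for n
      unfolding extend_def
      by (rule integral_distr[OF id_measurable[OF \<mu>]])
        (rule C0_borel[OF sC0])
    moreover have "measure (extend \<mu>) Y = 1"
      using extend_props(3)[OF \<mu> Y_borel] prob_measuresD(2)[OF \<mu> Y_borel] emeasure_space_1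
      by (simp add: measure_def)
    ultimately show ?thesis
      using saturate_LIMSEQ[OF prob_space.finite_measure extend_props(1)[OF \<mu>] C0_continuous[OF f(1)] f(2)]
        extend_props(2)[OF \<mu>] f(3) by simp
  qed
  have "1 \<le> Sup ?V"
  proof (rule LIMSEQ_le_const2[OF lim], intro exI allI impI)
    fix n :: nat assume "0 \<le> n"
    let ?a = "gen (\<lambda>x. of_real (indicator Y x * ?s n x)) 0"
    have "norm ?a \<le> 1"
    proof (rule norm_gen)
      show "cmod (of_real (indicator Y x * ?s n x)) \<le> 1" for x
        unfolding norm_of_real using s01[of n x] by (auto simp: indicator_def)
    qed
    then have "cmod (?\<phi> ?a) \<in> ?V" using gen_A[OF supported_real[OF sC0[of n]]] by blast
    moreover have "cmod (?\<phi> ?a) = (\<integral>x. ?s n x \<partial>\<mu>)"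
      unfolding measure_state_real[OF \<mu> sC0[of n]] norm_of_real
      by (rule abs_of_nonneg) (rule integral_nonneg_AE, simp)
    ultimately show "(\<integral>x. ?s n x \<partial>\<mu>) \<le> Sup ?V" using cSup_upper[OF _ bdd] by simp
  qed
  moreover have "Sup ?V \<le> 1"
  proof (rule cSup_least[OF _ ub])
    have "0 \<in> A \<and> norm (0 :: ('g \<times> 'x) op) \<le> 1" using csubspace_opD(1)[OF csubspace_A] by simp
    then show "?V \<noteq> {}" by blast
  qed
  ultimately have Sup: "Sup ?V = 1" by simp
  \<comment> \<open>The expectation of the product is the squared norm of
    \<open>a (ket (0, x))\<close> at each \<open>x\<close>. Outside \<open>A\<close> the functional
    is 0 by convention.\<close>
  have pos: "?\<phi> (adj_op a o\<^sub>L a) \<in> \<real>\<^sub>\<ge>\<^sub>0" if a: "a \<in> A" for a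
  proof (cases "adj_op a o\<^sub>L a \<in> A")
    case True
    have "cond_exp (adj_op a o\<^sub>L a) x = of_real ((norm (a (ket (0, x))))\<^sup>2)" for x
    proof -
      have "cinner (a (ket (0, x))) (a (ket (0, x))) = cinner (ket (0, x)) (adj_op a (a (ket (0, x))))"
        using A_adjoint[OF a] by (simp add: is_adjoint_def)
      then have "cond_exp (adj_op a o\<^sub>L a) x = cnj (cinner (a (ket (0, x))) (a (ket (0, x))))"
        unfolding cond_exp_def by (metis blinfun_apply_blinfun_compose cinner_commute)
      then show ?thesis unfolding cinner_self_norm by (simp del: of_real_power)
    qed
    then have "cond_exp (adj_op a o\<^sub>L a) = (\<lambda>x. of_real ((norm (a (ket (0, x))))\<^sup>2))" by (rule ext)
    then have "?\<phi> (adj_op a o\<^sub>L a) = of_real (\<integral>x. (norm (a (ket (0, x))))\<^sup>2 \<partial>\<mu>)"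
      using True by (simp add: measure_state_def del: of_real_power)
    then show ?thesis by (simp add: integral_nonneg_AE del: of_real_power)
  qed (simp add: measure_state_def)
  show ?thesis
    unfolding is_state_def
    using measure_state_additive[OF \<mu>] measure_state_cscale pos bdd Sup
    by (simp add: measure_state_def)
qed

text \<open>Both the set and its translate have to lie in \<open>Y\<close>, since the group does not
  preserve \<open>Y\<close>.\<close>

definition scaling :: "real \<Rightarrow> 'x measure \<Rightarrow> bool" where
  "scaling \<beta> \<mu> \<longleftrightarrow> \<mu> \<in> prob_measures Y \<and>
     (\<forall>g Z. Z \<in> sets borel \<longrightarrow> Z \<subseteq> Y \<longrightarrow> act g ` Z \<subseteq> Y \<longrightarrow>
        emeasure \<mu> (act g ` Z) = ennreal (N g powr - \<beta>) * emeasure \<mu> Z)"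

text \<open>\<open>act g\<close> carries \<open>W'\<close> onto \<open>W\<close>, and
  \<open>F\<close> lives on \<open>W\<close>. The identity for sets is thus one between a restricted
  measure and the image of another, and integrals follow.\<close>

lemma scaling_integral:
  fixes F :: "'x \<Rightarrow> complex"
  assumes \<mu>: "scaling \<beta> \<mu>" and F: "F \<in> borel_measurable borel" "\<And>x. F x \<noteq> 0 \<Longrightarrow> x \<in> Y \<and> act (- g) x \<in> Y"
  shows "(\<integral>x. F x \<partial>\<mu>) = of_real (N g powr - \<beta>) * (\<integral>x. F (act g x) \<partial>\<mu>)"
proof -
  have p: "\<mu> \<in> prob_measures Y" using \<mu> by (simp add: scaling_def)
  note e = extend_props[OF p]
  note [measurable] = F(1)
  let ?m = "extend \<mu>" and ?c = "N g powr - \<beta>"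
  have [measurable_cong]: "sets ?m = sets borel" by (rule e(1))
  define W where "W = Y \<inter> act g ` Y"
  define W' where "W' = Y \<inter> act (- g) ` Y"
  have [measurable]: "W \<in> sets borel" "W' \<in> sets borel"
    unfolding W_def W'_def by (intro sets.Int Y_borel act_image_borel)+
  have W: "x \<in> W \<longleftrightarrow> x \<in> Y \<and> act (- g) x \<in> Y" "x \<in> W' \<longleftrightarrow> x \<in> Y \<and> act g x \<in> Y" for x
    by (auto simp: W_def W'_def act_image)
  \<comment> \<open>A set is first replaced by its part in \<open>W\<close>, so that it and its
    preimage are both inside \<open>Y\<close> and the hypothesis applies.\<close>
  have eq: "density ?m (indicator W) = density (distr (density ?m (indicator W')) borel (act g)) (\<lambda>_. ennreal ?c)"
  proof (rule measure_eqI)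
    fix Z assume "Z \<in> sets (density ?m (indicator W))"
    then have Z [measurable]: "Z \<in> sets borel" by (simp add: e(1))
    let ?Z = "{x \<in> W'. act g x \<in> Z}"
    have Zb [measurable]: "?Z \<in> sets borel" by measurable
    have ZY: "act g ` ?Z = Z \<inter> W" "?Z \<subseteq> Y"
      by (auto simp: act_image W)
    have "emeasure (density ?m (indicator W)) Z = emeasure ?m (W \<inter> Z)"
      by (subst emeasure_density) (auto simp: indicator_inter_arith[symmetric] e(1))
    also have "\<dots> = emeasure \<mu> (W \<inter> Z \<inter> Y)" by (rule e(3)) measurable
    also have "W \<inter> Z \<inter> Y = Z \<inter> W" by (auto simp: W_def)
    also have "emeasure \<mu> (Z \<inter> W) = ennreal ?c * emeasure \<mu> ?Z"
    proof -
      have "act g ` ?Z \<subseteq> Y" unfolding ZY(1) by (auto simp: W_def)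
      then have "emeasure \<mu> (act g ` ?Z) = ennreal ?c * emeasure \<mu> ?Z"
        using \<mu> Zb ZY(2) unfolding scaling_def by blast
      then show ?thesis unfolding ZY(1) .
    qed
    also have "emeasure \<mu> ?Z = emeasure (density ?m (indicator W')) (act g -` Z)"
    proof -
      have "emeasure (density ?m (indicator W')) (act g -` Z) = emeasure ?m (W' \<inter> act g -` Z)"
        using measurable_sets[OF act_measurable Z, of g]
        by (subst emeasure_density) (auto simp: indicator_inter_arith[symmetric] e(1))
      also have "W' \<inter> act g -` Z = ?Z" by auto
      also have "emeasure ?m ?Z = emeasure \<mu> ?Z" using e(3)[OF Zb] ZY(2) by (simp add: Int_absorb2)
      finally show ?thesis by simp
    qed
    also have "\<dots> = emeasure (distr (density ?m (indicator W')) borel (act g)) Z"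
      by (subst emeasure_distr) (auto simp: e(1) sets_eq_imp_space_eq[OF e(1)])
    finally show "emeasure (density ?m (indicator W)) Z =
      emeasure (density (distr (density ?m (indicator W')) borel (act g)) (\<lambda>_. ennreal ?c)) Z"
      by (subst (2) emeasure_density) (auto simp: nn_integral_cmult_indicator)
  qed (simp add: e(1))
  have "(\<integral>x. F x \<partial>\<mu>) = (\<integral>x. F x \<partial>?m)"
    unfolding extend_def by (rule integral_distr[OF id_measurable[OF p] F(1), symmetric])
  also have "\<dots> = (\<integral>x. indicator W x *\<^sub>R F x \<partial>?m)"
    by (rule Bochner_Integration.integral_cong[OF refl]) (use F(2) in \<open>auto simp: indicator_def W\<close>)
  also have "\<dots> = integral\<^sup>L (density ?m (\<lambda>x. ennreal (indicator W x))) F"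
    by (rule integral_density[symmetric]) auto
  also have "\<dots> = integral\<^sup>L (density (distr (density ?m (indicator W')) borel (act g)) (\<lambda>_. ennreal ?c)) F"
    unfolding ennreal_indicator using eq by simp
  also have "\<dots> = (\<integral>x. ?c *\<^sub>R F x \<partial>distr (density ?m (indicator W')) borel (act g))"
    by (rule integral_density) auto
  also have "\<dots> = of_real ?c * (\<integral>x. F x \<partial>distr (density ?m (indicator W')) borel (act g))"
    by (simp add: scaleR_conv_of_real)
  also have "(\<integral>x. F x \<partial>distr (density ?m (indicator W')) borel (act g)) = (\<integral>x. F (act g x) \<partial>density ?m (indicator W'))"
    by (rule integral_distr) auto
  also have "\<dots> = (\<integral>x. F (act g x) \<partial>density ?m (\<lambda>x. ennreal (indicator W' x)))"
    unfolding ennreal_indicator ..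
  also have "\<dots> = (\<integral>x. indicator W' x *\<^sub>R F (act g x) \<partial>?m)"
    by (rule integral_density) auto
  also have "\<dots> = (\<integral>x. indicator W' x *\<^sub>R F (act g x) \<partial>\<mu>)"
    unfolding extend_def by (rule integral_distr[OF id_measurable[OF p]]) measurable
  also have "\<dots> = (\<integral>x. F (act g x) \<partial>\<mu>)"
    by (rule Bochner_Integration.integral_cong[OF refl])
      (use F(2)[of "act g _"] in \<open>auto simp: indicator_def W\<close>)
  finally show ?thesis .
qed

text \<open>The generators themselves serve as the set of analytic elements with dense span.\<close>

lemma scaling_imp_KMS:
  assumes \<mu>: "scaling \<beta> \<mu>"
  shows "measure_state act Y \<mu> \<in> KMS_states act Y N \<beta>"
proof -
  have p: "\<mu> \<in> prob_measures Y" using \<mu> by (simp add: scaling_def)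
  let ?\<phi> = "measure_state act Y \<mu>"
  have inv: "?\<phi> (dynamics N t a) = ?\<phi> a" if "a \<in> A" for t a
  proof -
    have "cond_exp (dynamics N t a) = cond_exp a" by (intro ext cond_exp_dynamics)
    then show ?thesis using that dynamics_A by (simp add: measure_state_def)
  qed
  have an: "gens \<subseteq> analytic_elements A (dynamics N)"
    unfolding analytic_elements_def using entire_extension_gen gen_A by (auto simp: gens_def)
  have kms: "?\<phi> (a o\<^sub>L b) = ?\<phi> (b o\<^sub>L analytic_value A (dynamics N) (\<i> * of_real \<beta>) a)"
    if ab: "a \<in> gens" "b \<in> gens" for a b
  proof -
    obtain f g k h where a: "a = gen f g" "supported f g" and b: "b = gen k h" "supported k h"
      using ab by (auto simp: gens_def)
    note f = supported_C0[OF a(2)] and k = supported_C0[OF b(2)]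
    \<comment> \<open>The eigenvalue of the dynamics on \<open>gen f g\<close>, continued to the
      time \<open>\<i> * \<beta>\<close>.\<close>
    have "exp (\<i> * (\<i> * of_real \<beta>) * of_real (ln (N g))) = of_real (N g powr - \<beta>)"
    proof -
      have "\<i> * (\<i> * of_real \<beta>) * of_real (ln (N g)) = of_real (- \<beta> * ln (N g))" by simp
      then have "exp (\<i> * (\<i> * of_real \<beta>) * of_real (ln (N g))) = of_real (exp (- \<beta> * ln (N g)))"
        by (simp only: exp_of_real)
      then show ?thesis using N_pos[of g] by (simp add: powr_def)
    qed
    then have av: "analytic_value A (dynamics N) (\<i> * of_real \<beta>) a = cscale_op (of_real (N g powr - \<beta>)) a"
      using analytic_value_gen[OF a(2)] a(1) by simp
    have "b o\<^sub>L cscale_op c a = cscale_op c (b o\<^sub>L a)" for c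
    proof -
      have "clinear_op b" by (rule A_clinear[OF gens_A[OF ab(2)]])
      then show ?thesis by (intro op_eqI) (simp add: cscale_op_def clinear_op_def)
    qed
    then have R: "?\<phi> (b o\<^sub>L analytic_value A (dynamics N) (\<i> * of_real \<beta>) a) = of_real (N g powr - \<beta>) * ?\<phi> (b o\<^sub>L a)"
      unfolding av using measure_state_cscale[OF gens_A[OF gens_mult[OF ab(2,1)]]] by simp
    have ab': "a o\<^sub>L b = gen (\<lambda>x. f x * k (act (- g) x)) (g + h)" "supported (\<lambda>x. f x * k (act (- g) x)) (g + h)"
      unfolding a b by (rule gen_mult[OF f k], rule supported_mult[OF a(2) b(2)])
    have ba': "b o\<^sub>L a = gen (\<lambda>x. k x * f (act (- h) x)) (h + g)" "supported (\<lambda>x. k x * f (act (- h) x)) (h + g)"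
      unfolding a b by (rule gen_mult[OF k f], rule supported_mult[OF b(2) a(2)])
    have \<phi>ab: "?\<phi> (a o\<^sub>L b) = (\<integral>x. (if g + h = 0 then f x * k (act (- g) x) else 0) \<partial>\<mu>)"
      unfolding ab'(1) measure_state_def using gen_A[OF ab'(2)]
      by (simp only: if_True ext[OF cond_exp_gen[OF supported_C0[OF ab'(2)]]])
    have \<phi>ba: "?\<phi> (b o\<^sub>L a) = (\<integral>x. (if h + g = 0 then k x * f (act (- h) x) else 0) \<partial>\<mu>)"
      unfolding ba'(1) measure_state_def using gen_A[OF ba'(2)]
      by (simp only: if_True ext[OF cond_exp_gen[OF supported_C0[OF ba'(2)]]])
    \<comment> \<open>Unless the group elements are mutually inverse, both products have expectation
      0; otherwise the two integrands correspond under \<open>act g\<close>.\<close>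
    show ?thesis
    proof (cases "g + h = 0")
      case True
      then have h: "h = - g" "h + g = 0" using minus_unique[of g h] by auto
      have "(\<integral>x. f x * k (act (- g) x) \<partial>\<mu>) = of_real (N g powr - \<beta>) * (\<integral>x. f (act g x) * k (act (- g) (act g x)) \<partial>\<mu>)"
      proof (rule scaling_integral[OF \<mu>])
        show "(\<lambda>x. f x * k (act (- g) x)) \<in> borel_measurable borel"
          by (rule C0_borel[OF supported_C0[OF ab'(2)]])
        show "x \<in> Y \<and> act (- g) x \<in> Y" if "f x * k (act (- g) x) \<noteq> 0" for x
          using a(2) that by (auto simp: supported_def)
      qed
      then show ?thesis unfolding R \<phi>ab \<phi>ba using True h by (simp add: mult.commute)
    next
      case False
      then have "h + g \<noteq> 0" using eq_neg_iff_add_eq_0[of h g] by auto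
      then show ?thesis unfolding R \<phi>ab \<phi>ba using False by simp
    qed
  qed
  show ?thesis
    unfolding KMS_states_def is_KMS_state_def
    using is_state_measure_state[OF p] inv an span_gens_dense kms by blast
qed

end

section \<open>Measures given by KMS states\<close>

lemma compose_cscale: "clinear_op a \<Longrightarrow> a o\<^sub>L cscale_op c b = cscale_op c (a o\<^sub>L b)"
  by (intro op_eqI) (simp add: cscale_op_def clinear_op_def)

lemmas compose_add_left = bounded_bilinear.add_left[OF bounded_bilinear_blinfun_compose]
lemmas compose_add_right = bounded_bilinear.add_right[OF bounded_bilinear_blinfun_compose]

lemma C0_sqrt_dominated:
  assumes f: "f \<in> C0" and g: "continuous_on UNIV g" and le: "\<And>x. norm (g x) \<le> sqrt (norm (f x))"
  shows "g \<in> C0"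
  unfolding C0_def
proof (intro CollectI conjI allI impI g)
  fix e :: real assume e: "0 < e"
  have "closed {x. e \<le> norm (g x)}"
    by (intro closed_Collect_le continuous_intros g)
  moreover have "compact {x. e\<^sup>2 \<le> norm (f x)}" by (rule C0_compact[OF f]) (use e in simp)
  ultimately have "compact ({x. e\<^sup>2 \<le> norm (f x)} \<inter> {x. e \<le> norm (g x)})"
    by (intro compact_Int_closed)
  moreover have "e\<^sup>2 \<le> norm (f x)" if "e \<le> norm (g x)" for x
    using order_trans[OF that le] e by (metis less_imp_le norm_ge_zero power_mono real_sqrt_pow2)
  then have "{x. e\<^sup>2 \<le> norm (f x)} \<inter> {x. e \<le> norm (g x)} = {x. e \<le> norm (g x)}" by auto
  ultimately show "compact {x. e \<le> norm (g x)}" by simp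
qed

text \<open>At 0 the quotient is 0 by the convention for division, and its modulus is
  \<open>sqrt (cmod z)\<close>, so it is continuous there as well.\<close>

lemma continuous_on_divide_sqrt: "continuous_on UNIV (\<lambda>z :: complex. z / of_real (sqrt (cmod z)))"
  unfolding continuous_on_eq_continuous_at[OF open_UNIV]
proof
  fix z :: complex
  show "isCont (\<lambda>z. z / of_real (sqrt (cmod z))) z"
  proof (cases "z = 0")
    case False
    then show ?thesis by (intro continuous_intros) auto
  next
    case True
    have "norm (w / of_real (sqrt (cmod w))) = sqrt (cmod w)" for w :: complex
      by (simp add: norm_divide real_div_sqrt)
    moreover have "(\<lambda>w :: complex. sqrt (cmod w)) \<midarrow>0\<rightarrow> 0"
      by (intro tendsto_eq_intros) auto
    ultimately have "(\<lambda>w :: complex. w / of_real (sqrt (cmod w))) \<midarrow>0\<rightarrow> 0"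
      by (subst tendsto_norm_zero_iff[symmetric]) simp
    then show ?thesis using True by (simp add: isCont_def)
  qed
qed

context partial_action
begin

lemma bounded_functional_compose:
  assumes \<psi>: "bounded_functional A \<psi>" and a: "a \<in> A"
  shows "bounded_functional A (\<lambda>x. \<psi> (a o\<^sub>L x))" "bounded_functional A (\<lambda>x. \<psi> (x o\<^sub>L a))"
proof -
  obtain K where K: "\<And>a. a \<in> A \<Longrightarrow> cmod (\<psi> a) \<le> K * norm a"
    using \<psi> unfolding bounded_functional_def by blast
  note b = bounded_functionalD[OF csubspace_A \<psi>]
  have "cmod (\<psi> (a o\<^sub>L x)) \<le> (\<bar>K\<bar> * norm a) * norm x" "cmod (\<psi> (x o\<^sub>L a)) \<le> (\<bar>K\<bar> * norm a) * norm x" if "x \<in> A" for x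
  proof -
    have *: "cmod (\<psi> y) \<le> (\<bar>K\<bar> * norm a) * norm x" if "y \<in> A" "norm y \<le> norm a * norm x" for y
    proof -
      have "cmod (\<psi> y) \<le> \<bar>K\<bar> * norm y"
        using K[OF that(1)] by (meson abs_ge_self mult_right_mono norm_ge_zero order_trans)
      also have "\<dots> \<le> \<bar>K\<bar> * (norm a * norm x)" by (rule mult_left_mono[OF that(2)]) simp
      finally show ?thesis by (simp add: mult.assoc)
    qed
    show "cmod (\<psi> (a o\<^sub>L x)) \<le> (\<bar>K\<bar> * norm a) * norm x"
      by (rule *[OF A_mult[OF a that] norm_blinfun_compose])
    show "cmod (\<psi> (x o\<^sub>L a)) \<le> (\<bar>K\<bar> * norm a) * norm x"
      using norm_blinfun_compose[of x a] by (intro * A_mult a that) (simp add: mult.commute)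
  qed
  then show "bounded_functional A (\<lambda>x. \<psi> (a o\<^sub>L x))" "bounded_functional A (\<lambda>x. \<psi> (x o\<^sub>L a))"
    unfolding bounded_functional_def
    by (auto simp: compose_add_left compose_add_right compose_cscale[OF A_clinear[OF a]] cscale_compose_left
        b(1,2) A_mult a intro!: exI[of _ "\<bar>K\<bar> * norm a"])
qed

end

locale KMS_state = partial_action act Y N
  for act :: "'g::{group_add, countable} \<Rightarrow> 'x::{second_countable_topology, t2_space} \<Rightarrow> 'x" and Y N +
  fixes \<beta> :: real and \<phi> :: "('g \<times> 'x) op \<Rightarrow> complex"
  assumes KMS: "\<phi> \<in> KMS_states act Y N \<beta>"
begin

lemma is_KMS: "is_KMS_state A (dynamics N) \<beta> \<phi>"
  using KMS by (simp add: KMS_states_def)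

lemma state: "is_state A \<phi>" using is_KMS by (simp add: is_KMS_state_def)

lemma \<phi>_outside: "a \<notin> A \<Longrightarrow> \<phi> a = 0" using state by (simp add: is_state_def)

lemma \<phi>_norm: assumes a: "a \<in> A" shows "cmod (\<phi> a) \<le> norm a"
proof (cases "a = 0")
  case True
  have "\<phi> (cscale_op 0 a) = 0 * \<phi> a" using state a unfolding is_state_def by blast
  then show ?thesis using True by simp
next
  case False
  define r where "r = inverse (norm a)"
  have r: "0 < r" "r * norm a = 1" using False by (simp_all add: r_def)
  let ?a = "cscale_op (of_real r) a"
  have "norm ?a \<le> 1" using norm_cscale_op_le[of "of_real r" a] r by simp
  moreover have "?a \<in> A" by (rule csubspace_opD(3)[OF csubspace_A a])
  ultimately have "cmod (\<phi> ?a) \<in> {cmod (\<phi> a) | a. a \<in> A \<and> norm a \<le> 1}" by blast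
  then have "cmod (\<phi> ?a) \<le> Sup {cmod (\<phi> a) | a. a \<in> A \<and> norm a \<le> 1}"
    by (rule cSup_upper) (rule state[unfolded is_state_def, THEN conjunct2, THEN conjunct2, THEN conjunct2, THEN conjunct2, THEN conjunct1])
  then have "cmod (\<phi> ?a) \<le> 1" using state unfolding is_state_def by simp
  moreover have "\<phi> ?a = of_real r * \<phi> a" using state a unfolding is_state_def by blast
  ultimately have "r * cmod (\<phi> a) \<le> r * norm a" using r by (simp add: norm_mult)
  then show ?thesis using r(1) by simp
qed

lemma bounded_functional_\<phi>: "bounded_functional A \<phi>"
  unfolding bounded_functional_def
proof (intro conjI exI ballI)
  show "cmod (\<phi> a) \<le> 1 * norm a" if "a \<in> A" for a using \<phi>_norm[OF that] by simp
qed (use state in \<open>auto simp: is_state_def\<close>)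

lemmas \<phi>_linear = bounded_functionalD[OF csubspace_A bounded_functional_\<phi>]

text \<open>
  For a generator \<open>b\<close>, invariance of the state makes \<open>x \<mapsto> \<phi>(b x)\<close> an eigenvector of the
  dynamics, so the KMS condition, given on an unspecified set \<open>D\<close> of analytic elements,
  passes to all of \<open>A\<close> by linearity and continuity.
\<close>

lemma KMS_gen:
  assumes s: "supported f g" and a: "a \<in> A"
  shows "\<phi> (a o\<^sub>L gen f g) = of_real (N g powr \<beta>) * \<phi> (gen f g o\<^sub>L a)"
proof -
  obtain D where D: "D \<subseteq> analytic_elements A (dynamics N)" "closure (cspan_op D) = A"
    and DD: "\<And>a b. a \<in> D \<Longrightarrow> b \<in> D \<Longrightarrow> \<phi> (a o\<^sub>L b) = \<phi> (b o\<^sub>L analytic_value A (dynamics N) (\<i> * of_real \<beta>) a)"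
    and inv: "\<And>t a. a \<in> A \<Longrightarrow> \<phi> (dynamics N t a) = \<phi> a"
    using is_KMS unfolding is_KMS_state_def by metis
  have DA: "D \<subseteq> A" using D(1) by (auto simp: analytic_elements_def)
  let ?b = "gen f g"
  have b: "?b \<in> A" by (rule gen_A[OF s])
  have eqD: "\<phi> (a o\<^sub>L ?b) = of_real (N g powr \<beta>) * \<phi> (?b o\<^sub>L a)" if a: "a \<in> D" for a
  proof -
    have aA: "a \<in> A" using a DA by auto
    define F where "F = (SOME F. entire_extension A (dynamics N) a F)"
    have "\<exists>F. entire_extension A (dynamics N) a F"
      using a D(1) by (auto simp: analytic_elements_def)
    then have F: "entire_extension A (dynamics N) a F" unfolding F_def by (rule someI_ex)
    have FA: "F z \<in> A" for z using F by (simp add: entire_extension_def)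
    have av: "analytic_value A (dynamics N) (\<i> * of_real \<beta>) a = F (\<i> * of_real \<beta>)"
      by (simp add: analytic_value_def F_def)
    \<comment> \<open>For fixed \<open>a\<close> both sides are bounded functionals of the second
      factor and agree on \<open>D\<close>, so they agree at \<open>?b\<close>.\<close>
    have "\<phi> (a o\<^sub>L ?b) = \<phi> (?b o\<^sub>L F (\<i> * of_real \<beta>))"
    proof (rule bounded_functional_eqI[OF csubspace_A bounded_functional_compose(1)[OF bounded_functional_\<phi> aA]
          bounded_functional_compose(2)[OF bounded_functional_\<phi> FA] DA _ _ b])
      show "A \<subseteq> closure (cspan_op D)" by (simp add: D)
      show "\<phi> (a o\<^sub>L d) = \<phi> (d o\<^sub>L F (\<i> * of_real \<beta>))" if "d \<in> D" for d
        using DD[OF a that] by (simp add: av)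
    qed
    also have "\<dots> = exp (\<i> * (\<i> * of_real \<beta>) * of_real (- ln (N g))) * \<phi> (?b o\<^sub>L a)"
    proof (rule entire_extension_eigenvector[OF csubspace_A closed_A bounded_functional_compose(1)[OF bounded_functional_\<phi> b] F])
      fix t
      have "?b o\<^sub>L dynamics N t a = dynamics N t (dynamics N (- t) ?b o\<^sub>L a)"
        by (simp add: dynamics_mult dynamics_inverse)
      then have "\<phi> (?b o\<^sub>L dynamics N t a) = \<phi> (dynamics N (- t) ?b o\<^sub>L a)"
        using inv[OF A_mult[OF dynamics_A[OF b] aA]] by simp
      also have "\<dots> = exp (\<i> * of_real t * of_real (- ln (N g))) * \<phi> (?b o\<^sub>L a)"
        unfolding dynamics_gen[OF supported_C0[OF s]] cscale_compose_left
        by (simp add: \<phi>_linear(2)[OF A_mult[OF b aA]])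
      finally show "\<phi> (?b o\<^sub>L dynamics N t a) = exp (\<i> * of_real t * of_real (- ln (N g))) * \<phi> (?b o\<^sub>L a)" .
    qed
    \<comment> \<open>The functional has the inverse eigenvalue of \<open>gen f g\<close>, whence
      \<open>- ln (N g)\<close>; together with the square of the imaginary unit the sign becomes
      positive.\<close>
    also have "exp (\<i> * (\<i> * of_real \<beta>) * of_real (- ln (N g))) = complex_of_real (N g powr \<beta>)"
    proof -
      have "\<i> * (\<i> * of_real \<beta>) * of_real (- ln (N g)) = complex_of_real (\<beta> * ln (N g))" by simp
      then have "exp (\<i> * (\<i> * of_real \<beta>) * of_real (- ln (N g))) = complex_of_real (exp (\<beta> * ln (N g)))"
        by (simp only: exp_of_real)
      then show ?thesis using N_pos[of g] by (simp add: powr_def)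
    qed
    finally show ?thesis .
  qed
  let ?c = "complex_of_real (N g powr \<beta>)"
  have cb: "cscale_op ?c ?b \<in> A" by (rule csubspace_opD(3)[OF csubspace_A b])
  have sc: "\<phi> (cscale_op ?c ?b o\<^sub>L a) = ?c * \<phi> (?b o\<^sub>L a)" if "a \<in> A" for a
    unfolding cscale_compose_left by (rule \<phi>_linear(2)[OF A_mult[OF b that]])
  have "\<phi> (a o\<^sub>L ?b) = \<phi> (cscale_op ?c ?b o\<^sub>L a)"
  proof (rule bounded_functional_eqI[OF csubspace_A bounded_functional_compose(2)[OF bounded_functional_\<phi> b]
        bounded_functional_compose(1)[OF bounded_functional_\<phi> cb] DA _ _ a])
    show "A \<subseteq> closure (cspan_op D)" by (simp add: D)
    show "\<phi> (d o\<^sub>L ?b) = \<phi> (cscale_op ?c ?b o\<^sub>L d)" if "d \<in> D" for d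
      using eqD[OF that] sc[of d] DA that by auto
  qed
  then show ?thesis using sc[OF a] by simp
qed

lemma \<phi>_positive: "a \<in> A \<Longrightarrow> \<phi> (adj_op a o\<^sub>L a) \<in> \<real>\<^sub>\<ge>\<^sub>0"
  using state by (simp add: is_state_def)

text \<open>The adjoints are supplied explicitly so that all products are known to lie in
  \<open>A\<close>. The positive bound \<open>M\<close> replaces the value itself, which might
  vanish.\<close>

lemma \<phi>_Cauchy_Schwarz:
  assumes x: "x \<in> A" "is_adjoint x x'" "x' \<in> A" and y: "y \<in> A" "is_adjoint y y'" "y' \<in> A"
    and M: "cmod (\<phi> (x' o\<^sub>L x)) \<le> M" "0 < M"
  shows "(cmod (\<phi> (y' o\<^sub>L x)))\<^sup>2 \<le> M * cmod (\<phi> (y' o\<^sub>L y))"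
proof -
  define u v X' Y' where "u = \<phi> (y' o\<^sub>L x)" "v = \<phi> (x' o\<^sub>L y)" "X' = \<phi> (x' o\<^sub>L x)" "Y' = \<phi> (y' o\<^sub>L y)"
  \<comment> \<open>The value of \<open>\<phi>\<close> on the adjoint of \<open>y + c x\<close>
    times \<open>y + c x\<close>. Taking \<open>c\<close> to be 1 and the imaginary unit forces
    \<open>v = cnj u\<close>.\<close>
  have form: "Y' + c * u + cnj c * v + c * cnj c * X' \<in> \<real>\<^sub>\<ge>\<^sub>0" for c
  proof -
    let ?p = "y + cscale_op c x"
    have p: "?p \<in> A" by (intro csubspace_opD[OF csubspace_A] x y)
    have "is_adjoint ?p (y' + cscale_op (cnj c) x')" by (intro is_adjoint_add is_adjoint_cscale x y)
    then have adj: "adj_op ?p = y' + cscale_op (cnj c) x'" by (rule adj_op_eq)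
    have "adj_op ?p o\<^sub>L ?p = ((y' o\<^sub>L y) + cscale_op c (y' o\<^sub>L x)) + (cscale_op (cnj c) (x' o\<^sub>L y) + cscale_op (cnj c * c) (x' o\<^sub>L x))"
      unfolding adj
      by (simp add: compose_add_left compose_add_right cscale_compose_left cscale_add
          compose_cscale[OF A_clinear[OF x(3)]] compose_cscale[OF A_clinear[OF y(3)]])
    then have "\<phi> (adj_op ?p o\<^sub>L ?p) = (Y' + c * u) + (cnj c * v + cnj c * c * X')"
      by (simp add: \<phi>_linear(1,2) csubspace_opD(2,3)[OF csubspace_A] A_mult x y u_v_X'_Y'_def)
    then show ?thesis using \<phi>_positive[OF p] by (simp add: algebra_simps)
  qed
  have XY: "X' \<in> \<real>\<^sub>\<ge>\<^sub>0" "Y' \<in> \<real>\<^sub>\<ge>\<^sub>0"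
    using \<phi>_positive[OF x(1)] \<phi>_positive[OF y(1)] adj_op_eq[OF x(2)] adj_op_eq[OF y(2)]
    by (simp_all add: u_v_X'_Y'_def)
  have "Im u + Im v = 0" using form[of 1] XY by (auto simp: complex_nonneg_Reals_iff)
  moreover have "Re u - Re v = 0" using form[of \<i>] XY by (auto simp: complex_nonneg_Reals_iff)
  ultimately have v: "v = cnj u" by (simp add: complex_eq_iff)
  have X'M: "Re X' \<le> M" using M(1) complex_Re_le_cmod[of X'] by (simp add: u_v_X'_Y'_def)
  define s where "s = inverse M"
  have s: "0 < s" using M(2) by (simp add: s_def)
  define q where "q = (cmod u)\<^sup>2"
  have q: "u * cnj u = of_real q" "0 \<le> q" unfolding q_def by (simp_all add: complex_norm_square del: of_real_power)
  \<comment> \<open>This \<open>c\<close>, minus \<open>cnj u\<close> divided by \<open>M\<close>,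
    minimises the quadratic form with \<open>X'\<close> replaced by its bound
    \<open>M\<close>.\<close>
  have "0 \<le> Re (Y' + (- of_real s * cnj u) * u + cnj (- of_real s * cnj u) * v + (- of_real s * cnj u) * cnj (- of_real s * cnj u) * X')"
    using form[of "- of_real s * cnj u"] by (simp only: complex_nonneg_Reals_iff)
  also have "Y' + (- of_real s * cnj u) * u + cnj (- of_real s * cnj u) * v + (- of_real s * cnj u) * cnj (- of_real s * cnj u) * X'
    = Y' - of_real (2 * s) * (u * cnj u) + of_real (s * s) * (u * cnj u) * X'"
    by (simp add: v algebra_simps)
  also have "Re \<dots> = Re Y' - 2 * s * q + s * s * q * Re X'" unfolding q by simp
  also have "\<dots> \<le> Re Y' - 2 * s * q + s * q"
  proof -
    have "s * s * q * Re X' \<le> s * s * q * M" using X'M s q by (intro mult_left_mono) auto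
    also have "\<dots> = s * q" using M(2) by (simp add: s_def)
    finally show ?thesis by linarith
  qed
  finally have "s * q \<le> Re Y'" by linarith
  then have "q \<le> M * Re Y'" using M(2) by (simp add: s_def field_simps)
  also have "\<dots> \<le> M * cmod Y'" using M(2) complex_Re_le_cmod[of Y'] by (intro mult_left_mono) auto
  finally show ?thesis by (simp add: q_def u_v_X'_Y'_def)
qed

text \<open>Cutting by the indicator of \<open>Y\<close> defines the functional on all real
  \<open>C0\<close> functions of the space, the setting of the Riesz theorem.\<close>

definition func :: "('x \<Rightarrow> real) \<Rightarrow> ('g \<times> 'x) op" where
  "func f = gen (\<lambda>x. of_real (indicator Y x * f x)) 0"

lemma func_A: "f \<in> C0 \<Longrightarrow> func f \<in> A"
  unfolding func_def by (rule gen_A[OF supported_real])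

lemma func_add: "f \<in> C0 \<Longrightarrow> g \<in> C0 \<Longrightarrow> func (\<lambda>x. f x + g x) = func f + func g"
  unfolding func_def
  by (subst gen_add[OF supported_C0[OF supported_real] supported_C0[OF supported_real]]) (simp_all add: algebra_simps)

lemma func_scale: "f \<in> C0 \<Longrightarrow> func (\<lambda>x. c * f x) = cscale_op (of_real c) (func f)"
  unfolding func_def
  by (subst gen_cscale[OF supported_C0[OF supported_real]]) (simp_all add: algebra_simps)

text \<open>\<open>func f\<close> is the square of the self-adjoint element \<open>func\<close> of
  the square root.\<close>

lemma \<phi>_func_nonneg:
  assumes f: "f \<in> C0" "\<And>x. 0 \<le> f x"
  shows "\<phi> (func f) \<in> \<real>\<^sub>\<ge>\<^sub>0"
proof -
  let ?s = "\<lambda>x. sqrt (f x)"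
  have s: "?s \<in> C0"
    by (rule C0_sqrt_dominated[OF f(1)]) (use f(2) in \<open>simp_all add: continuous_on_real_sqrt C0_continuous[OF f(1)]\<close>)
  note S = supported_C0[OF supported_real[OF s]]
  have "is_adjoint (func ?s) (func ?s)"
    using is_adjoint_gen[OF S, of 0] unfolding func_def by simp
  then have adj: "adj_op (func ?s) = func ?s" by (rule adj_op_eq)
  have "func ?s o\<^sub>L func ?s = func f"
    unfolding func_def gen_mult[OF S S]
    by (rule arg_cong2[where f = gen]) (use f(2) in \<open>auto simp: fun_eq_iff indicator_def simp flip: of_real_mult\<close>)
  then show ?thesis using \<phi>_positive[OF func_A[OF s]] adj by simp
qed

lemma \<phi>_func_real: assumes f: "f \<in> C0" shows "\<phi> (func f) = of_real (Re (\<phi> (func f)))"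
proof -
  let ?p = "\<lambda>x. max (f x) 0" and ?m = "\<lambda>x. max (- f x) 0"
  have p: "?p \<in> C0" "?m \<in> C0"
    using C0_max[OF f C0_0] C0_max[OF C0_diff[OF C0_0 f] C0_0] by simp_all
  have "f = (\<lambda>x. ?p x + (-1) * ?m x)" by (rule ext) (simp add: max_def)
  then have "func f = func ?p + cscale_op (of_real (-1)) (func ?m)"
    using func_add[OF p(1) C0_cmult[OF p(2)], of "-1"] func_scale[OF p(2), of "-1"] by simp
  then have "\<phi> (func f) = \<phi> (func ?p) - \<phi> (func ?m)"
    by (simp add: \<phi>_linear(1,2) csubspace_opD(3)[OF csubspace_A] func_A p)
  moreover have "\<phi> (func ?p) \<in> \<real>\<^sub>\<ge>\<^sub>0" "\<phi> (func ?m) \<in> \<real>\<^sub>\<ge>\<^sub>0"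
    by (rule \<phi>_func_nonneg; (rule p | simp))+
  ultimately show ?thesis by (auto simp: complex_nonneg_Reals_iff complex_eq_iff)
qed

text \<open>The bound 1 comes from \<open>\<phi>_norm\<close>. Taking real parts loses nothing by
  \<open>\<phi>_func_real\<close>.\<close>

sublocale R: C0_functional "\<lambda>f. Re (\<phi> (func f))" 1
proof
  show "locally compact (UNIV :: 'x set)" by (rule X)
  show "Re (\<phi> (func (\<lambda>x. f x + g x))) = Re (\<phi> (func f)) + Re (\<phi> (func g))" if "f \<in> C0" "g \<in> C0" for f g
    by (simp add: func_add \<phi>_linear func_A that)
  show "Re (\<phi> (func (\<lambda>x. c * f x))) = c * Re (\<phi> (func f))" if "f \<in> C0" for f c
    by (simp add: func_scale \<phi>_linear func_A that)
  show "0 \<le> Re (\<phi> (func f))" if "f \<in> C0" "\<And>x. 0 \<le> f x" for f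
    using \<phi>_func_nonneg[OF that] by (simp add: complex_nonneg_Reals_iff)
  show "Re (\<phi> (func f)) \<le> 1" if f: "f \<in> C0" "\<And>x. 0 \<le> f x" "\<And>x. f x \<le> 1" for f
  proof -
    have "Re (\<phi> (func f)) \<le> cmod (\<phi> (func f))" by (rule complex_Re_le_cmod)
    also have "\<dots> \<le> norm (func f)" by (rule \<phi>_norm[OF func_A[OF f(1)]])
    also have "\<dots> \<le> 1" unfolding func_def
    proof (rule norm_gen)
      show "cmod (of_real (indicator Y x * f x)) \<le> 1" for x
        unfolding norm_of_real using f(2,3)[of x] by (auto simp: indicator_def)
    qed
    finally show ?thesis .
  qed
qed

abbreviation "m \<equiv> R.rep_measure"

lemma \<phi>_func: "f \<in> C0 \<Longrightarrow> \<phi> (func f) = of_real (\<integral>x. f x \<partial>m)"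
  using \<phi>_func_real R.integral_rep_measure(2) by simp

lemma finite_m: "finite_measure m" by (rule R.finite_rep_measure)

lemma space_m: "space m = UNIV" using sets_eq_imp_space_eq[OF R.sets_rep_measure] by simp

text \<open>The open set \<open>- Y\<close> is the positivity set of some \<open>f\<close>, and
  \<open>func f\<close> is 0 because \<open>f\<close> vanishes on \<open>Y\<close>.\<close>

lemma m_outside: "emeasure m (- Y) = 0"
proof -
  interpret finite_measure m by (rule finite_m)
  obtain f :: "'x \<Rightarrow> real" where f: "f \<in> C0" "\<And>x. 0 \<le> f x" "- Y = {x. 0 < f x}"
    using open_eq_positive_C0[OF X, of "- Y"] Y by (metis open_Compl)
  have "indicator Y x * f x = 0" for x
  proof (cases "x \<in> Y")
    case True
    then have "x \<notin> {x. 0 < f x}" unfolding f(3)[symmetric] by simp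
    then show ?thesis using f(2)[of x] by simp
  qed simp
  then have "func f = gen (\<lambda>_. 0) 0" unfolding func_def by (simp only: of_real_0)
  also have "\<dots> = 0" using gen_cscale[OF C0_0, of 0 0] by simp
  finally have "\<phi> (func f) = 0" using \<phi>_linear(4) by simp
  then have "(\<integral>x. f x \<partial>m) = 0" using \<phi>_func[OF f(1)] by simp
  then have "AE x in m. f x = 0"
    using integral_nonneg_eq_0_iff_AE[OF R.integral_rep_measure(1)[OF f(1)]] f(2) by simp
  then have "AE x in m. x \<notin> - Y" by eventually_elim (simp add: f(3))
  then show ?thesis using Y by (subst AE_iff_measurable[symmetric, where P = "\<lambda>x. x \<notin> - Y"]) (auto simp: space_m)
qed

end

section \<open>Scaling of the representing measure and vanishing off the neutral element\<close>

context KMS_state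
begin

text \<open>The KMS condition for \<open>k\<close> carried by \<open>g\<close> and its translate
  carried by \<open>- g\<close>: the two products are functions, namely the translated and the
  original square.\<close>

lemma \<phi>_transport_square:
  fixes k :: "'x \<Rightarrow> real"
  assumes k: "k \<in> C0" and supp: "\<And>x. k x \<noteq> 0 \<Longrightarrow> x \<in> Y \<and> act (- g) x \<in> Y"
  shows "(\<integral>x. (k (act g x))\<^sup>2 \<partial>m) = N g powr \<beta> * (\<integral>x. (k x)\<^sup>2 \<partial>m)"
proof -
  let ?b = "\<lambda>x. complex_of_real (k x)" and ?a = "\<lambda>x. complex_of_real (k (act g x))"
  have kg: "(\<lambda>x. k (act g x)) \<in> C0" by (rule C0_act[OF C0_of_real[OF k, where ?'b = complex], of g, THEN C0_Re, simplified])
  have b: "supported ?b g" using supp C0_of_real[OF k] by (auto simp: supported_def)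
  have a: "supported ?a (- g)" using supp[of "act g _"] C0_of_real[OF kg] by (auto simp: supported_def)
  have ab: "gen ?a (- g) o\<^sub>L gen ?b g = func (\<lambda>x. (k (act g x))\<^sup>2)"
  proof -
    have "gen ?a (- g) o\<^sub>L gen ?b g = gen (\<lambda>x. ?a x * ?b (act g x)) 0"
      using gen_mult[OF supported_C0[OF a] supported_C0[OF b], of "- g" g] by simp
    also have "(\<lambda>x. ?a x * ?b (act g x)) = (\<lambda>x. of_real (indicator Y x * (k (act g x))\<^sup>2))"
      using supp[of "act g _"] by (auto simp: fun_eq_iff indicator_def power2_eq_square)
    finally show ?thesis by (simp only: func_def)
  qed
  have ba: "gen ?b g o\<^sub>L gen ?a (- g) = func (\<lambda>x. (k x)\<^sup>2)"
  proof -
    have "gen ?b g o\<^sub>L gen ?a (- g) = gen (\<lambda>x. ?b x * ?a (act (- g) x)) 0"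
      using gen_mult[OF supported_C0[OF b] supported_C0[OF a], of g "- g"] by simp
    also have "(\<lambda>x. ?b x * ?a (act (- g) x)) = (\<lambda>x. of_real (indicator Y x * (k x)\<^sup>2))"
      using supp by (auto simp: fun_eq_iff indicator_def power2_eq_square)
    finally show ?thesis by (simp only: func_def)
  qed
  have "\<phi> (func (\<lambda>x. (k (act g x))\<^sup>2)) = of_real (N g powr \<beta>) * \<phi> (func (\<lambda>x. (k x)\<^sup>2))"
    using KMS_gen[OF b gen_A[OF a]] unfolding ab ba .
  then have "complex_of_real (\<integral>x. (k (act g x))\<^sup>2 \<partial>m) = of_real (N g powr \<beta> * (\<integral>x. (k x)\<^sup>2 \<partial>m))"
    by (simp add: \<phi>_func C0_square k kg)
  then show ?thesis by (simp only: of_real_eq_iff)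
qed

text \<open>The two finite measures \<open>?M1\<close> and \<open>?M2\<close> agree on squares.
  Cutting a test function by the clopen set \<open>W\<close> keeps it in \<open>C0\<close> and makes
  the transport identity applicable.\<close>

lemma m_scaling:
  assumes Z: "Z \<in> sets borel" "Z \<subseteq> Y" "act (- g) ` Z \<subseteq> Y"
  shows "emeasure m (act (- g) ` Z) = ennreal (N g powr \<beta>) * emeasure m Z"
proof -
  interpret finite_measure m by (rule finite_m)
  let ?c = "N g powr \<beta>"
  define W where "W = Y \<inter> act g ` Y"
  define W' where "W' = Y \<inter> act (- g) ` Y"
  have [measurable]: "W \<in> sets borel" "W' \<in> sets borel"
    unfolding W_def W'_def by (intro sets.Int Y_borel act_image_borel)+
  have W: "x \<in> W \<longleftrightarrow> x \<in> Y \<and> act (- g) x \<in> Y" "x \<in> W' \<longleftrightarrow> x \<in> Y \<and> act g x \<in> Y" for x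
    by (auto simp: W_def W'_def act_image)
  have clopen: "open W" "closed W"
    unfolding W_def act_image
    by (rule open_Int[OF Y(1) open_vimage[OF Y(1) act_cont]], rule closed_Int[OF Y(2) closed_vimage[OF Y(2) act_cont]])
  let ?M1 = "distr (density m (\<lambda>x. ennreal (indicator W' x))) borel (act g)"
  let ?M2 = "density m (\<lambda>x. ennreal (?c * indicator W x))"
  have e1: "emeasure ?M1 B = emeasure m (W' \<inter> act g -` B)" if [measurable]: "B \<in> sets borel" for B
  proof -
    have "emeasure ?M1 B = emeasure (density m (\<lambda>x. ennreal (indicator W' x))) (act g -` B)"
      by (subst emeasure_distr) (auto simp: space_m)
    also have "\<dots> = emeasure m (W' \<inter> act g -` B)"
      using measurable_sets[OF act_measurable that, of g]
      by (subst emeasure_density) (auto simp: indicator_inter_arith[symmetric] ennreal_indicator)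
    finally show ?thesis .
  qed
  have e2: "emeasure ?M2 B = ennreal ?c * emeasure m (W \<inter> B)" if [measurable]: "B \<in> sets borel" for B
  proof -
    have "emeasure ?M2 B = (\<integral>\<^sup>+x. ennreal ?c * indicator (W \<inter> B) x \<partial>m)"
      by (subst emeasure_density)
        (auto simp: ennreal_mult ennreal_indicator indicator_inter_arith mult.assoc intro!: nn_integral_cong)
    then show ?thesis by (simp add: nn_integral_cmult_indicator)
  qed
  have "?M1 = ?M2"
  proof (rule finite_borel_measure_eqI[OF X])
    show "finite_measure ?M1" "finite_measure ?M2"
      by (rule finite_measureI; simp add: e1 e2 space_m emeasure_eq_measure ennreal_mult_eq_top_iff)+
    fix k :: "'x \<Rightarrow> real" assume k: "k \<in> C0"
    have [measurable]: "k \<in> borel_measurable borel" by (rule C0_borel[OF k])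
    let ?k = "\<lambda>x. indicator W x * k x"
    have "(\<integral>x. (k x)\<^sup>2 \<partial>?M1) = (\<integral>x. (k (act g x))\<^sup>2 \<partial>density m (\<lambda>x. ennreal (indicator W' x)))"
      by (rule integral_distr) auto
    also have "\<dots> = (\<integral>x. indicator W' x *\<^sub>R (k (act g x))\<^sup>2 \<partial>m)"
      by (rule integral_density) auto
    also have "\<dots> = (\<integral>x. (?k (act g x))\<^sup>2 \<partial>m)"
      by (rule Bochner_Integration.integral_cong[OF refl]) (auto simp: W indicator_def)
    also have "\<dots> = ?c * (\<integral>x. (?k x)\<^sup>2 \<partial>m)"
      by (rule \<phi>_transport_square[OF C0_indicator[OF k clopen]]) (auto simp: W indicator_def split: if_splits)
    also have "\<dots> = (\<integral>x. (?c * indicator W x) *\<^sub>R (k x)\<^sup>2 \<partial>m)"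
      by (subst integral_mult_right_zero[symmetric], rule Bochner_Integration.integral_cong[OF refl])
        (auto simp: indicator_def)
    also have "\<dots> = (\<integral>x. (k x)\<^sup>2 \<partial>?M2)"
      by (rule integral_density[symmetric]) auto
    finally show "(\<integral>x. (k x)\<^sup>2 \<partial>?M1) = (\<integral>x. (k x)\<^sup>2 \<partial>?M2)" .
  qed auto
  moreover have "W' \<inter> act g -` Z = act (- g) ` Z"
  proof -
    have "act (- g) (act g x) \<in> Y" if "act g x \<in> Z" for x using Z(3) that by blast
    then have "act g -` Z \<subseteq> W'" using Z(2) by (auto simp: W)
    then show ?thesis by (auto simp: act_image)
  qed
  moreover have "W \<inter> Z = Z"
  proof -
    have "act (- g) z \<in> Y" if "z \<in> Z" for z using Z(3) that by blast
    then show ?thesis using Z(2) by (auto simp: W)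
  qed
  ultimately show ?thesis using e1[OF Z(1)] e2[OF Z(1)] by simp
qed

text \<open>Functions are carried by the neutral element, where \<open>N\<close> is 1, so they
  commute under \<open>\<phi>\<close>.\<close>

lemma \<phi>_commute_func:
  assumes u: "supported u g" and h: "h \<in> C0"
  shows "\<phi> (gen (\<lambda>x. of_real (h x) * u x) g) = \<phi> (gen (\<lambda>x. of_real (h (act (- g) x)) * u x) g)"
proof -
  note s = supported_real[OF h]
  have "func h o\<^sub>L gen u g = gen (\<lambda>x. of_real (indicator Y x * h x) * u x) g"
    unfolding func_def using gen_mult[OF supported_C0[OF s] supported_C0[OF u], of 0 g] by simp
  also have "(\<lambda>x. of_real (indicator Y x * h x) * u x) = (\<lambda>x. of_real (h x) * u x)"
    using u by (auto simp: fun_eq_iff supported_def indicator_def)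
  finally have 1: "func h o\<^sub>L gen u g = gen (\<lambda>x. of_real (h x) * u x) g" .
  have "gen u g o\<^sub>L func h = gen (\<lambda>x. u x * of_real (indicator Y (act (- g) x) * h (act (- g) x))) g"
    unfolding func_def using gen_mult[OF supported_C0[OF u] supported_C0[OF s], of g 0] by simp
  also have "(\<lambda>x. u x * of_real (indicator Y (act (- g) x) * h (act (- g) x))) = (\<lambda>x. of_real (h (act (- g) x)) * u x)"
    using u by (auto simp: fun_eq_iff supported_def indicator_def)
  finally have 2: "gen u g o\<^sub>L func h = gen (\<lambda>x. of_real (h (act (- g) x)) * u x) g" .
  show ?thesis
    using KMS_gen[OF s gen_A[OF u]] unfolding func_def[symmetric] 1 2 by (simp add: N_0)
qed

lemma supported_mult_bounded:
  assumes "supported u g" "continuous_on UNIV c" "\<And>x. \<bar>c x\<bar> \<le> B"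
  shows "supported (\<lambda>x. of_real (c x) * u x) g"
  using assms unfolding supported_def
  by (auto intro!: C0_mult_bounded(1)[where C = B] continuous_on_of_real)

lemma supported_diff:
  assumes "supported p g" "supported q g" shows "supported (\<lambda>x. p x - q x) g"
  unfolding supported_def
proof (intro conjI allI impI)
  show "(\<lambda>x. p x - q x) \<in> C0" using assms by (intro C0_diff supported_C0)
  fix x assume "p x - q x \<noteq> 0"
  then have "p x \<noteq> 0 \<or> q x \<noteq> 0" by auto
  then show "x \<in> Y" "act (- g) x \<in> Y" using assms unfolding supported_def by blast+
qed

text \<open>
  With \<open>d\<^sub>i = h\<^sub>i - h\<^sub>i \<circ> g\<^sup>-\<^sup>1\<close>, centrality of functions gives \<open>\<phi>(d\<^sub>i u u\<^sub>g) = 0\<close>, so \<open>f\<close> may be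
  multiplied by \<open>r\<^sub>n = 1 / (1 + n \<Sum>\<^sub>i\<^sub><\<^sub>n d\<^sub>i\<^sup>2)\<close>, which tends to \<open>0\<close> off the fixed points of \<open>g\<close>. The
  Cauchy--Schwarz inequality for \<open>f r\<^sub>n u\<^sub>g = (\<bar>f\<bar>\<^sup>1\<^sup>/\<^sup>2 r\<^sub>n) (f \<bar>f\<bar>\<^sup>-\<^sup>1\<^sup>/\<^sup>2 u\<^sub>g)\<close> and dominated convergence conclude.
\<close>

lemma \<phi>_gen_zero:
  assumes f: "supported f g" and null: "emeasure m {x \<in> Y. act (- g) x = x} = 0"
  shows "\<phi> (gen f g) = 0"
proof -
  interpret finite_measure m by (rule finite_m)
  obtain h :: "nat \<Rightarrow> 'x \<Rightarrow> real" where h: "\<And>n. h n \<in> C0"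
    and hU: "\<And>U x. open U \<Longrightarrow> x \<in> U \<Longrightarrow> \<exists>n. 0 < h n x \<and> {y. 0 < h n y} \<subseteq> U"
    using C0_basis[OF X] by blast
  have separating: "\<exists>n. h n x \<noteq> h n y" if "x \<noteq> y" for x y
  proof -
    obtain U where "open U" "x \<in> U" "y \<notin> U" using t1_space[OF \<open>x \<noteq> y\<close>] by blast
    from hU[OF this(1,2)] this(3) obtain n where "0 < h n x" "\<not> 0 < h n y" by blast
    then show ?thesis by (metis less_irrefl)
  qed
  define d where "d i x = h i x - h i (act (- g) x)" for i x
  have dC: "continuous_on UNIV (d i)" for i
    unfolding d_def using C0_continuous[OF h] act_cont
    by (intro continuous_on_diff) (auto intro: continuous_on_compose2[where t = UNIV])
  have dB: "\<exists>B. \<forall>x. \<bar>d i x\<bar> \<le> B" for i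
  proof -
    obtain B where B: "\<And>x. norm (h i x) \<le> B" using C0_bounded_norm[OF h] by metis
    have "\<bar>d i x\<bar> \<le> B + B" for x
      using B[of x] B[of "act (- g) x"] unfolding d_def by (simp add: abs_le_iff)
    then show ?thesis by blast
  qed
  have kill: "\<phi> (gen (\<lambda>x. of_real (d i x) * u x) g) = 0" if u: "supported u g" for i u
  proof -
    obtain B where B: "\<And>x. norm (h i x) \<le> B" using C0_bounded_norm[OF h] by metis
    have s: "supported (\<lambda>x. of_real (h i x) * u x) g"
      using B by (intro supported_mult_bounded[OF u, where B = B] C0_continuous[OF h]) simp
    have s': "supported (\<lambda>x. of_real (h i (act (- g) x)) * u x) g"
      using B by (intro supported_mult_bounded[OF u, where B = B] continuous_on_compose2[OF C0_continuous[OF h] act_cont]) auto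
    have "gen (\<lambda>x. of_real (d i x) * u x) g = gen (\<lambda>x. of_real (h i x) * u x) g - gen (\<lambda>x. of_real (h i (act (- g) x)) * u x) g"
      unfolding gen_diff[OF supported_C0[OF s] supported_C0[OF s']] d_def by (simp add: algebra_simps)
    then show ?thesis
      using \<phi>_linear(3)[OF gen_A[OF s] gen_A[OF s']] \<phi>_commute_func[OF u h] by simp
  qed
  \<comment> \<open>The same \<open>n\<close> counts the terms and multiplies the sum, so a single
    nonzero \<open>d j x\<close> makes \<open>n * w n x\<close> tend to infinity.\<close>
  define w where "w n x = (\<Sum>i<n. (d i x)\<^sup>2)" for n x
  define r where "r n x = inverse (1 + real n * w n x)" for n x
  have w0: "0 \<le> w n x" for n x unfolding w_def by (intro sum_nonneg) simp
  have pos: "0 < 1 + real n * w n x" for n x using w0[of n x] by (simp add: add_pos_nonneg)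
  have wC: "continuous_on UNIV (w n)" for n
    unfolding w_def by (intro continuous_on_sum continuous_on_power dC)
  have rC: "continuous_on UNIV (r n)" for n
    unfolding r_def using pos[of n] by (intro continuous_on_inverse continuous_on_add continuous_on_mult continuous_on_const wC) (metis less_irrefl)
  have r01: "0 < r n x" "r n x \<le> 1" for n x
    unfolding r_def using pos[of n x] w0[of n x] by (auto simp: inverse_le_1_iff)
  have step: "\<phi> (gen f g) = \<phi> (gen (\<lambda>x. of_real (r n x) * f x) g)" for n
  proof -
    have rf: "supported (\<lambda>x. of_real (r n x) * f x) g"
      using r01 by (intro supported_mult_bounded[OF f rC, where B = 1]) (simp add: abs_le_iff less_imp_le order_trans[of _ 0])
    \<comment> \<open>Chosen so that the \<open>d i x * u i x\<close> add up to
      \<open>n * w n x * r n x * f x\<close>, which is \<open>(1 - r n x) * f x\<close>. Subtracting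
      these terms, each killed by \<open>\<phi>\<close>, leaves \<open>r n x * f x\<close>.\<close>
    define u where "u i x = of_real (real n * d i x) * (of_real (r n x) * f x)" for i x
    have u: "supported (u i) g" for i
    proof -
      obtain B where "\<And>x. \<bar>d i x\<bar> \<le> B" using dB by blast
      then have "\<bar>real n * d i x\<bar> \<le> real n * B" for x by (simp add: abs_mult mult_left_mono)
      then show ?thesis unfolding u_def
        by (intro supported_mult_bounded[OF rf] continuous_on_mult continuous_on_const dC)
    qed
    have tele: "supported (\<lambda>x. f x - (\<Sum>i<j. of_real (d i x) * u i x)) g \<and>
      \<phi> (gen (\<lambda>x. f x - (\<Sum>i<j. of_real (d i x) * u i x)) g) = \<phi> (gen f g)" for j
    proof (induction j)
      case 0
      show ?case using f by simp
    next
      case (Suc j)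
      let ?p = "\<lambda>x. f x - (\<Sum>i<j. of_real (d i x) * u i x)" and ?q = "\<lambda>x. of_real (d j x) * u j x"
      obtain B where "\<And>x. \<bar>d j x\<bar> \<le> B" using dB by blast
      then have q: "supported ?q g" by (rule supported_mult_bounded[OF u dC])
      have p: "supported ?p g" using Suc by blast
      have eq: "(\<lambda>x. f x - (\<Sum>i<Suc j. of_real (d i x) * u i x)) = (\<lambda>x. ?p x - ?q x)"
        by (simp add: algebra_simps)
      have "supported (\<lambda>x. ?p x - ?q x) g"
        by (rule supported_diff[OF p q])
      moreover have "\<phi> (gen (\<lambda>x. ?p x - ?q x) g) = \<phi> (gen ?p g) - \<phi> (gen ?q g)"
        unfolding gen_diff[OF supported_C0[OF p] supported_C0[OF q], symmetric]
        by (rule \<phi>_linear(3)[OF gen_A[OF p] gen_A[OF q]])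
      ultimately show ?case unfolding eq using kill[OF u] Suc by simp
    qed
    have "f x - (\<Sum>i<n. of_real (d i x) * u i x) = of_real (r n x) * f x" for x
    proof -
      have "(\<Sum>i<n. of_real (d i x) * u i x) = (\<Sum>i<n. of_real ((d i x)\<^sup>2) * (of_real (real n * r n x) * f x))"
        by (intro sum.cong) (auto simp: u_def power2_eq_square algebra_simps)
      also have "\<dots> = (\<Sum>i<n. of_real ((d i x)\<^sup>2)) * (of_real (real n * r n x) * f x)"
        by (rule sum_distrib_right[symmetric])
      also have "(\<Sum>i<n. complex_of_real ((d i x)\<^sup>2)) = of_real (w n x)" unfolding w_def by simp
      also have "of_real (w n x) * (of_real (real n * r n x) * f x) = of_real (real n * w n x * r n x) * f x"
        by simp
      also have "real n * w n x * r n x = 1 - r n x"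
        unfolding r_def using pos[of n x] by (simp add: field_simps)
      finally show ?thesis by (simp add: algebra_simps)
    qed
    then have "(\<lambda>x. f x - (\<Sum>i<n. of_real (d i x) * u i x)) = (\<lambda>x. of_real (r n x) * f x)" by (rule ext)
    then show ?thesis using tele[of n] by (simp only:)
  qed
  \<comment> \<open>Splitting off half of the modulus puts all dependence on \<open>n\<close> into
    the factor \<open>func ?k\<close>, whose square is a function and is evaluated by the
    measure.\<close>
  define f' where "f' x = f x / of_real (sqrt (cmod (f x)))" for x
  have f'C: "continuous_on UNIV f'"
    unfolding f'_def by (rule continuous_on_compose2[OF continuous_on_divide_sqrt C0_continuous[OF supported_C0[OF f]]]) auto
  have "f' \<in> C0"
    by (rule C0_sqrt_dominated[OF supported_C0[OF f] f'C]) (simp add: f'_def norm_divide real_div_sqrt)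
  then have f': "supported f' g" using f by (auto simp: supported_def f'_def)
  have f'_mult: "of_real (sqrt (cmod (f x))) * f' x = f x" for x by (simp add: f'_def)
  let ?x = "gen f' g" and ?x' = "gen (\<lambda>x. cnj (f' (act g x))) (- g)"
  have x': "supported (\<lambda>x. cnj (f' (act g x))) (- g)"
    unfolding supported_def
  proof
    show "(\<lambda>x. cnj (f' (act g x))) \<in> C0"
      by (rule C0_dominated[OF C0_act[OF \<open>f' \<in> C0\<close>, of g], where C = 1])
        (simp_all add: continuous_on_cnj C0_continuous C0_act \<open>f' \<in> C0\<close>)
  qed (use f' in \<open>force simp: supported_def\<close>)
  \<comment> \<open>Independent of \<open>n\<close>; adding 1 makes it positive.\<close>
  define M where "M = norm (?x' o\<^sub>L ?x) + 1"
  have M: "0 < M" "cmod (\<phi> (?x' o\<^sub>L ?x)) \<le> M"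
    using \<phi>_norm[OF A_mult[OF gen_A[OF x'] gen_A[OF f']]] by (auto simp: M_def add_nonneg_pos)
  have fn: "(\<lambda>x. sqrt (cmod (f x))) \<in> C0"
    by (rule C0_sqrt_dominated[OF supported_C0[OF f]])
      (simp_all add: continuous_on_real_sqrt continuous_on_norm C0_continuous[OF supported_C0[OF f]])
  have fn': "(\<lambda>x. cmod (f x)) \<in> C0"
    by (rule C0_dominated[OF supported_C0[OF f], where C = 1])
      (simp_all add: continuous_on_norm C0_continuous[OF supported_C0[OF f]])
  have bound: "(cmod (\<phi> (gen f g)))\<^sup>2 \<le> M * (\<integral>x. cmod (f x) * (r n x)\<^sup>2 \<partial>m)" for n
  proof -
    let ?k = "\<lambda>x. sqrt (cmod (f x)) * r n x"
    have k: "?k \<in> C0"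
      using r01 by (intro C0_mult_bounded(2)[OF fn rC, where C = 1]) (simp add: abs_le_iff less_imp_le order_trans[of _ 0])
    note S = supported_C0[OF supported_real[OF k]]
    have adj: "is_adjoint (func ?k) (func ?k)"
      using is_adjoint_gen[OF S, of 0] unfolding func_def by simp
    have "func ?k o\<^sub>L ?x = gen (\<lambda>x. of_real (indicator Y x * ?k x) * f' x) g"
      unfolding func_def using gen_mult[OF S supported_C0[OF f'], of 0 g] by simp
    also have "(\<lambda>x. of_real (indicator Y x * ?k x) * f' x) = (\<lambda>x. of_real (r n x) * f x)"
    proof
      fix x
      show "of_real (indicator Y x * ?k x) * f' x = of_real (r n x) * f x"
      proof (cases "f x = 0")
        case False
        then have "x \<in> Y" using f by (auto simp: supported_def)
        then show ?thesis using f'_mult[of x] by (simp add: algebra_simps)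
      qed (simp add: f'_def)
    qed
    finally have prod: "func ?k o\<^sub>L ?x = gen (\<lambda>x. of_real (r n x) * f x) g" .
    have "func ?k o\<^sub>L func ?k = gen (\<lambda>x. of_real (indicator Y x * ?k x) * of_real (indicator Y x * ?k x)) 0"
      unfolding func_def using gen_mult[OF S S, of 0 0] by simp
    also have "\<dots> = func (\<lambda>x. cmod (f x) * (r n x)\<^sup>2)"
      unfolding func_def
      by (rule arg_cong2[where f = gen])
        (auto simp: fun_eq_iff indicator_def power2_eq_square simp flip: of_real_mult)
    finally have sq: "func ?k o\<^sub>L func ?k = func (\<lambda>x. cmod (f x) * (r n x)\<^sup>2)" .
    have C: "(\<lambda>x. cmod (f x) * (r n x)\<^sup>2) \<in> C0"
      using r01 by (intro C0_mult_bounded(2)[OF fn', where C = 1] continuous_on_power rC) (simp add: power_le_one less_imp_le)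
    have nn: "0 \<le> (\<integral>x. cmod (f x) * (r n x)\<^sup>2 \<partial>m)" by (rule integral_nonneg_AE) simp
    have "(cmod (\<phi> (func ?k o\<^sub>L ?x)))\<^sup>2 \<le> M * cmod (\<phi> (func ?k o\<^sub>L func ?k))"
      by (rule \<phi>_Cauchy_Schwarz[OF gen_A[OF f'] is_adjoint_gen[OF \<open>f' \<in> C0\<close>] gen_A[OF x']
            func_A[OF k] adj func_A[OF k] M(2,1)])
    then show ?thesis unfolding prod sq step[of n, symmetric] \<phi>_func[OF C] norm_of_real using nn by simp
  qed
  have "(\<lambda>n. \<integral>x. cmod (f x) * (r n x)\<^sup>2 \<partial>m) \<longlonglongrightarrow> (\<integral>x. 0 \<partial>m)"
  proof (rule integral_dominated_convergence[where w = "\<lambda>x. cmod (f x)"])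
    have [measurable]: "(\<lambda>x. cmod (f x)) \<in> borel_measurable borel" "r n \<in> borel_measurable borel" for n
      by (intro borel_measurable_continuous_onI C0_continuous[OF fn'] rC)+
    show "(\<lambda>x. cmod (f x) * (r n x)\<^sup>2) \<in> borel_measurable m" for n by measurable
    show "integrable m (\<lambda>x. cmod (f x))" by (rule R.integral_rep_measure(1)[OF fn'])
    show "AE x in m. norm (cmod (f x) * (r n x)\<^sup>2) \<le> cmod (f x)" for n
    proof (rule AE_I2)
      fix x
      have "(r n x)\<^sup>2 \<le> 1" using r01[of n x] by (simp add: power_le_one less_imp_le)
      then show "norm (cmod (f x) * (r n x)\<^sup>2) \<le> cmod (f x)"
        using mult_left_mono[of "(r n x)\<^sup>2" 1 "cmod (f x)"] by simp
    qed
    have closedF: "{x \<in> Y. act (- g) x = x} \<in> sets m"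
    proof -
      have "closed {x. act (- g) x = x}" by (intro closed_Collect_eq act_cont continuous_on_id)
      then have "{x. act (- g) x = x} \<inter> Y \<in> sets borel" by (intro sets.Int borel_closed Y)
      also have "{x. act (- g) x = x} \<inter> Y = {x \<in> Y. act (- g) x = x}" by auto
      finally show ?thesis by simp
    qed
    then have "AE x in m. \<not> (x \<in> Y \<and> act (- g) x = x)"
      using null by (intro AE_I[where N = "{x \<in> Y. act (- g) x = x}"]) auto
    then show "AE x in m. (\<lambda>n. cmod (f x) * (r n x)\<^sup>2) \<longlonglongrightarrow> 0"
    proof eventually_elim
      fix x assume nx: "\<not> (x \<in> Y \<and> act (- g) x = x)"
      show "(\<lambda>n. cmod (f x) * (r n x)\<^sup>2) \<longlonglongrightarrow> 0"
      proof (cases "f x = 0")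
        case False
        then have "act (- g) x \<noteq> x" using nx f by (auto simp: supported_def)
        then obtain j where j: "d j x \<noteq> 0" unfolding d_def using separating by (metis eq_iff_diff_eq_0)
        \<comment> \<open>Once \<open>n\<close> exceeds \<open>j\<close>, the sum
          \<open>w n x\<close> contains this term, so \<open>r n x\<close> is at most
          \<open>inverse (1 + n * e)\<close>.\<close>
        define e where "e = (d j x)\<^sup>2"
        have e: "0 < e" using j by (simp add: e_def)
        have we: "e \<le> w n x" if "j < n" for n
          unfolding w_def e_def using that member_le_sum[of j "{..<n}" "\<lambda>i. (d i x)\<^sup>2"] by simp
        have "(\<lambda>n. inverse (1 + real n * e)) \<longlonglongrightarrow> 0" using e by real_asymp
        moreover have "\<forall>\<^sub>F n in sequentially. norm (r n x) \<le> inverse (1 + real n * e)"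
          using eventually_gt_at_top[of j]
        proof eventually_elim
          fix n assume "j < n"
          then have "1 + real n * e \<le> 1 + real n * w n x" using we by (simp add: mult_left_mono)
          moreover have "0 < 1 + real n * e" using e by (simp add: add_pos_nonneg)
          ultimately show "norm (r n x) \<le> inverse (1 + real n * e)"
            using r01(1)[of n x] unfolding r_def by (simp add: le_imp_inverse_le)
        qed
        ultimately have "(\<lambda>n. r n x) \<longlonglongrightarrow> 0" by (rule Lim_null_comparison[rotated])
        then have "(\<lambda>n. cmod (f x) * (r n x)\<^sup>2) \<longlonglongrightarrow> cmod (f x) * 0\<^sup>2" by (intro tendsto_intros)
        then show ?thesis by simp
      qed simp
    qed
  qed auto
  then have "(\<lambda>n. M * (\<integral>x. cmod (f x) * (r n x)\<^sup>2 \<partial>m)) \<longlonglongrightarrow> M * 0" by (intro tendsto_mult tendsto_const) simp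
  then have "(cmod (\<phi> (gen f g)))\<^sup>2 \<le> M * 0"
    by (rule LIMSEQ_le_const) (use bound in auto)
  then show ?thesis by simp
qed

end

lemma ennreal_scaled_eq_self:
  assumes "e = ennreal c * e" "e \<noteq> \<infinity>" "c \<noteq> 1" "0 \<le> c"
  shows "e = 0"
proof -
  obtain r where r: "e = ennreal r" "0 \<le> r" using assms(2) by (cases e) auto
  then have "ennreal r = ennreal (c * r)" using assms(1,4) by (simp add: ennreal_mult)
  then have "r = c * r" using r assms(4) by (simp add: ennreal_inj)
  then show ?thesis using r assms(3) by simp
qed

lemma powr_eq_1_imp: "0 < x \<Longrightarrow> x \<noteq> 1 \<Longrightarrow> \<beta> \<noteq> 0 \<Longrightarrow> x powr \<beta> \<noteq> (1 :: real)"
  by (simp add: powr_def)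

context KMS_state
begin

text \<open>An invariant set has finite mass equal to \<open>N (gn n) powr \<beta>\<close> times
  itself, a factor different from 1.\<close>

lemma fixed_points_null:
  assumes \<beta>: "\<beta> \<noteq> 0"
    and Yn: "\<And>n. Yn n \<in> sets borel" "\<And>n. Yn n \<subseteq> Y"
      "{x \<in> Y. \<exists>g. g \<noteq> 0 \<and> act g x = x} \<subseteq> (\<Union>n. Yn (n :: nat))"
    and gn: "\<And>n. N (gn n) \<noteq> 1" "\<And>n. act (gn n) ` Yn n = Yn n"
    and g: "g \<noteq> 0"
  shows "emeasure m {x \<in> Y. act g x = x} = 0"
proof -
  interpret finite_measure m by (rule finite_m)
  have "emeasure m (Yn n) = 0" for n
  proof (rule ennreal_scaled_eq_self[where c = "N (gn n) powr \<beta>"])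
    have *: "act (- gn n) ` Yn n = Yn n"
      by (subst (1) gn(2)[symmetric]) (simp add: image_image)
    show "emeasure m (Yn n) = ennreal (N (gn n) powr \<beta>) * emeasure m (Yn n)"
      using m_scaling[of "Yn n" "gn n"] Yn(1,2) * by simp
    show "N (gn n) powr \<beta> \<noteq> 1" by (rule powr_eq_1_imp[OF N_pos gn(1) \<beta>])
  qed (auto simp: emeasure_eq_measure)
  then have "emeasure m (\<Union>n. Yn n) = 0"
    by (subst emeasure_UN_eq_0) (use Yn in auto)
  moreover have "{x \<in> Y. act g x = x} \<subseteq> (\<Union>n. Yn n)" using Yn(3) g by auto
  ultimately show ?thesis using emeasure_mono[of "{x \<in> Y. act g x = x}" "\<Union>n. Yn n" m] Yn(1) by auto
qed

lemma integrable_m_C0: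
  fixes f :: "'x \<Rightarrow> complex"
  assumes "f \<in> C0" shows "integrable m f"
proof -
  interpret finite_measure m by (rule finite_m)
  obtain B where "\<And>x. norm (f x) \<le> B" using C0_bounded_norm[OF assms] by metis
  then show ?thesis
    using C0_borel[OF assms]
    by (intro integrable_const_bound[where B = B]) (auto cong: measurable_cong_sets)
qed

text \<open>Both sides are bounded functionals, so they are compared on generators: off the neutral
  element both vanish, and on functions this is the Riesz representation.\<close>

lemma \<phi>_eq_integral:
  assumes null: "\<And>g. g \<noteq> 0 \<Longrightarrow> emeasure m {x \<in> Y. act g x = x} = 0" and a: "a \<in> A"
  shows "\<phi> a = (\<integral>x. cond_exp a x \<partial>m)"
proof -
  interpret finite_measure m by (rule finite_m)
  have "bounded_functional A (\<lambda>a. \<integral>x. cond_exp a x \<partial>m)"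
    unfolding bounded_functional_def
  proof (intro conjI ballI allI exI)
    show "(\<integral>x. cond_exp (a + b) x \<partial>m) = (\<integral>x. cond_exp a x \<partial>m) + (\<integral>x. cond_exp b x \<partial>m)"
      if "a \<in> A" "b \<in> A" for a b
      unfolding cond_exp_add using that by (intro Bochner_Integration.integral_add integrable_m_C0 cond_exp_C0)
    show "(\<integral>x. cond_exp (cscale_op c a) x \<partial>m) = c * (\<integral>x. cond_exp a x \<partial>m)" for a c
      unfolding cond_exp_cscale by (rule integral_mult_right_zero)
    show "cmod (\<integral>x. cond_exp a x \<partial>m) \<le> measure m UNIV * norm a" if "a \<in> A" for a
    proof -
      have "cmod (\<integral>x. cond_exp a x \<partial>m) \<le> (\<integral>x. cmod (cond_exp a x) \<partial>m)" by (rule integral_norm_bound)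
      also have "\<dots> \<le> (\<integral>x. norm a \<partial>m)"
        using integrable_m_C0[OF cond_exp_C0[OF that]] by (intro integral_mono cond_exp_le) auto
      finally show ?thesis by (simp add: space_m)
    qed
  qed
  then show ?thesis
  proof (rule bounded_functional_eqI[OF csubspace_A bounded_functional_\<phi> _ _ _ _ a])
    show "gens \<subseteq> A" using gens_A by blast
    show "A \<subseteq> closure (cspan_op gens)" by (simp add: span_gens_dense)
    fix b assume "b \<in> gens"
    then obtain f g where b: "b = gen f g" "supported f g" by (auto simp: gens_def)
    note fC = supported_C0[OF b(2)]
    show "\<phi> b = (\<integral>x. cond_exp b x \<partial>m)"
    proof (cases "g = 0")
      case False
      then have "\<phi> b = 0" using \<phi>_gen_zero[OF b(2) null] b(1) by simp
      then show ?thesis unfolding b(1) cond_exp_gen[OF fC] using False by simp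
    next
      case True
      have ReIm: "(\<lambda>x. Re (f x)) \<in> C0" "(\<lambda>x. Im (f x)) \<in> C0" by (rule C0_Re[OF fC], rule C0_Im[OF fC])
      have f_eq: "f x = of_real (indicator Y x * Re (f x)) + \<i> * of_real (indicator Y x * Im (f x))" for x
        using b(2) by (cases "f x = 0") (auto simp: supported_def complex_eq_iff)
      have "gen f 0 = func (\<lambda>x. Re (f x)) + cscale_op \<i> (func (\<lambda>x. Im (f x)))"
        unfolding func_def gen_cscale[OF supported_C0[OF supported_real[OF ReIm(2)]]]
        by (subst gen_add[OF supported_C0[OF supported_real[OF ReIm(1)]] C0_cmult[OF supported_C0[OF supported_real[OF ReIm(2)]]]])
          (simp only: f_eq[symmetric])
      then have "\<phi> (gen f 0) = of_real (\<integral>x. Re (f x) \<partial>m) + \<i> * of_real (\<integral>x. Im (f x) \<partial>m)"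
        by (simp add: \<phi>_linear(1,2) func_A ReIm csubspace_opD(3)[OF csubspace_A] \<phi>_func)
      also have "\<dots> = (\<integral>x. f x \<partial>m)"
        using integrable_m_C0[OF fC] by (simp add: complex_eq_iff)
      finally show ?thesis unfolding b(1) cond_exp_gen[OF fC] using True by simp
    qed
  qed
qed

text \<open>Since \<open>cond_exp\<close> is contractive, the norm 1 of \<open>\<phi>\<close> is at
  most the mass of \<open>m\<close>, which the Riesz bound keeps below 1.\<close>

lemma measure_m_UNIV:
  assumes "\<And>g. g \<noteq> 0 \<Longrightarrow> emeasure m {x \<in> Y. act g x = x} = 0"
  shows "emeasure m UNIV = 1"
proof -
  interpret finite_measure m by (rule finite_m)
  let ?V = "{cmod (\<phi> a) | a. a \<in> A \<and> norm a \<le> 1}"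
  have ub: "v \<le> measure m UNIV" if "v \<in> ?V" for v
  proof -
    obtain a where a: "v = cmod (\<phi> a)" "a \<in> A" "norm a \<le> 1" using \<open>v \<in> ?V\<close> by blast
    have "cmod (\<integral>x. cond_exp a x \<partial>m) \<le> (\<integral>x. cmod (cond_exp a x) \<partial>m)" by (rule integral_norm_bound)
    also have "\<dots> \<le> (\<integral>x. 1 \<partial>m)"
      using integrable_m_C0[OF cond_exp_C0[OF a(2)]]
      by (intro integral_mono order_trans[OF cond_exp_le a(3)]) auto
    finally show ?thesis using \<phi>_eq_integral[OF assms a(2)] a(1) by (simp add: space_m)
  qed
  have "0 \<in> A \<and> norm (0 :: ('g \<times> 'x) op) \<le> 1" using csubspace_opD(1)[OF csubspace_A] by simp
  then have "?V \<noteq> {}" by blast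
  from cSup_least[OF this ub] have "1 \<le> measure m UNIV" using state unfolding is_state_def by simp
  moreover have "measure m UNIV \<le> 1" using R.emeasure_rep_measure_UNIV by (simp add: emeasure_eq_measure)
  ultimately show ?thesis by (simp add: emeasure_eq_measure)
qed

lemma exists_scaling:
  assumes null: "\<And>g. g \<noteq> 0 \<Longrightarrow> emeasure m {x \<in> Y. act g x = x} = 0"
  shows "\<exists>\<mu>. scaling \<beta> \<mu> \<and> \<phi> = measure_state act Y \<mu>"
proof -
  interpret finite_measure m by (rule finite_m)
  define \<mu> where "\<mu> = restrict_space m Y"
  have em: "emeasure \<mu> Z = emeasure m Z" if "Z \<in> sets borel" "Z \<subseteq> Y" for Z
    unfolding \<mu>_def using that by (intro emeasure_restrict_space) (auto simp: space_m)
  have AEY: "AE x in m. x \<in> Y"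
    using m_outside by (intro AE_I[where N = "- Y"]) auto
  have "emeasure m Y = emeasure m UNIV"
    by (rule emeasure_eq_AE) (use AEY in auto)
  then have "emeasure \<mu> (space \<mu>) = 1"
    using em[OF Y_borel] measure_m_UNIV[OF null] by (simp add: \<mu>_def space_restrict_space space_m)
  then have "prob_space \<mu>" by (rule prob_spaceI)
  then have p: "\<mu> \<in> prob_measures Y"
    by (auto simp: prob_measures_def \<mu>_def sets_restrict_space)
  have "emeasure \<mu> (act g ` Z) = ennreal (N g powr - \<beta>) * emeasure \<mu> Z"
    if Z: "Z \<in> sets borel" "Z \<subseteq> Y" "act g ` Z \<subseteq> Y" for g Z
  proof -
    \<comment> \<open>\<open>m_scaling\<close> is applied to the translated set, and the positive
      factor is then moved to the other side.\<close>
    have "act (- g) ` act g ` Z = Z" by (simp add: image_image)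
    then have "emeasure m Z = ennreal (N g powr \<beta>) * emeasure m (act g ` Z)"
      using m_scaling[OF act_image_borel[OF Z(1)], of g g] Z by simp
    then have "ennreal (N g powr - \<beta>) * emeasure m Z = ennreal (N g powr - \<beta> * N g powr \<beta>) * emeasure m (act g ` Z)"
      by (simp add: ennreal_mult mult.assoc)
    moreover have "N g powr - \<beta> * N g powr \<beta> = 1" using N_pos[of g] by (simp add: powr_add[symmetric])
    ultimately show ?thesis using em Z act_image_borel[OF Z(1)] by simp
  qed
  then have "scaling \<beta> \<mu>" using p by (simp add: scaling_def)
  moreover have "\<phi> a = measure_state act Y \<mu> a" for a
  proof (cases "a \<in> A")
    case True
    have "(\<integral>x. cond_exp a x \<partial>\<mu>) = (\<integral>x. indicator Y x *\<^sub>R cond_exp a x \<partial>m)"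
      unfolding \<mu>_def by (rule integral_restrict_space) (simp add: space_m)
    also have "\<dots> = (\<integral>x. cond_exp a x \<partial>m)"
    proof (rule integral_cong_AE)
      have [measurable]: "cond_exp a \<in> borel_measurable borel"
        by (rule C0_borel[OF cond_exp_C0[OF True]])
      show "(\<lambda>x. indicat_real Y x *\<^sub>R cond_exp a x) \<in> borel_measurable m" "cond_exp a \<in> borel_measurable m"
        by measurable
      show "AE x in m. indicat_real Y x *\<^sub>R cond_exp a x = cond_exp a x" using AEY by eventually_elim simp
    qed
    finally show ?thesis using \<phi>_eq_integral[OF null True] True by (simp add: measure_state_def)
  qed (simp add: \<phi>_outside measure_state_def)
  ultimately show ?thesis by blast
qed

end

lemma (in partial_action) KMS_states_eq:
  assumes \<beta>: "\<beta> \<noteq> 0"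
    and Yn: "\<And>n. Yn n \<in> sets borel" "\<And>n. Yn n \<subseteq> Y"
      "{x \<in> Y. \<exists>g. g \<noteq> 0 \<and> act g x = x} \<subseteq> (\<Union>n. Yn (n :: nat))"
    and gn: "\<And>n. N (gn n) \<noteq> 1" "\<And>n. act (gn n) ` Yn n = Yn n"
  shows "KMS_states act Y N \<beta> = measure_state act Y ` {\<mu>. scaling \<beta> \<mu>}"
proof (intro equalityI subsetI)
  fix \<phi> assume "\<phi> \<in> KMS_states act Y N \<beta>"
  then interpret KMS_state act Y N \<beta> \<phi> by unfold_locales
  show "\<phi> \<in> measure_state act Y ` {\<mu>. scaling \<beta> \<mu>}"
    using exists_scaling[OF fixed_points_null[OF \<beta> Yn gn]] by blast
next
  fix \<phi> assume "\<phi> \<in> measure_state act Y ` {\<mu>. scaling \<beta> \<mu>}"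
  then show "\<phi> \<in> KMS_states act Y N \<beta>" using scaling_imp_KMS by blast
qed

lemma (in partial_action) scaling_null:
  assumes \<mu>: "scaling \<beta> \<mu>" and \<beta>: "\<beta> \<noteq> 0" and Z: "Z \<in> sets borel" "Z \<subseteq> Y" "act g ` Z = Z" "N g \<noteq> 1"
  shows "emeasure \<mu> Z = 0"
proof -
  interpret prob_space \<mu> using \<mu> prob_measuresD(1)[OF _ Y_borel] by (auto simp: scaling_def)
  show ?thesis
  proof (rule ennreal_scaled_eq_self[where c = "N g powr - \<beta>"])
    have "emeasure \<mu> (act g ` Z) = ennreal (N g powr - \<beta>) * emeasure \<mu> Z"
      using \<mu> Z(1,2) Z(3)[THEN equalityD1] unfolding scaling_def by (blast intro: subset_trans)
    then show "emeasure \<mu> Z = ennreal (N g powr - \<beta>) * emeasure \<mu> Z" unfolding Z(3) .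
    show "N g powr - \<beta> \<noteq> 1" using powr_eq_1_imp[OF N_pos Z(4), of "- \<beta>"] \<beta> by simp
  qed (auto simp: emeasure_eq_measure)
qed

section \<open>Measures carried by a wandering set\<close>

text \<open>Turns the sums over \<open>S\<close> in the induced measure into integrals against
  counting measure, where monotone convergence and Fubini are available.\<close>

lemma infsum_ennreal_eq_nn_integral:
  fixes f :: "'a::countable \<Rightarrow> ennreal"
  shows "(\<Sum>\<^sub>\<infinity>x\<in>A. f x) = (\<integral>\<^sup>+x. f x \<partial>count_space A)"
proof (rule antisym)
  have inf: "(\<Sum>\<^sub>\<infinity>x\<in>A. f x) = (SUP F\<in>{F. finite F \<and> F \<subseteq> A}. sum f F)"
    by (rule nonneg_infsum_complete) simp
  have fin: "sum f F = (\<integral>\<^sup>+x. f x * indicator F x \<partial>count_space A)" if "finite F" "F \<subseteq> A" for F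
  proof -
    have "sum f F = (\<integral>\<^sup>+x. f x \<partial>count_space F)" using that by (simp add: nn_integral_count_space_finite)
    also have "\<dots> = (\<integral>\<^sup>+x. f x * indicator F x \<partial>count_space A)"
      using that by (simp add: nn_integral_restrict_space[symmetric] restrict_count_space Int_absorb2)
    finally show ?thesis .
  qed
  show "(\<Sum>\<^sub>\<infinity>x\<in>A. f x) \<le> (\<integral>\<^sup>+x. f x \<partial>count_space A)"
    unfolding inf
  proof (rule SUP_least)
    fix F assume F: "F \<in> {F. finite F \<and> F \<subseteq> A}"
    have "(\<integral>\<^sup>+x. f x * indicator F x \<partial>count_space A) \<le> (\<integral>\<^sup>+x. f x \<partial>count_space A)"
      by (rule nn_integral_mono) (auto simp: indicator_def)
    then show "sum f F \<le> (\<integral>\<^sup>+x. f x \<partial>count_space A)" using F by (simp add: fin)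
  qed
  define F where "F n = {x \<in> A. to_nat x < n}" for n
  have finF: "finite (F n)" "F n \<subseteq> A" for n
  proof -
    have "finite (to_nat -` {..<n} :: 'a set)" by (rule finite_vimageI) auto
    then show "finite (F n)" by (rule finite_subset[rotated]) (auto simp: F_def)
  qed (auto simp: F_def)
  have "(\<integral>\<^sup>+x. f x \<partial>count_space A) = (\<integral>\<^sup>+x. (SUP n. f x * indicator (F n) x) \<partial>count_space A)"
  proof (rule nn_integral_cong)
    fix x assume "x \<in> space (count_space A)"
    then have "f x = f x * indicator (F (Suc (to_nat x))) x" by (simp add: F_def)
    also have "\<dots> \<le> (SUP n. f x * indicator (F n) x)" by (rule SUP_upper) simp
    finally have le: "f x \<le> (SUP n. f x * indicator (F n) x)" .
    have "(SUP n. f x * indicator (F n) x) \<le> f x"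
      by (rule SUP_least) (auto simp: indicator_def)
    then show "f x = (SUP n. f x * indicator (F n) x)" using le by (rule antisym[rotated])
  qed
  also have "\<dots> = (SUP n. \<integral>\<^sup>+x. f x * indicator (F n) x \<partial>count_space A)"
    by (rule nn_integral_monotone_convergence_SUP)
      (auto simp: incseq_def le_fun_def F_def indicator_def)
  also have "\<dots> \<le> (\<Sum>\<^sub>\<infinity>x\<in>A. f x)"
    unfolding inf
  proof (rule SUP_least)
    fix n
    have "(\<integral>\<^sup>+x. f x * indicator (F n) x \<partial>count_space A) = sum f (F n)" using fin finF by simp
    also have "\<dots> \<le> (SUP F\<in>{F. finite F \<and> F \<subseteq> A}. sum f F)"
      by (rule SUP_upper) (use finF in auto)
    finally show "(\<integral>\<^sup>+x. f x * indicator (F n) x \<partial>count_space A) \<le> (SUP F\<in>{F. finite F \<and> F \<subseteq> A}. sum f F)" .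
  qed
  finally show "(\<integral>\<^sup>+x. f x \<partial>count_space A) \<le> (\<Sum>\<^sub>\<infinity>x\<in>A. f x)" .
qed

locale wandering = partial_action act Y N
  for act :: "'g::{group_add, countable} \<Rightarrow> 'x::{second_countable_topology, t2_space} \<Rightarrow> 'x" and Y N +
  fixes \<beta> :: real and S :: "'g set" and Y0 :: "'x set"
  assumes Y0: "Y0 \<subseteq> Y" "Y0 \<noteq> {}" "Y0 \<in> sets borel"
    and disj: "g \<noteq> 0 \<Longrightarrow> act g ` Y0 \<inter> Y0 = {}"
    and SY0: "(\<Union>s\<in>S. act s ` Y0) \<subseteq> Y"
    and in_S: "act g ` Y0 \<inter> Y \<noteq> {} \<Longrightarrow> g \<in> S"
    and summ: "(\<lambda>s. N s powr - \<beta>) summable_on S"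
begin

text \<open>Condition (iii) for the neutral element, as \<open>Y0\<close> is a nonempty part of
  \<open>Y\<close>.\<close>

lemma zero_S: "0 \<in> S"
  using in_S[of 0] Y0 by (auto simp: image_def)

lemma S_Y: "s \<in> S \<Longrightarrow> y \<in> Y0 \<Longrightarrow> act s y \<in> Y"
  using SY0 by blast

lemma Y_S: "y \<in> Y0 \<Longrightarrow> act s y \<in> Y \<Longrightarrow> s \<in> S"
  using in_S[of s] by blast

abbreviation "\<zeta> \<equiv> zeta N S \<beta>"

lemma zeta_pos: "0 < \<zeta>"
proof -
  have "(\<Sum>\<^sub>\<infinity>s\<in>{0}. N s powr - \<beta>) \<le> (\<Sum>\<^sub>\<infinity>s\<in>S. N s powr - \<beta>)"
    by (rule infsum_mono_neutral) (use zero_S summ in auto)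
  then show ?thesis unfolding zeta_def by (simp add: N_0)
qed

lemma zeta_nn: "ennreal \<zeta> = (\<integral>\<^sup>+s. ennreal (N s powr - \<beta>) \<partial>count_space S)"
proof -
  have "ennreal \<zeta> = (SUP F\<in>{F. finite F \<and> F \<subseteq> S}. ennreal (\<Sum>s\<in>F. N s powr - \<beta>))"
    unfolding zeta_def by (rule infsum_nonneg_is_SUPREMUM_ennreal[OF summ]) simp
  also have "\<dots> = (SUP F\<in>{F. finite F \<and> F \<subseteq> S}. \<Sum>s\<in>F. ennreal (N s powr - \<beta>))"
    by (intro SUP_cong refl sum_ennreal[symmetric]) simp
  also have "\<dots> = (\<Sum>\<^sub>\<infinity>s\<in>S. ennreal (N s powr - \<beta>))"
    by (rule nonneg_infsum_complete[symmetric]) simp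
  finally show ?thesis by (simp add: infsum_ennreal_eq_nn_integral)
qed

text \<open>Condition (i) for \<open>- t + s\<close>, which moves \<open>y\<close> to
  \<open>y'\<close> inside \<open>Y0\<close>.\<close>

lemma translate_cases:
  assumes "y \<in> Y0" "y' \<in> Y0" "act s y = act t y'" shows "s = t" "y = y'"
proof -
  have y': "act (- t + s) y = y'" using assms(3) by (simp add: act_add)
  have "- t + s = 0"
  proof (rule ccontr)
    assume "- t + s \<noteq> 0"
    then show False using disj[of "- t + s"] y' assms(1,2) by blast
  qed
  then have "t + (- t + s) = t" by simp
  then show "s = t" by (simp add: add.assoc[symmetric])
  then show "y = y'" using y' by simp
qed

lemma disjoint_translates: "disjoint_family_on (\<lambda>s. act s ` Y0) S"
  unfolding disjoint_family_on_def using translate_cases(1) by blast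

definition wt :: "'g \<Rightarrow> real" where "wt s = N s powr - \<beta> / \<zeta>"

lemma wt_pos: "0 < wt s" using N_pos[of s] zeta_pos by (simp add: wt_def)

definition weights :: "'g measure" where
  "weights = density (count_space S) (\<lambda>s. ennreal (wt s))"

lemma weights_simps [simp]: "space weights = S" "sets weights = Pow S"
  by (simp_all add: weights_def)

lemma nn_integral_weights: "(\<integral>\<^sup>+s. f s \<partial>weights) = (\<integral>\<^sup>+s. ennreal (wt s) * f s \<partial>count_space S)"
  unfolding weights_def by (rule nn_integral_density) auto

lemma prob_space_weights: "prob_space weights"
proof
  have "emeasure weights (space weights) = (\<integral>\<^sup>+s. ennreal (wt s) \<partial>count_space S)"
    using nn_integral_weights[of "\<lambda>_. 1"] by simp
  also have "\<dots> = (\<integral>\<^sup>+s. ennreal (N s powr - \<beta>) * ennreal (inverse \<zeta>) \<partial>count_space S)"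
    by (intro nn_integral_cong) (use zeta_pos in \<open>simp add: wt_def divide_inverse ennreal_mult\<close>)
  also have "\<dots> = ennreal \<zeta> * ennreal (inverse \<zeta>)"
    by (simp add: nn_integral_multc zeta_nn)
  also have "\<dots> = 1" using zeta_pos by (simp flip: ennreal_mult)
  finally show "emeasure weights (space weights) = 1" .
qed

text \<open>With \<open>weights\<close> as the first factor, the slices over \<open>s\<close> are
  translates of the set, which is the formula for the induced measure.\<close>

definition spread :: "'x measure \<Rightarrow> 'x measure" where
  "spread \<nu> = distr (weights \<Otimes>\<^sub>M \<nu>) (restrict_space borel Y) (\<lambda>(s, y). act s y)"

lemma Y0_borel [measurable]: "Y0 \<in> sets borel" by (rule Y0)

lemma measurable_from_\<nu>:
  assumes \<nu>: "\<nu> \<in> prob_measures Y0" and f: "f \<in> borel \<rightarrow>\<^sub>M M"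
  shows "f \<in> \<nu> \<rightarrow>\<^sub>M M"
  using measurable_cong_sets[OF prob_measuresD(5)[OF \<nu> Y0(3)] refl] measurable_restrict_space1[OF f] by blast

lemma measurable_spread:
  assumes \<nu>: "\<nu> \<in> prob_measures Y0"
  shows "(\<lambda>(s, y). act s y) \<in> weights \<Otimes>\<^sub>M \<nu> \<rightarrow>\<^sub>M restrict_space borel Y"
proof (rule measurable_restrict_space2)
  show "(\<lambda>(s, y). act s y) \<in> space (weights \<Otimes>\<^sub>M \<nu>) \<rightarrow> Y"
    using S_Y prob_measuresD(2)[OF \<nu> Y0(3)] by (auto simp: space_pair_measure)
  have "(\<lambda>(s, y). act s y) \<in> count_space S \<Otimes>\<^sub>M \<nu> \<rightarrow>\<^sub>M borel"
    by (rule measurable_pair_measure_countable1) (auto intro: measurable_from_\<nu>[OF \<nu>])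
  moreover have "sets (weights \<Otimes>\<^sub>M \<nu>) = sets (count_space S \<Otimes>\<^sub>M \<nu>)"
    by (rule sets_pair_measure_cong) auto
  ultimately show "(\<lambda>(s, y). act s y) \<in> weights \<Otimes>\<^sub>M \<nu> \<rightarrow>\<^sub>M borel"
    using measurable_cong_sets by blast
qed

lemma pair_prob:
  assumes \<nu>: "\<nu> \<in> prob_measures Y0" shows "pair_prob_space weights \<nu>"
proof -
  interpret W: prob_space weights by (rule prob_space_weights)
  interpret V: prob_space \<nu> using prob_measuresD(1)[OF \<nu> Y0(3)] .
  show ?thesis by unfold_locales
qed

lemma sets_Y: "sets (restrict_space borel Y) = {B \<in> sets borel. B \<subseteq> Y}"
  by (rule sets_restrict_borel[OF Y_borel])

lemma spread_prob:
  assumes \<nu>: "\<nu> \<in> prob_measures Y0" shows "spread \<nu> \<in> prob_measures Y"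
proof -
  interpret pair_prob_space weights \<nu> by (rule pair_prob[OF \<nu>])
  show ?thesis unfolding prob_measures_def spread_def
    using prob_space_distr[OF measurable_spread[OF \<nu>]] by simp
qed

lemma emeasure_spread:
  assumes \<nu>: "\<nu> \<in> prob_measures Y0" and B: "B \<in> sets borel" "B \<subseteq> Y"
  shows "emeasure (spread \<nu>) B = (\<integral>\<^sup>+s. ennreal (wt s) * emeasure \<nu> (act (- s) ` B \<inter> Y0) \<partial>count_space S)"
proof -
  interpret pair_prob_space weights \<nu> by (rule pair_prob[OF \<nu>])
  have sp: "space \<nu> = Y0" by (rule prob_measuresD(2)[OF \<nu> Y0(3)])
  have B': "B \<in> sets (restrict_space borel Y)" using B by (simp add: sets_Y)
  let ?X = "(\<lambda>(s, y). act s y) -` B \<inter> space (weights \<Otimes>\<^sub>M \<nu>)"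
  have X: "?X \<in> sets (weights \<Otimes>\<^sub>M \<nu>)" by (rule measurable_sets[OF measurable_spread[OF \<nu>] B'])
  have "emeasure (spread \<nu>) B = emeasure (weights \<Otimes>\<^sub>M \<nu>) ?X"
    unfolding spread_def by (rule emeasure_distr[OF measurable_spread[OF \<nu>] B'])
  also have "\<dots> = (\<integral>\<^sup>+s. emeasure \<nu> (Pair s -` ?X) \<partial>weights)"
    by (rule M2.emeasure_pair_measure_alt[OF X])
  also have "\<dots> = (\<integral>\<^sup>+s. emeasure \<nu> (act (- s) ` B \<inter> Y0) \<partial>weights)"
  proof (rule nn_integral_cong)
    fix s assume "s \<in> space weights"
    then have "Pair s -` ?X = act (- s) ` B \<inter> Y0"
      by (auto simp: space_pair_measure sp act_image)
    then show "emeasure \<nu> (Pair s -` ?X) = emeasure \<nu> (act (- s) ` B \<inter> Y0)" by simp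
  qed
  finally show ?thesis unfolding nn_integral_weights .
qed

lemma induced_formula:
  assumes \<nu>: "\<nu> \<in> prob_measures Y0" and B: "B \<in> sets borel" "B \<subseteq> Y"
  shows "ennreal (inverse \<zeta>) * (\<Sum>\<^sub>\<infinity>s\<in>S. ennreal (N s powr - \<beta>) * emeasure \<nu> (act (- s) ` B \<inter> Y0)) = emeasure (spread \<nu>) B"
proof -
  have "ennreal (inverse \<zeta>) * (\<Sum>\<^sub>\<infinity>s\<in>S. ennreal (N s powr - \<beta>) * emeasure \<nu> (act (- s) ` B \<inter> Y0))
    = (\<integral>\<^sup>+s. ennreal (inverse \<zeta>) * (ennreal (N s powr - \<beta>) * emeasure \<nu> (act (- s) ` B \<inter> Y0)) \<partial>count_space S)"
    unfolding infsum_ennreal_eq_nn_integral by (rule nn_integral_cmult[symmetric]) simp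
  also have "\<dots> = emeasure (spread \<nu>) B"
    unfolding emeasure_spread[OF assms]
  proof (rule nn_integral_cong)
    fix s
    have "wt s = inverse \<zeta> * N s powr - \<beta>" by (simp add: wt_def divide_inverse mult.commute)
    then have "ennreal (wt s) = ennreal (inverse \<zeta>) * ennreal (N s powr - \<beta>)"
      using zeta_pos by (simp only:) (intro ennreal_mult, auto)
    then show "ennreal (inverse \<zeta>) * (ennreal (N s powr - \<beta>) * emeasure \<nu> (act (- s) ` B \<inter> Y0))
        = ennreal (wt s) * emeasure \<nu> (act (- s) ` B \<inter> Y0)"
      by (simp only: mult.assoc)
  qed
  finally show ?thesis .
qed

text \<open>\<open>measure_of\<close> keeps the given set function only if it is countably additive;
  this is inherited from \<open>spread\<close>, with which it agrees.\<close>

lemma induced_measure_eq: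
  assumes \<nu>: "\<nu> \<in> prob_measures Y0"
  shows "induced_measure act Y Y0 N S \<beta> \<nu> = spread \<nu>"
proof -
  have "induced_measure act Y Y0 N S \<beta> \<nu> = measure_of Y (sets (restrict_space borel Y)) (emeasure (spread \<nu>))"
    unfolding induced_measure_def
  proof (rule measure_of_eq)
    show "sets (restrict_space borel Y) \<subseteq> Pow Y" by (auto simp: sets_Y)
    fix B assume "B \<in> sigma_sets Y (sets (restrict_space borel Y))"
    then have "B \<in> sets (restrict_space borel Y)"
      using sets.sigma_sets_eq[of "restrict_space borel Y"] by (simp add: space_restrict_space)
    then show "ennreal (inverse \<zeta>) * (\<Sum>\<^sub>\<infinity>s\<in>S. ennreal (N s powr - \<beta>) * emeasure \<nu> (act (- s) ` B \<inter> Y0)) = emeasure (spread \<nu>) B"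
      using induced_formula[OF \<nu>] by (simp add: sets_Y)
  qed
  also have "\<dots> = spread \<nu>"
    using measure_of_of_measure[of "spread \<nu>"] prob_measuresD(2,5)[OF spread_prob[OF \<nu>] Y_borel] by simp
  finally show ?thesis .
qed

lemma scaling_spread:
  assumes \<nu>: "\<nu> \<in> prob_measures Y0" shows "scaling \<beta> (spread \<nu>)"
  unfolding scaling_def
proof (intro conjI allI impI)
  show "spread \<nu> \<in> prob_measures Y" by (rule spread_prob[OF \<nu>])
  \<comment> \<open>By (iii) a subset of \<open>Y\<close> meets no translate of \<open>Y0\<close>
    with index outside \<open>S\<close>, so the sum may run over the group and be reindexed by left
    translation.\<close>
  have all: "emeasure (spread \<nu>) B = (\<integral>\<^sup>+s. ennreal (wt s) * emeasure \<nu> (act (- s) ` B \<inter> Y0) \<partial>count_space UNIV)"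
    if B: "B \<in> sets borel" "B \<subseteq> Y" for B
    unfolding emeasure_spread[OF \<nu> B]
  proof (rule nn_integral_count_space_eq)
    fix s assume "s \<in> UNIV - S"
    then have "act (- s) ` B \<inter> Y0 = {}" using Y_S B(2) by (auto simp: act_image)
    then show "ennreal (wt s) * emeasure \<nu> (act (- s) ` B \<inter> Y0) = 0" by simp
  qed auto
  fix g and B assume B: "B \<in> sets borel" "B \<subseteq> Y" "act g ` B \<subseteq> Y"
  have bij: "bij_betw (\<lambda>t. g + t) UNIV (UNIV :: 'g set)"
    by (rule bij_betwI[where g = "\<lambda>t. - g + t"]) (auto simp: add.assoc[symmetric])
  have "emeasure (spread \<nu>) (act g ` B) = (\<integral>\<^sup>+s. ennreal (wt s) * emeasure \<nu> (act (- s) ` act g ` B \<inter> Y0) \<partial>count_space UNIV)"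
    by (rule all[OF act_image_borel[OF B(1)] B(3)])
  also have "\<dots> = (\<integral>\<^sup>+t. ennreal (wt (g + t)) * emeasure \<nu> (act (- (g + t)) ` act g ` B \<inter> Y0) \<partial>count_space UNIV)"
    by (rule nn_integral_bij_count_space[OF bij, symmetric])
  also have "\<dots> = (\<integral>\<^sup>+t. ennreal (N g powr - \<beta>) * (ennreal (wt t) * emeasure \<nu> (act (- t) ` B \<inter> Y0)) \<partial>count_space UNIV)"
  proof (rule nn_integral_cong)
    fix t
    have "act (- (g + t)) ` act g ` B = act (- t) ` B"
      unfolding act_image_image minus_add by (simp add: add.assoc)
    moreover have "wt (g + t) = N g powr - \<beta> * wt t"
      using N_pos[of g] N_pos[of t] by (simp add: wt_def N_add powr_mult)
    ultimately show "ennreal (wt (g + t)) * emeasure \<nu> (act (- (g + t)) ` act g ` B \<inter> Y0) =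
        ennreal (N g powr - \<beta>) * (ennreal (wt t) * emeasure \<nu> (act (- t) ` B \<inter> Y0))"
      using wt_pos[of t] by (simp add: ennreal_mult mult.assoc)
  qed
  also have "\<dots> = ennreal (N g powr - \<beta>) * emeasure (spread \<nu>) B"
    unfolding all[OF B(1,2)] by (rule nn_integral_cmult) simp
  finally show "emeasure (spread \<nu>) (act g ` B) = ennreal (N g powr - \<beta>) * emeasure (spread \<nu>) B" .
qed

text \<open>By (i) only the neutral index contributes, and its weight is
  \<open>inverse \<zeta>\<close>.\<close>

lemma emeasure_spread_Y0:
  assumes \<nu>: "\<nu> \<in> prob_measures Y0" and B: "B \<in> sets borel" "B \<subseteq> Y0"
  shows "emeasure (spread \<nu>) B = ennreal (inverse \<zeta>) * emeasure \<nu> B"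
proof -
  have "emeasure (spread \<nu>) B = (\<integral>\<^sup>+s. ennreal (wt s) * emeasure \<nu> (act (- s) ` B \<inter> Y0) \<partial>count_space S)"
    using B Y0 by (intro emeasure_spread[OF \<nu>]) auto
  also have "\<dots> = (\<integral>\<^sup>+s. ennreal (wt s) * emeasure \<nu> (act (- s) ` B \<inter> Y0) \<partial>count_space {0})"
  proof (rule nn_integral_count_space_eq)
    fix s assume "s \<in> S - {0}"
    then have "act (- s) ` Y0 \<inter> Y0 = {}" by (intro disj) auto
    then have "act (- s) ` B \<inter> Y0 = {}" using B(2) by blast
    then show "ennreal (wt s) * emeasure \<nu> (act (- s) ` B \<inter> Y0) = 0" by simp
  qed (use zero_S in auto)
  also have "\<dots> = ennreal (wt 0) * emeasure \<nu> (B \<inter> Y0)"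
    by (simp add: nn_integral_count_space_finite)
  finally show ?thesis using B(2) by (simp add: wt_def N_0 Int_absorb2 divide_inverse)
qed

text \<open>
  An open \<open>U\<close> with \<open>\<mu>(U) < \<mu>(Y0) + \<epsilon>\<close> gives \<open>1 \<le> \<Sum>\<^sub>s \<mu>(s U \<inter> Y) \<le> \<zeta> (\<mu>(Y0) + \<epsilon>)\<close>,
  whereas the disjoint translates of \<open>Y0\<close> have total mass \<open>\<zeta> \<mu>(Y0)\<close>.
\<close>

lemma scaling_concentrated:
  assumes \<mu>: "scaling \<beta> \<mu>"
    and cover: "\<And>U. open U \<Longrightarrow> Y0 \<subseteq> U \<Longrightarrow> emeasure \<mu> (Y - (\<Union>s\<in>S. act s ` U)) = 0"
  shows "ennreal \<zeta> * emeasure \<mu> Y0 = 1" "emeasure \<mu> (\<Union>s\<in>S. act s ` Y0) = 1"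
proof -
  have p: "\<mu> \<in> prob_measures Y" using \<mu> by (simp add: scaling_def)
  interpret prob_space \<mu> by (rule prob_measuresD(1)[OF p Y_borel])
  have sets: "B \<in> sets \<mu> \<longleftrightarrow> B \<in> sets borel \<and> B \<subseteq> Y" for B
    using prob_measuresD(3)[OF p Y_borel] by auto
  have sp: "space \<mu> = Y" by (rule prob_measuresD(2)[OF p Y_borel])
  note e = extend_props[OF p]
  have scal: "emeasure \<mu> (act s ` B) = ennreal (N s powr - \<beta>) * emeasure \<mu> B"
    if "B \<in> sets borel" "B \<subseteq> Y" "act s ` B \<subseteq> Y" for s B
    using \<mu> that unfolding scaling_def by blast
  have sY0: "act s ` Y0 \<in> sets \<mu>" if "s \<in> S" for s
    using that SY0 act_image_borel[OF Y0(3)] by (auto simp: sets)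
  have "emeasure \<mu> (\<Union>s\<in>S. act s ` Y0) = (\<integral>\<^sup>+s. emeasure \<mu> (act s ` Y0) \<partial>count_space S)"
  proof (rule emeasure_UN_countable[OF sY0])
    show "disjoint_family_on (\<lambda>s. act s ` Y0) S" by (rule disjoint_translates)
  qed auto
  also have "\<dots> = (\<integral>\<^sup>+s. ennreal (N s powr - \<beta>) * emeasure \<mu> Y0 \<partial>count_space S)"
    by (intro nn_integral_cong scal) (use Y0 SY0 in auto)
  also have "\<dots> = ennreal \<zeta> * emeasure \<mu> Y0" by (simp add: nn_integral_multc zeta_nn)
  finally have eq: "emeasure \<mu> (\<Union>s\<in>S. act s ` Y0) = ennreal \<zeta> * emeasure \<mu> Y0" .
  have le1: "ennreal \<zeta> * emeasure \<mu> Y0 \<le> 1"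
    unfolding eq[symmetric] by (simp add: emeasure_eq_measure)
  have "1 \<le> \<zeta> * measure \<mu> Y0 + d" if d: "0 < d" for d
  proof -
    define \<epsilon> where "\<epsilon> = d / \<zeta>"
    have \<epsilon>: "0 < \<epsilon>" using d zeta_pos by (simp add: \<epsilon>_def)
    \<comment> \<open>Regularity is used on the whole space; intersecting with the open set
      \<open>Y\<close> afterwards keeps the neighbourhood open.\<close>
    obtain U0 where U0: "open U0" "Y0 \<subseteq> U0" "measure (extend \<mu>) U0 < measure (extend \<mu>) Y0 + \<epsilon>"
      using finite_borel_measure_outer_regular[OF X prob_space.finite_measure[OF e(2)] e(1) Y0(3) \<epsilon>] by metis
    define U where "U = U0 \<inter> Y"
    have U: "open U" "Y0 \<subseteq> U" "U \<subseteq> Y" using U0 Y Y0 by (auto simp: U_def)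
    have mU: "measure \<mu> U < measure \<mu> Y0 + \<epsilon>"
      using U0(3) e(3)[OF borel_open[OF U0(1)]] e(3)[OF Y0(3)] Y0(1)
      by (simp add: measure_def U_def Int_absorb2)
    define V where "V s = act s ` U \<inter> Y" for s
    have Vb: "V s \<in> sets \<mu>" for s
      using act_image_borel[OF borel_open[OF U(1)]] Y_borel by (auto simp: sets V_def)
    have V: "emeasure \<mu> (V s) \<le> ennreal (N s powr - \<beta>) * emeasure \<mu> U" for s
    proof -
      \<comment> \<open>Only the part of \<open>U\<close> that \<open>s\<close> moves into
        \<open>Y\<close> may be scaled.\<close>
      let ?B = "U \<inter> act (- s) ` Y"
      have Bb: "?B \<in> sets borel" using borel_open[OF U(1)] act_image_borel[OF Y_borel] by blast
      have "V s = act s ` ?B" by (auto simp: V_def act_image)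
      then have "emeasure \<mu> (V s) = ennreal (N s powr - \<beta>) * emeasure \<mu> ?B"
        using scal[OF Bb, of s] U(3) by (auto simp: V_def)
      also have "\<dots> \<le> ennreal (N s powr - \<beta>) * emeasure \<mu> U"
        using U borel_open[OF U(1)] by (intro mult_left_mono emeasure_mono) (auto simp: sets)
      finally show ?thesis .
    qed
    have UV: "(\<Union>s\<in>S. V s) \<in> sets \<mu>" using Vb by (intro sets.countable_UN') auto
    have "emeasure \<mu> Y \<le> emeasure \<mu> (\<Union>s\<in>S. V s) + emeasure \<mu> (Y - (\<Union>s\<in>S. act s ` U))"
    proof (rule order_trans[OF emeasure_mono emeasure_subadditive])
      show "Y \<subseteq> (\<Union>s\<in>S. V s) \<union> (Y - (\<Union>s\<in>S. act s ` U))" by (auto simp: V_def)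
      have "Y - (\<Union>s\<in>S. act s ` U) = Y - (\<Union>s\<in>S. V s)" by (auto simp: V_def)
      then show "Y - (\<Union>s\<in>S. act s ` U) \<in> sets \<mu>" using UV sp by (metis sets.compl_sets)
      then show "(\<Union>s\<in>S. V s) \<union> (Y - (\<Union>s\<in>S. act s ` U)) \<in> sets \<mu>" using UV by auto
    qed (rule UV)
    also have "\<dots> = (\<integral>\<^sup>+x. indicator (\<Union>s\<in>S. V s) x \<partial>\<mu>)"
      using cover[OF U(1,2)] UV by simp
    \<comment> \<open>Countable subadditivity: the indicator of a union is at most the number of
      members containing the point.\<close>
    also have "\<dots> \<le> (\<integral>\<^sup>+x. (\<integral>\<^sup>+s. indicator (V s) x \<partial>count_space S) \<partial>\<mu>)"
    proof (rule nn_integral_mono)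
      fix x
      show "indicator (\<Union>s\<in>S. V s) x \<le> (\<integral>\<^sup>+s. indicator (V s) x \<partial>count_space S)"
      proof (cases "x \<in> (\<Union>s\<in>S. V s)")
        case True
        then obtain s where s: "s \<in> S" "x \<in> V s" by blast
        have "1 = (\<integral>\<^sup>+t. indicator {s} t \<partial>count_space S)" using s by simp
        also have "\<dots> \<le> (\<integral>\<^sup>+t. indicator (V t) x \<partial>count_space S)"
          using s by (intro nn_integral_mono) (auto simp: indicator_def)
        finally show ?thesis using True by simp
      qed simp
    qed
    also have "\<dots> = (\<integral>\<^sup>+s. (\<integral>\<^sup>+x. indicator (V s) x \<partial>\<mu>) \<partial>count_space S)"
      by (rule nn_integral_count_space_nn_integral) (use Vb in auto)
    also have "\<dots> = (\<integral>\<^sup>+s. emeasure \<mu> (V s) \<partial>count_space S)" using Vb by simp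
    also have "\<dots> \<le> (\<integral>\<^sup>+s. ennreal (N s powr - \<beta>) * emeasure \<mu> U \<partial>count_space S)"
      by (intro nn_integral_mono V)
    also have "\<dots> = ennreal \<zeta> * emeasure \<mu> U" by (simp add: nn_integral_multc zeta_nn)
    finally have "1 \<le> \<zeta> * measure \<mu> U"
      using emeasure_space_1 sp zeta_pos by (simp add: emeasure_eq_measure flip: ennreal_mult)
    also have "\<dots> \<le> \<zeta> * (measure \<mu> Y0 + \<epsilon>)" using mU zeta_pos by (intro mult_left_mono) auto
    also have "\<dots> = \<zeta> * measure \<mu> Y0 + d" using zeta_pos by (simp add: \<epsilon>_def algebra_simps)
    finally show ?thesis .
  qed
  then have "1 \<le> \<zeta> * measure \<mu> Y0" by (rule field_le_epsilon)
  moreover have "\<zeta> * measure \<mu> Y0 \<le> 1"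
    using le1 zeta_pos by (simp add: emeasure_eq_measure flip: ennreal_mult)
  ultimately have "\<zeta> * measure \<mu> Y0 = 1" by simp
  then show "ennreal \<zeta> * emeasure \<mu> Y0 = 1"
    using zeta_pos by (simp add: emeasure_eq_measure flip: ennreal_mult)
  then show "emeasure \<mu> (\<Union>s\<in>S. act s ` Y0) = 1" by (simp add: eq)
qed

text \<open>\<open>restricted_measure\<close> as an operation on measures instead of states.\<close>

definition restrict_Y0 :: "'x measure \<Rightarrow> 'x measure" where
  "restrict_Y0 \<mu> = scale_measure (ennreal \<zeta>) (restrict_space \<mu> Y0)"

lemma restrict_Y0_props:
  assumes p: "\<mu> \<in> prob_measures Y"
  shows "sets (restrict_Y0 \<mu>) = sets (restrict_space borel Y0)"
    "B \<in> sets borel \<Longrightarrow> B \<subseteq> Y0 \<Longrightarrow> emeasure (restrict_Y0 \<mu>) B = ennreal \<zeta> * emeasure \<mu> B"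
    "space (restrict_Y0 \<mu>) = Y0"
proof -
  have sets: "sets \<mu> = {B \<in> sets borel. B \<subseteq> Y}" by (rule prob_measuresD(3)[OF p Y_borel])
  have sp: "space \<mu> = Y" by (rule prob_measuresD(2)[OF p Y_borel])
  have "Y0 \<in> sets \<mu>" using Y0 by (simp add: sets)
  then have "sets (restrict_space \<mu> Y0) = {B \<in> sets \<mu>. B \<subseteq> Y0}"
    by (auto simp: sets_restrict_space)
  also have "\<dots> = sets (restrict_space borel Y0)"
    using Y0 unfolding sets sets_restrict_borel[OF Y0(3)] by auto
  finally show 1: "sets (restrict_Y0 \<mu>) = sets (restrict_space borel Y0)"
    by (simp add: restrict_Y0_def)
  show "space (restrict_Y0 \<mu>) = Y0"
    using Y0(1) by (auto simp: restrict_Y0_def space_scale_measure space_restrict_space sp)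
  show "emeasure (restrict_Y0 \<mu>) B = ennreal \<zeta> * emeasure \<mu> B" if "B \<in> sets borel" "B \<subseteq> Y0"
    unfolding restrict_Y0_def using that \<open>Y0 \<in> sets \<mu>\<close> sp Y0(1)
    by (simp add: emeasure_restrict_space Int_absorb2)
qed

lemma restrict_spread:
  assumes \<nu>: "\<nu> \<in> prob_measures Y0" shows "restrict_Y0 (spread \<nu>) = \<nu>"
proof (rule measure_eqI)
  note r = restrict_Y0_props[OF spread_prob[OF \<nu>]]
  show "sets (restrict_Y0 (spread \<nu>)) = sets \<nu>" using r(1) prob_measuresD(5)[OF \<nu> Y0(3)] by simp
  fix B assume "B \<in> sets (restrict_Y0 (spread \<nu>))"
  then have B: "B \<in> sets borel" "B \<subseteq> Y0" using r(1) sets_restrict_borel[OF Y0(3)] by auto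
  show "emeasure (restrict_Y0 (spread \<nu>)) B = emeasure \<nu> B"
    unfolding r(2)[OF B] emeasure_spread_Y0[OF \<nu> B] mult.assoc[symmetric]
    using zeta_pos by (simp flip: ennreal_mult)
qed

text \<open>\<open>wt s * \<zeta>\<close> is the scaling factor of \<open>s\<close>, so each summand
  is the mass of \<open>B\<close> inside one translate; the disjoint translates have full
  measure.\<close>

lemma spread_restrict:
  assumes \<mu>: "scaling \<beta> \<mu>"
    and cover: "\<And>U. open U \<Longrightarrow> Y0 \<subseteq> U \<Longrightarrow> emeasure \<mu> (Y - (\<Union>s\<in>S. act s ` U)) = 0"
  shows "restrict_Y0 \<mu> \<in> prob_measures Y0" "spread (restrict_Y0 \<mu>) = \<mu>"
proof -
  have p: "\<mu> \<in> prob_measures Y" using \<mu> by (simp add: scaling_def)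
  interpret prob_space \<mu> by (rule prob_measuresD(1)[OF p Y_borel])
  note r = restrict_Y0_props[OF p] and c = scaling_concentrated[OF \<mu> cover]
  have sets: "B \<in> sets \<mu> \<longleftrightarrow> B \<in> sets borel \<and> B \<subseteq> Y" for B
    using prob_measuresD(3)[OF p Y_borel] by auto
  have sp: "space \<mu> = Y" by (rule prob_measuresD(2)[OF p Y_borel])
  have "prob_space (restrict_Y0 \<mu>)"
    by (rule prob_spaceI) (simp add: r(3) r(2)[OF Y0(3)] c(1))
  then show \<nu>: "restrict_Y0 \<mu> \<in> prob_measures Y0" using r(1) by (simp add: prob_measures_def)
  show "spread (restrict_Y0 \<mu>) = \<mu>"
  proof (rule measure_eqI)
    show "sets (spread (restrict_Y0 \<mu>)) = sets \<mu>"
      using prob_measuresD(5)[OF p Y_borel] prob_measuresD(5)[OF spread_prob[OF \<nu>] Y_borel] by simp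
    fix B assume "B \<in> sets (spread (restrict_Y0 \<mu>))"
    then have B: "B \<in> sets borel" "B \<subseteq> Y" using prob_measuresD(3)[OF spread_prob[OF \<nu>] Y_borel] by auto
    have Bs: "B \<inter> act s ` Y0 \<in> sets borel" for s using B(1) act_image_borel[OF Y0(3)] by blast
    have "emeasure (spread (restrict_Y0 \<mu>)) B = (\<integral>\<^sup>+s. emeasure \<mu> (B \<inter> act s ` Y0) \<partial>count_space S)"
      unfolding emeasure_spread[OF \<nu> B]
    proof (rule nn_integral_cong)
      fix s assume "s \<in> space (count_space S)"
      let ?C = "act (- s) ` B \<inter> Y0"
      have C: "?C \<in> sets borel" "?C \<subseteq> Y0" using act_image_borel[OF B(1)] Y0(3) by auto
      have eq: "act s ` ?C = B \<inter> act s ` Y0" by (auto simp: act_image)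
      have "emeasure \<mu> (act s ` ?C) = ennreal (N s powr - \<beta>) * emeasure \<mu> ?C"
        using \<mu> C Y0(1) B(2) eq unfolding scaling_def by (metis inf.coboundedI1 subset_trans)
      moreover have "ennreal (wt s) * ennreal \<zeta> = ennreal (N s powr - \<beta>)"
        using zeta_pos wt_pos[of s] by (simp add: wt_def flip: ennreal_mult)
      ultimately show "ennreal (wt s) * emeasure (restrict_Y0 \<mu>) ?C = emeasure \<mu> (B \<inter> act s ` Y0)"
        unfolding r(2)[OF C] eq by (simp add: mult.assoc[symmetric])
    qed
    also have "\<dots> = emeasure \<mu> (\<Union>s\<in>S. B \<inter> act s ` Y0)"
    proof (rule emeasure_UN_countable[symmetric])
      show "disjoint_family_on (\<lambda>s. B \<inter> act s ` Y0) S"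
        using disjoint_translates unfolding disjoint_family_on_def by blast
    qed (use Bs B(2) in \<open>auto simp: sets\<close>)
    also have "\<dots> = emeasure \<mu> B"
    proof (rule emeasure_eq_AE)
      have T: "(\<Union>s\<in>S. act s ` Y0) \<in> sets \<mu>"
        using SY0 act_image_borel[OF Y0(3)] by (auto simp: sets)
      then have "AE x in \<mu>. x \<in> (\<Union>s\<in>S. act s ` Y0)"
        using c(2) by (intro AE_in_set_eq_1[THEN iffD2]) (auto simp: emeasure_eq_measure)
      then show "AE x in \<mu>. (x \<in> (\<Union>s\<in>S. B \<inter> act s ` Y0)) = (x \<in> B)"
        by eventually_elim auto
      have "(\<Union>s\<in>S. B \<inter> act s ` Y0) \<in> sets borel"
        by (rule sets.countable_UN'') (auto intro: Bs)
      then show "(\<Union>s\<in>S. B \<inter> act s ` Y0) \<in> sets \<mu>" using B(2) unfolding sets by blast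
      show "B \<in> sets \<mu>" using B by (simp add: sets)
    qed
    finally show "emeasure (spread (restrict_Y0 \<mu>)) B = emeasure \<mu> B" .
  qed
qed

end

section \<open>Functions constant on the fibres\<close>

lemma L2_product_integrable:
  assumes "f \<in> L2_functions M" "g \<in> L2_functions M"
  shows "integrable M (\<lambda>x. f x * cnj (g x))"
proof (rule Bochner_Integration.integrable_bound)
  show "integrable M (\<lambda>x. (cmod (f x))\<^sup>2 + (cmod (g x))\<^sup>2)"
    using assms by (simp add: L2_functions_def)
  have [measurable]: "f \<in> borel_measurable M" "g \<in> borel_measurable M"
    using assms by (auto simp: L2_functions_def)
  show "(\<lambda>x. f x * cnj (g x)) \<in> borel_measurable M"
    by (intro borel_measurable_times measurable_compose[OF _ borel_measurable_continuous_onI[of cnj]])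
      (auto intro: continuous_intros)
  have "cmod (f x * cnj (g x)) \<le> (cmod (f x))\<^sup>2 + (cmod (g x))\<^sup>2" for x
  proof -
    have "2 * (cmod (f x) * cmod (g x)) \<le> (cmod (f x))\<^sup>2 + (cmod (g x))\<^sup>2"
      using sum_squares_bound[of "cmod (f x)" "cmod (g x)"] by simp
    moreover have "0 \<le> cmod (f x) * cmod (g x)" by simp
    ultimately have "cmod (f x) * cmod (g x) \<le> (cmod (f x))\<^sup>2 + (cmod (g x))\<^sup>2" by linarith
    then show ?thesis by (simp add: norm_mult)
  qed
  then show "AE x in M. norm (f x * cnj (g x)) \<le> norm ((cmod (f x))\<^sup>2 + (cmod (g x))\<^sup>2)"
    by (intro AE_I2) (auto intro: order_trans)
qed

lemma L2_diff:
  assumes "f \<in> L2_functions M" "g \<in> L2_functions M"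
  shows "(\<lambda>x. f x - g x) \<in> L2_functions M"
  unfolding L2_functions_def
proof (intro CollectI conjI)
  have [measurable]: "f \<in> borel_measurable M" "g \<in> borel_measurable M"
    using assms by (auto simp: L2_functions_def)
  show "(\<lambda>x. f x - g x) \<in> borel_measurable M" by measurable
  show "integrable M (\<lambda>x. (cmod (f x - g x))\<^sup>2)"
  proof (rule Bochner_Integration.integrable_bound)
    show "integrable M (\<lambda>x. 2 * (cmod (f x))\<^sup>2 + 2 * (cmod (g x))\<^sup>2)"
      using assms by (simp add: L2_functions_def)
    have "(cmod (f x - g x))\<^sup>2 \<le> 2 * (cmod (f x))\<^sup>2 + 2 * (cmod (g x))\<^sup>2" for x
    proof -
      have "(cmod (f x - g x))\<^sup>2 \<le> (cmod (f x) + cmod (g x))\<^sup>2"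
        by (intro power_mono norm_triangle_ineq4) auto
      then show ?thesis using sum_squares_bound[of "cmod (f x)" "cmod (g x)"] by (simp add: power2_sum)
    qed
    then show "AE x in M. norm ((cmod (f x - g x))\<^sup>2) \<le> norm (2 * (cmod (f x))\<^sup>2 + 2 * (cmod (g x))\<^sup>2)"
      by (intro AE_I2) (auto intro: order_trans)
  qed measurable
qed

text \<open>The inequality is nonnegativity of the variance of the modulus.\<close>

lemma (in prob_space) square_integral_le:
  fixes h :: "'a \<Rightarrow> complex"
  assumes [measurable]: "h \<in> borel_measurable M" and int: "integrable M (\<lambda>x. (cmod (h x))\<^sup>2)"
  shows "integrable M h" "(cmod (\<integral>x. h x \<partial>M))\<^sup>2 \<le> (\<integral>x. (cmod (h x))\<^sup>2 \<partial>M)"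
proof -
  have n: "integrable M (\<lambda>x. cmod (h x))" by (rule square_integrable_imp_integrable[OF _ int]) simp
  then show "integrable M h" by (simp add: integrable_norm_iff)
  have "(cmod (\<integral>x. h x \<partial>M))\<^sup>2 \<le> (\<integral>x. cmod (h x) \<partial>M)\<^sup>2"
    by (intro power_mono integral_norm_bound) simp
  also have "\<dots> \<le> (\<integral>x. (cmod (h x))\<^sup>2 \<partial>M)"
    using variance_positive[of "\<lambda>x. cmod (h x)"] variance_eq[OF n int] by simp
  finally show "(cmod (\<integral>x. h x \<partial>M))\<^sup>2 \<le> (\<integral>x. (cmod (h x))\<^sup>2 \<partial>M)" .
qed

context wandering
begin

lemma AE_weights: "(AE s in weights. Q s) \<longleftrightarrow> (\<forall>s\<in>S. Q s)"
  unfolding weights_def by (subst AE_density) (auto simp: AE_count_space wt_pos)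

text \<open>Integrability against \<open>weights\<close> is absolute summability, which identifies
  the Bochner integral with an unordered sum.\<close>

lemma weights_integral:
  fixes h :: "'g \<Rightarrow> complex"
  assumes "integrable weights h"
  shows "(\<lambda>s. of_real (N s powr - \<beta>) * h s) summable_on S"
    "(\<integral>s. h s \<partial>weights) = of_real (inverse \<zeta>) * (\<Sum>\<^sub>\<infinity>s\<in>S. of_real (N s powr - \<beta>) * h s)"
proof -
  have nn: "AE s in count_space S. 0 \<le> wt s" using wt_pos by (simp add: AE_count_space less_imp_le)
  have w: "wt s *\<^sub>R h s = of_real (inverse \<zeta>) * (of_real (N s powr - \<beta>) * h s)" for s
    by (simp add: wt_def scaleR_conv_of_real divide_inverse)
  have "integrable (count_space S) (\<lambda>s. wt s *\<^sub>R h s)"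
    using assms unfolding weights_def by (subst (asm) integrable_density[OF _ _ nn]) auto
  then have set_sum: "Infinite_Set_Sum.abs_summable_on (\<lambda>s. wt s *\<^sub>R h s) S"
    by (simp add: Infinite_Set_Sum.abs_summable_on_def)
  then have abs: "Infinite_Sum.abs_summable_on (\<lambda>s. wt s *\<^sub>R h s) S" by (rule abs_summable_equivalent[THEN iffD2])
  have "(\<lambda>s. wt s *\<^sub>R h s) summable_on S" by (rule abs_summable_summable[OF abs])
  from summable_on_cmult_right[OF this, of "of_real \<zeta>"]
  show "(\<lambda>s. of_real (N s powr - \<beta>) * h s) summable_on S"
    unfolding w using zeta_pos by (simp add: mult.assoc[symmetric] flip: of_real_mult)
  have "(\<integral>s. h s \<partial>weights) = (\<integral>s. wt s *\<^sub>R h s \<partial>count_space S)"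
    unfolding weights_def by (rule integral_density[OF _ _ nn]) auto
  also have "\<dots> = infsetsum (\<lambda>s. wt s *\<^sub>R h s) S" by (simp add: infsetsum_def)
  also have "\<dots> = (\<Sum>\<^sub>\<infinity>s\<in>S. wt s *\<^sub>R h s)" by (rule infsetsum_infsum[OF set_sum])
  also have "\<dots> = of_real (inverse \<zeta>) * (\<Sum>\<^sub>\<infinity>s\<in>S. of_real (N s powr - \<beta>) * h s)"
    unfolding w by (rule infsum_cmult_right')
  finally show "(\<integral>s. h s \<partial>weights) = of_real (inverse \<zeta>) * (\<Sum>\<^sub>\<infinity>s\<in>S. of_real (N s powr - \<beta>) * h s)" .
qed

end

locale wandering_measure = wandering act Y N \<beta> S Y0
  for act :: "'g::{group_add, countable} \<Rightarrow> 'x::{second_countable_topology, t2_space} \<Rightarrow> 'x"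
    and Y N \<beta> S Y0 +
  fixes \<nu> :: "'x measure"
  assumes \<nu>: "\<nu> \<in> prob_measures Y0"
begin

abbreviation "\<mu> \<equiv> spread \<nu>"
text \<open>The order is opposite to that in \<open>spread\<close>: iterated integration now leaves
  the integral over each fibre inside.\<close>

abbreviation "\<Theta> \<equiv> \<nu> \<Otimes>\<^sub>M weights"

definition spread_map :: "'x \<times> 'g \<Rightarrow> 'x" where "spread_map = (\<lambda>(y, s). act s y)"

lemma spread_map_simp [simp]: "spread_map (y, s) = act s y" by (simp add: spread_map_def)

sublocale V: prob_space \<nu> by (rule prob_measuresD(1)[OF \<nu> Y0(3)])
sublocale W: prob_space weights by (rule prob_space_weights)
sublocale VW: pair_prob_space \<nu> weights by unfold_locales
sublocale M: prob_space \<mu> by (rule prob_measuresD(1)[OF spread_prob[OF \<nu>] Y_borel])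

lemma space_\<nu>: "space \<nu> = Y0" by (rule prob_measuresD(2)[OF \<nu> Y0(3)])

lemma measurable_spread_map: "spread_map \<in> \<Theta> \<rightarrow>\<^sub>M restrict_space borel Y"
  using measurable_compose[OF measurable_pair_swap' measurable_spread[OF \<nu>]]
  by (simp add: spread_map_def case_prod_unfold)

lemma \<mu>_eq: "\<mu> = distr \<Theta> (restrict_space borel Y) spread_map"
proof -
  interpret WV: pair_sigma_finite weights \<nu> by unfold_locales
  have "\<mu> = distr (distr \<Theta> (weights \<Otimes>\<^sub>M \<nu>) (\<lambda>(x, y). (y, x))) (restrict_space borel Y) (\<lambda>(s, y). act s y)"
    unfolding spread_def by (subst WV.distr_pair_swap) simp
  also have "\<dots> = distr \<Theta> (restrict_space borel Y) ((\<lambda>(s, y). act s y) \<circ> (\<lambda>(x, y). (y, x)))"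
    by (rule distr_distr[OF measurable_spread[OF \<nu>] measurable_pair_swap'])
  also have "(\<lambda>(s, y). act s y) \<circ> (\<lambda>(x, y). (y, x)) = spread_map" by (auto simp: spread_map_def)
  finally show ?thesis .
qed

lemma measurable_\<mu>: "f \<in> borel_measurable \<mu> \<longleftrightarrow> f \<in> borel_measurable (restrict_space borel Y)"
  by (rule measurable_cong_sets[THEN arg_cong, of \<mu> "restrict_space borel Y" _ _ "\<lambda>X. f \<in> X"]) (simp_all add: \<mu>_eq)

lemma measurable_comp:
  assumes "f \<in> borel_measurable \<mu>" shows "(\<lambda>p. f (spread_map p)) \<in> borel_measurable \<Theta>"
  by (rule measurable_compose[OF measurable_spread_map]) (use assms measurable_\<mu> in blast)

lemma integral_\<mu>:
  fixes f :: "'x \<Rightarrow> 'b::{banach, second_countable_topology}"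
  assumes "f \<in> borel_measurable \<mu>"
  shows "(\<integral>x. f x \<partial>\<mu>) = (\<integral>p. f (spread_map p) \<partial>\<Theta>)" "integrable \<mu> f \<longleftrightarrow> integrable \<Theta> (\<lambda>p. f (spread_map p))"
proof -
  have f: "f \<in> borel_measurable (restrict_space borel Y)" using assms measurable_\<mu> by blast
  show "(\<integral>x. f x \<partial>\<mu>) = (\<integral>p. f (spread_map p) \<partial>\<Theta>)"
    by (subst \<mu>_eq) (rule integral_distr[OF measurable_spread_map f])
  show "integrable \<mu> f \<longleftrightarrow> integrable \<Theta> (\<lambda>p. f (spread_map p))"
    by (subst \<mu>_eq) (rule integrable_distr_eq[OF measurable_spread_map f])
qed

lemma AE_\<mu>_D:
  assumes "AE x in \<mu>. Q x" shows "AE y in \<nu>. \<forall>s\<in>S. Q (act s y)"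
proof -
  have "AE p in \<Theta>. Q (spread_map p)"
    using assms by (subst (asm) \<mu>_eq) (rule AE_distrD[OF measurable_spread_map])
  from VW.AE_pair[OF this] show ?thesis by (simp add: AE_weights)
qed

text \<open>On subsets of \<open>Y0\<close> the measure \<open>\<mu>\<close> is a multiple of
  \<open>\<nu>\<close>, so null sets carry over.\<close>

lemma AE_\<nu>_imp_AE_\<mu>:
  assumes "AE y in \<nu>. Q y" shows "AE y in \<mu>. y \<in> Y0 \<longrightarrow> Q y"
proof -
  obtain B where B: "{y \<in> space \<nu>. \<not> Q y} \<subseteq> B" "emeasure \<nu> B = 0" "B \<in> sets \<nu>"
    using assms by (rule AE_E)
  have Bb: "B \<in> sets borel" "B \<subseteq> Y0" using B(3) prob_measuresD(3)[OF \<nu> Y0(3)] by auto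
  have "emeasure \<mu> B = 0" using emeasure_spread_Y0[OF \<nu> Bb] B(2) by simp
  moreover have "B \<in> sets \<mu>" using Bb Y0(1) prob_measuresD(3)[OF spread_prob[OF \<nu>] Y_borel] by auto
  ultimately show ?thesis using B(1) by (intro AE_I[where N = B]) (auto simp: space_\<nu>)
qed

lemma fst_\<Theta>:
  fixes h :: "'x \<Rightarrow> 'b::{banach, second_countable_topology}"
  assumes "h \<in> borel_measurable \<nu>"
  shows "(\<integral>p. h (fst p) \<partial>\<Theta>) = (\<integral>y. h y \<partial>\<nu>)" "integrable \<Theta> (\<lambda>p. h (fst p)) \<longleftrightarrow> integrable \<nu> h"
  using integral_distr[OF measurable_fst assms, of weights] integrable_distr_eq[OF measurable_fst assms, of weights]
  unfolding W.distr_pair_fst by auto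

lemma measurable_\<mu>_\<nu>: "f \<in> borel_measurable \<mu> \<Longrightarrow> f \<in> borel_measurable \<nu>"
proof -
  assume f: "f \<in> borel_measurable \<mu>"
  have "(\<lambda>y. y) \<in> \<nu> \<rightarrow>\<^sub>M restrict_space borel Y"
  proof (rule measurable_restrict_space2)
    show "(\<lambda>y. y) \<in> \<nu> \<rightarrow>\<^sub>M borel" by (rule measurable_from_\<nu>[OF \<nu>]) simp
  qed (use Y0 in \<open>auto simp: space_\<nu>\<close>)
  from measurable_compose[OF this] f show ?thesis using measurable_\<mu> by blast
qed

text \<open>A point \<open>act s y\<close> of the spread lies in \<open>Y0\<close> only for the
  neutral index, which has probability \<open>inverse \<zeta>\<close>.\<close>

lemma set_integral_Y0:
  fixes F :: "'x \<Rightarrow> real"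
  assumes F: "F \<in> borel_measurable \<mu>" and int: "integrable \<nu> F"
  shows "\<zeta> * (\<integral>y. indicator Y0 y *\<^sub>R F y \<partial>\<mu>) = (\<integral>y. F y \<partial>\<nu>)"
proof -
  have "Y0 \<in> sets \<mu>" using Y0 prob_measuresD(3)[OF spread_prob[OF \<nu>] Y_borel] by auto
  then have meas: "(\<lambda>y. indicator Y0 y *\<^sub>R F y) \<in> borel_measurable \<mu>" using F by measurable
  have "(\<integral>y. indicator Y0 y *\<^sub>R F y \<partial>\<mu>) = (\<integral>p. indicator Y0 (spread_map p) *\<^sub>R F (spread_map p) \<partial>\<Theta>)"
    by (rule integral_\<mu>(1)[OF meas])
  also have "\<dots> = (\<integral>p. F (fst p) * indicator {0} (snd p) \<partial>\<Theta>)"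
  proof (rule Bochner_Integration.integral_cong[OF refl])
    fix p assume "p \<in> space \<Theta>"
    then obtain y s where p: "p = (y, s)" "y \<in> Y0" "s \<in> S" by (auto simp: space_pair_measure space_\<nu>)
    have "act s y \<in> Y0 \<longleftrightarrow> s = 0"
      using translate_cases(1)[of y "act s y" s 0] p(2) by auto
    then show "indicator Y0 (spread_map p) *\<^sub>R F (spread_map p) = F (fst p) * indicator {0} (snd p)"
      by (auto simp: p(1) indicator_def)
  qed
  also have "\<dots> = (\<integral>y. (\<integral>s. F y * indicator {0} s \<partial>weights) \<partial>\<nu>)"
  proof -
    have "integrable \<Theta> (\<lambda>p. F (fst p))" using fst_\<Theta>(2)[OF measurable_\<mu>_\<nu>[OF F]] int by blast
    moreover have "(\<lambda>p. F (fst p) * indicator {0} (snd p)) \<in> borel_measurable \<Theta>"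
    proof (intro borel_measurable_times)
      show "(\<lambda>p. F (fst p)) \<in> borel_measurable \<Theta>" by (rule measurable_compose[OF measurable_fst measurable_\<mu>_\<nu>[OF F]])
      show "(\<lambda>p. indicator {0} (snd p) :: real) \<in> borel_measurable \<Theta>"
        by (rule measurable_compose[OF measurable_snd]) (auto simp: measurable_def weights_def)
    qed
    ultimately have "integrable \<Theta> (\<lambda>p. F (fst p) * indicator {0} (snd p))"
      by (rule Bochner_Integration.integrable_bound) (auto simp: indicator_def)
    from VW.integral_fst'[OF this] show ?thesis by simp
  qed
  also have "\<dots> = (\<integral>y. F y * inverse \<zeta> \<partial>\<nu>)"
  proof -
    have "emeasure weights {0} = ennreal (inverse \<zeta>)"
      unfolding weights_def using zero_S
      by (subst emeasure_density) (auto simp: nn_integral_cmult_indicator wt_def N_0 divide_inverse nn_integral_count_space_indicator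
        intro!: trans[OF nn_integral_count_space'[of "{0}"]])
    then have "(\<integral>s. indicator {0} s \<partial>weights) = inverse \<zeta>"
      using zero_S zeta_pos by (simp add: measure_def)
    then show ?thesis by simp
  qed
  finally show ?thesis using zeta_pos by simp
qed

text \<open>The invariant representative does not depend on the fibre coordinate, so its integral
  over the product reduces to one against \<open>\<nu>\<close>.\<close>

lemma invariant_norm:
  assumes f: "f \<in> invariant_L2 act Y0 S \<mu>"
  shows "(L2_norm \<mu> f)\<^sup>2 = \<zeta> * (LINT y:Y0|\<mu>. (cmod (f y))\<^sup>2)"
proof -
  obtain f' where f': "f' \<in> borel_measurable \<mu>" "AE x in \<mu>. f x = f' x" "\<And>y s. y \<in> Y0 \<Longrightarrow> s \<in> S \<Longrightarrow> f' (act s y) = f' y"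
    and fL: "f \<in> borel_measurable \<mu>" "integrable \<mu> (\<lambda>x. (cmod (f x))\<^sup>2)"
    using f unfolding invariant_L2_def L2_functions_def by blast
  let ?F = "\<lambda>x. (cmod (f' x))\<^sup>2"
  have Fm: "?F \<in> borel_measurable \<mu>" using f'(1) by measurable
  have AEsq: "AE x in \<mu>. (cmod (f x))\<^sup>2 = ?F x" using f'(2) by eventually_elim simp
  have intF: "integrable \<mu> ?F"
    using fL AEsq Fm by (subst integrable_cong_AE[symmetric, where f = "\<lambda>x. (cmod (f x))\<^sup>2"]) auto
  have spread: "?F (spread_map p) = ?F (fst p)" if "p \<in> space \<Theta>" for p
    using that f'(3) by (auto simp: space_pair_measure space_\<nu>)
  have int\<nu>: "integrable \<nu> ?F"
  proof -
    have "integrable \<Theta> (\<lambda>p. ?F (spread_map p))" using intF integral_\<mu>(2)[OF Fm] by blast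
    then have "integrable \<Theta> (\<lambda>p. ?F (fst p))"
      by (subst Bochner_Integration.integrable_cong[OF refl spread[symmetric]]) auto
    then show ?thesis using fst_\<Theta>(2)[OF measurable_\<mu>_\<nu>[OF Fm]] by blast
  qed
  have "(L2_norm \<mu> f)\<^sup>2 = (\<integral>x. (cmod (f x))\<^sup>2 \<partial>\<mu>)"
    unfolding L2_norm_def by (simp add: integral_nonneg_AE)
  also have "\<dots> = (\<integral>x. ?F x \<partial>\<mu>)" by (rule integral_cong_AE) (use fL Fm AEsq in auto)
  also have "\<dots> = (\<integral>p. ?F (spread_map p) \<partial>\<Theta>)" by (rule integral_\<mu>(1)[OF Fm])
  also have "\<dots> = (\<integral>p. ?F (fst p) \<partial>\<Theta>)" by (rule Bochner_Integration.integral_cong[OF refl spread])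
  also have "\<dots> = (\<integral>y. ?F y \<partial>\<nu>)" by (rule fst_\<Theta>(1)[OF measurable_\<mu>_\<nu>[OF Fm]])
  also have "\<dots> = \<zeta> * (\<integral>y. indicator Y0 y *\<^sub>R ?F y \<partial>\<mu>)" by (rule set_integral_Y0[OF Fm int\<nu>, symmetric])
  also have "(\<integral>y. indicator Y0 y *\<^sub>R ?F y \<partial>\<mu>) = (LINT y:Y0|\<mu>. (cmod (f y))\<^sup>2)"
    unfolding set_lebesgue_integral_def
  proof (rule integral_cong_AE)
    have "Y0 \<in> sets \<mu>" using Y0 prob_measuresD(3)[OF spread_prob[OF \<nu>] Y_borel] by auto
    then show "(\<lambda>y. indicator Y0 y *\<^sub>R ?F y) \<in> borel_measurable \<mu>"
      "(\<lambda>y. indicat_real Y0 y *\<^sub>R (cmod (f y))\<^sup>2) \<in> borel_measurable \<mu>"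
      using Fm fL(1) by measurable
    show "AE y in \<mu>. indicat_real Y0 y *\<^sub>R ?F y = indicat_real Y0 y *\<^sub>R (cmod (f y))\<^sup>2"
      using AEsq by eventually_elim simp
  qed
  finally show ?thesis .
qed

section \<open>The orthogonal projection as averaging over fibres\<close>

definition fibre_mean :: "('x \<Rightarrow> complex) \<Rightarrow> 'x \<Rightarrow> complex" where
  "fibre_mean f y = (\<integral>s. f (act s y) \<partial>weights)"

text \<open>Off the translates the index defaults to 0. Such points are not in \<open>Y0\<close>,
  because 0 lies in \<open>S\<close>, so \<open>proj\<close> vanishes there.\<close>

definition fibre_index :: "'x \<Rightarrow> 'g" where
  "fibre_index x = (if \<exists>s\<in>S. x \<in> act s ` Y0 then (THE s. s \<in> S \<and> x \<in> act s ` Y0) else 0)"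

definition proj :: "('x \<Rightarrow> complex) \<Rightarrow> 'x \<Rightarrow> complex" where
  "proj f x = (if act (- fibre_index x) x \<in> Y0 then fibre_mean f (act (- fibre_index x) x) else 0)"

lemma fibre_index: "y \<in> Y0 \<Longrightarrow> s \<in> S \<Longrightarrow> fibre_index (act s y) = s"
proof -
  assume y: "y \<in> Y0" and s: "s \<in> S"
  have "(THE t. t \<in> S \<and> act s y \<in> act t ` Y0) = s"
    by (rule the_equality) (use y s translate_cases(1) in auto)
  then show ?thesis unfolding fibre_index_def using y s by auto
qed

lemma proj_act: "y \<in> Y0 \<Longrightarrow> s \<in> S \<Longrightarrow> proj f (act s y) = fibre_mean f y"
  by (simp add: proj_def fibre_index)

lemma fibre_index_measurable: "fibre_index \<in> borel \<rightarrow>\<^sub>M count_space UNIV"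
proof (subst measurable_count_space_eq2_countable, intro conjI ballI)
  fix t :: 'g
  let ?T = "\<Union>s\<in>S. act s ` Y0"
  have T: "?T \<in> sets borel" by (rule sets.countable_UN'') (auto intro: act_image_borel Y0)
  have "fibre_index -` {t} = (if t \<in> S then act t ` Y0 else {}) \<union> (if t = 0 then - ?T else {})"
  proof (intro equalityI subsetI)
    fix x assume x: "x \<in> fibre_index -` {t}"
    show "x \<in> (if t \<in> S then act t ` Y0 else {}) \<union> (if t = 0 then - ?T else {})"
    proof (cases "x \<in> ?T")
      case True
      then obtain s y where "s \<in> S" "y \<in> Y0" "x = act s y" by blast
      then show ?thesis using x fibre_index by auto
    next
      case False
      then have "fibre_index x = 0" by (auto simp: fibre_index_def)
      then show ?thesis using x False by auto
    qed
  next
    fix x assume "x \<in> (if t \<in> S then act t ` Y0 else {}) \<union> (if t = 0 then - ?T else {})"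
    then consider "t \<in> S" "x \<in> act t ` Y0" | "t = 0" "x \<notin> ?T" by (auto split: if_splits)
    then show "x \<in> fibre_index -` {t}"
    proof cases
      case 1
      then show ?thesis using fibre_index by auto
    next
      case 2
      then show ?thesis by (auto simp: fibre_index_def)
    qed
  qed
  moreover have "(if t \<in> S then act t ` Y0 else {}) \<union> (if t = 0 then - ?T else {}) \<in> sets borel"
  proof -
    have if_sets: "(if P then B else {}) \<in> sets borel" if "B \<in> sets borel" for B :: "'x set" and P
      using that by simp
    show ?thesis
      by (rule sets.Un[OF if_sets[OF act_image_borel[OF Y0(3)]] if_sets[OF borel_comp[OF T]]])
  qed
  ultimately show "fibre_index -` {t} \<inter> space borel \<in> sets borel" by simp
qed auto

lemma fibre_mean_measurable:
  assumes f: "f \<in> borel_measurable \<mu>" shows "fibre_mean f \<in> borel_measurable \<nu>"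
proof -
  have "(\<lambda>(y, s). f (act s y)) \<in> borel_measurable \<Theta>"
    using measurable_comp[OF f] by (simp add: spread_map_def case_prod_unfold)
  then show ?thesis unfolding fibre_mean_def[abs_def] by (rule W.borel_measurable_lebesgue_integral)
qed

text \<open>The index takes countably many values, and for each fixed index the expression is a
  measurable function of the point.\<close>

lemma proj_measurable:
  assumes f: "f \<in> borel_measurable \<mu>" shows "proj f \<in> borel_measurable \<mu>"
proof -
  let ?c = "\<lambda>y. if y \<in> Y0 then fibre_mean f y else 0"
  have "fibre_mean f \<in> borel_measurable (restrict_space borel Y0)"
    using fibre_mean_measurable[OF f] measurable_cong_sets[OF prob_measuresD(5)[OF \<nu> Y0(3)] refl] by blast
  then have c: "?c \<in> borel_measurable borel"
    by (subst (asm) measurable_restrict_space_iff) auto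
  have "(\<lambda>x. ?c (act (- fibre_index x) x)) \<in> borel_measurable borel"
  proof (rule measurable_compose_countable[where f = "\<lambda>t x. ?c (act (- t) x)" and g = fibre_index, OF _ fibre_index_measurable])
    show "(\<lambda>x. ?c (act (- t) x)) \<in> borel_measurable borel" for t
      by (rule measurable_compose[OF act_measurable c])
  qed
  then have "proj f \<in> borel_measurable borel" by (simp add: proj_def[abs_def])
  then show ?thesis by (rule prob_measuresD(4)[OF spread_prob[OF \<nu>] Y_borel])
qed

text \<open>Fubini puts almost every fibre in the square-integrable setting, where the mean is
  controlled by the mean square.\<close>

lemma L2_fibres:
  assumes f: "f \<in> L2_functions \<mu>"
  shows "AE y in \<nu>. integrable weights (\<lambda>s. f (act s y)) \<and> (cmod (fibre_mean f y))\<^sup>2 \<le> (\<integral>s. (cmod (f (act s y)))\<^sup>2 \<partial>weights)"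
    "integrable \<nu> (\<lambda>y. \<integral>s. (cmod (f (act s y)))\<^sup>2 \<partial>weights)"
proof -
  have fm: "f \<in> borel_measurable \<mu>" and int: "integrable \<mu> (\<lambda>x. (cmod (f x))\<^sup>2)"
    using f by (auto simp: L2_functions_def)
  have sqm: "(\<lambda>x. (cmod (f x))\<^sup>2) \<in> borel_measurable \<mu>" using fm by measurable
  have I: "integrable \<Theta> (\<lambda>p. (cmod (f (spread_map p)))\<^sup>2)" using int integral_\<mu>(2)[OF sqm] by blast
  show "integrable \<nu> (\<lambda>y. \<integral>s. (cmod (f (act s y)))\<^sup>2 \<partial>weights)"
    using VW.integrable_fst'[OF I] by simp
  have "AE y in \<nu>. integrable weights (\<lambda>s. (cmod (f (act s y)))\<^sup>2)"
    using VW.AE_integrable_fst'[OF I] by simp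
  then show "AE y in \<nu>. integrable weights (\<lambda>s. f (act s y)) \<and> (cmod (fibre_mean f y))\<^sup>2 \<le> (\<integral>s. (cmod (f (act s y)))\<^sup>2 \<partial>weights)"
  proof eventually_elim
    case (elim y)
    have "(\<lambda>s. f (act s y)) \<in> borel_measurable weights" by (simp add: measurable_def weights_def)
    from W.square_integral_le[OF this elim] show ?case unfolding fibre_mean_def by blast
  qed
qed

lemma proj_invariant:
  assumes f: "f \<in> L2_functions \<mu>" shows "proj f \<in> invariant_L2 act Y0 S \<mu>"
proof -
  have fm: "f \<in> borel_measurable \<mu>" using f by (auto simp: L2_functions_def)
  note pm = proj_measurable[OF fm] and cm = fibre_mean_measurable[OF fm]
  have sqm: "(\<lambda>x. (cmod (proj f x))\<^sup>2) \<in> borel_measurable \<mu>" using pm by measurable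
  have csq: "(\<lambda>y. (cmod (fibre_mean f y))\<^sup>2) \<in> borel_measurable \<nu>" using cm by measurable
  have "integrable \<nu> (\<lambda>y. (cmod (fibre_mean f y))\<^sup>2)"
  proof (rule Bochner_Integration.integrable_bound[OF L2_fibres(2)[OF f] csq])
    show "AE y in \<nu>. norm ((cmod (fibre_mean f y))\<^sup>2) \<le> norm (\<integral>s. (cmod (f (act s y)))\<^sup>2 \<partial>weights)"
      using L2_fibres(1)[OF f] by eventually_elim (auto intro: order_trans)
  qed
  then have "integrable \<Theta> (\<lambda>p. (cmod (fibre_mean f (fst p)))\<^sup>2)" using fst_\<Theta>(2)[OF csq] by blast
  then have "integrable \<Theta> (\<lambda>p. (cmod (proj f (spread_map p)))\<^sup>2)"
    by (rule Bochner_Integration.integrable_cong[THEN iffD1, OF refl, rotated])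
      (auto simp: space_pair_measure space_\<nu> proj_act)
  then have "integrable \<mu> (\<lambda>x. (cmod (proj f x))\<^sup>2)" using integral_\<mu>(2)[OF sqm] by blast
  then have "proj f \<in> L2_functions \<mu>" using pm by (simp add: L2_functions_def)
  moreover have "proj f (act s y) = proj f y" if "y \<in> Y0" "s \<in> S" for y s
    using proj_act[OF that] proj_act[OF that(1) zero_S] by simp
  ultimately show ?thesis unfolding invariant_L2_def using pm by blast
qed

lemma invariant_L2_sub: "f \<in> invariant_L2 act Y0 S \<mu> \<Longrightarrow> f \<in> L2_functions \<mu>"
  by (simp add: invariant_L2_def)

text \<open>Along a fibre \<open>h'\<close> is constant and \<open>f\<close> minus its mean
  integrates to 0.\<close>

lemma proj_orthogonal:
  assumes f: "f \<in> L2_functions \<mu>" and h: "h \<in> invariant_L2 act Y0 S \<mu>"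
  shows "L2_inner \<mu> (\<lambda>x. f x - proj f x) h = 0"
proof -
  obtain h' where h': "h' \<in> borel_measurable \<mu>" "AE x in \<mu>. h x = h' x" "\<And>y s. y \<in> Y0 \<Longrightarrow> s \<in> S \<Longrightarrow> h' (act s y) = h' y"
    using h unfolding invariant_L2_def by blast
  have D: "(\<lambda>x. f x - proj f x) \<in> L2_functions \<mu>"
    by (rule L2_diff[OF f invariant_L2_sub[OF proj_invariant[OF f]]])
  have I: "integrable \<mu> (\<lambda>x. (f x - proj f x) * cnj (h x))"
    by (rule L2_product_integrable[OF D invariant_L2_sub[OF h]])
  have cnjm: "(\<lambda>x. cnj (h' x)) \<in> borel_measurable \<mu>"
    using h'(1) borel_measurable_continuous_onI[of cnj] by (rule measurable_compose) (auto intro: continuous_intros)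
  have Fm: "(\<lambda>x. (f x - proj f x) * cnj (h' x)) \<in> borel_measurable \<mu>"
    using D cnjm by (intro borel_measurable_times) (auto simp: L2_functions_def)
  have AE: "AE x in \<mu>. (f x - proj f x) * cnj (h x) = (f x - proj f x) * cnj (h' x)"
    using h'(2) by eventually_elim simp
  have I': "integrable \<mu> (\<lambda>x. (f x - proj f x) * cnj (h' x))"
    using integrable_cong_AE[OF borel_measurable_integrable[OF I] Fm AE] I by blast
  then have I\<Theta>: "integrable \<Theta> (\<lambda>p. (f (spread_map p) - proj f (spread_map p)) * cnj (h' (spread_map p)))"
    using integral_\<mu>(2)[OF Fm] by blast
  have "L2_inner \<mu> (\<lambda>x. f x - proj f x) h = (\<integral>x. (f x - proj f x) * cnj (h' x) \<partial>\<mu>)"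
    unfolding L2_inner_def by (rule integral_cong_AE[OF borel_measurable_integrable[OF I] Fm AE])
  also have "\<dots> = (\<integral>p. (f (spread_map p) - proj f (spread_map p)) * cnj (h' (spread_map p)) \<partial>\<Theta>)"
    by (rule integral_\<mu>(1)[OF Fm])
  also have "\<dots> = (\<integral>y. (\<integral>s. (f (act s y) - proj f (act s y)) * cnj (h' (act s y)) \<partial>weights) \<partial>\<nu>)"
    using VW.integral_fst'[OF I\<Theta>] by simp
  also have "\<dots> = 0"
  proof (rule integral_eq_zero_AE)
    show "AE y in \<nu>. (\<integral>s. (f (act s y) - proj f (act s y)) * cnj (h' (act s y)) \<partial>weights) = 0"
      using L2_fibres(1)[OF f] AE_space
    proof eventually_elim
      case (elim y)
      then have y: "y \<in> Y0" and int: "integrable weights (\<lambda>s. f (act s y))" by (auto simp: space_\<nu>)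
      have "(\<integral>s. (f (act s y) - proj f (act s y)) * cnj (h' (act s y)) \<partial>weights)
          = (\<integral>s. (f (act s y) - fibre_mean f y) * cnj (h' y) \<partial>weights)"
        by (rule Bochner_Integration.integral_cong[OF refl]) (use y h'(3) proj_act in auto)
      also have "\<dots> = (\<integral>s. f (act s y) - fibre_mean f y \<partial>weights) * cnj (h' y)"
        by (rule integral_mult_left_zero)
      also have "(\<integral>s. f (act s y) - fibre_mean f y \<partial>weights) = fibre_mean f y - fibre_mean f y"
        using int W.prob_space by (subst Bochner_Integration.integral_diff) (auto simp: fibre_mean_def)
      finally show ?case by simp
    qed
  qed
  finally show ?thesis .
qed

lemma proj_is_projection: "is_orthogonal_projection \<mu> (invariant_L2 act Y0 S \<mu>) proj"
  unfolding is_orthogonal_projection_def using proj_invariant proj_orthogonal by blast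

lemma invariant_L2_diff:
  assumes f: "f \<in> invariant_L2 act Y0 S \<mu>" and g: "g \<in> invariant_L2 act Y0 S \<mu>"
  shows "(\<lambda>x. f x - g x) \<in> invariant_L2 act Y0 S \<mu>"
proof -
  obtain f' where f': "f' \<in> borel_measurable \<mu>" "AE x in \<mu>. f x = f' x" "\<And>y s. y \<in> Y0 \<Longrightarrow> s \<in> S \<Longrightarrow> f' (act s y) = f' y"
    using f unfolding invariant_L2_def by blast
  obtain g' where g': "g' \<in> borel_measurable \<mu>" "AE x in \<mu>. g x = g' x" "\<And>y s. y \<in> Y0 \<Longrightarrow> s \<in> S \<Longrightarrow> g' (act s y) = g' y"
    using g unfolding invariant_L2_def by blast
  have "(\<lambda>x. f' x - g' x) \<in> borel_measurable \<mu>" using f'(1) g'(1) by measurable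
  moreover have "AE x in \<mu>. f x - g x = f' x - g' x" using f'(2) g'(2) by eventually_elim simp
  ultimately show ?thesis
    using L2_diff[OF invariant_L2_sub[OF f] invariant_L2_sub[OF g]] f'(3) g'(3)
    unfolding invariant_L2_def by (intro CollectI conjI bexI[of _ "\<lambda>x. f' x - g' x"]) auto
qed

text \<open>The difference of two projections of \<open>f\<close> is invariant, hence orthogonal to
  itself. This carries the formula from \<open>proj\<close> to any representative
  \<open>P\<close>.\<close>

lemma projection_unique:
  assumes P: "is_orthogonal_projection \<mu> (invariant_L2 act Y0 S \<mu>) P" and f: "f \<in> L2_functions \<mu>"
  shows "AE x in \<mu>. P f x = proj f x"
proof -
  have PH: "P f \<in> invariant_L2 act Y0 S \<mu>" and Po: "\<And>h. h \<in> invariant_L2 act Y0 S \<mu> \<Longrightarrow> L2_inner \<mu> (\<lambda>x. f x - P f x) h = 0"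
    using P f unfolding is_orthogonal_projection_def by blast+
  let ?d = "\<lambda>x. P f x - proj f x"
  have d: "?d \<in> invariant_L2 act Y0 S \<mu>" by (rule invariant_L2_diff[OF PH proj_invariant[OF f]])
  note dL = invariant_L2_sub[OF d]
  have I1: "integrable \<mu> (\<lambda>x. (f x - proj f x) * cnj (?d x))"
    by (intro L2_product_integrable L2_diff f invariant_L2_sub[OF proj_invariant[OF f]] dL)
  have I2: "integrable \<mu> (\<lambda>x. (f x - P f x) * cnj (?d x))"
    by (intro L2_product_integrable L2_diff f invariant_L2_sub[OF PH] dL)
  have "(\<integral>x. of_real ((cmod (?d x))\<^sup>2) \<partial>\<mu>) = (\<integral>x. (f x - proj f x) * cnj (?d x) - (f x - P f x) * cnj (?d x) \<partial>\<mu>)"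
    by (rule Bochner_Integration.integral_cong[OF refl]) (simp add: complex_norm_square algebra_simps del: of_real_power)
  also have "\<dots> = L2_inner \<mu> (\<lambda>x. f x - proj f x) ?d - L2_inner \<mu> (\<lambda>x. f x - P f x) ?d"
    unfolding L2_inner_def by (rule Bochner_Integration.integral_diff[OF I1 I2])
  also have "\<dots> = 0" using proj_orthogonal[OF f d] Po[OF d] by simp
  finally have "complex_of_real (\<integral>x. (cmod (?d x))\<^sup>2 \<partial>\<mu>) = 0" by (simp only: integral_complex_of_real)
  then have "(\<integral>x. (cmod (?d x))\<^sup>2 \<partial>\<mu>) = 0" by (simp only: of_real_eq_0_iff)
  moreover have "integrable \<mu> (\<lambda>x. (cmod (?d x))\<^sup>2)" using dL by (simp add: L2_functions_def)
  ultimately have "AE x in \<mu>. (cmod (?d x))\<^sup>2 = 0" by (subst (asm) integral_nonneg_eq_0_iff_AE) auto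
  then show ?thesis by eventually_elim simp
qed

lemma projection_formula:
  assumes P: "is_orthogonal_projection \<mu> (invariant_L2 act Y0 S \<mu>) P" and f: "f \<in> L2_functions \<mu>"
  shows "AE y in \<mu>. y \<in> Y0 \<longrightarrow>
    (\<lambda>s. of_real (N s powr - \<beta>) * f (act s y)) summable_on S \<and>
    (\<forall>r\<in>S. P f (act r y) = of_real (inverse \<zeta>) * (\<Sum>\<^sub>\<infinity>s\<in>S. of_real (N s powr - \<beta>) * f (act s y)))"
proof (rule AE_\<nu>_imp_AE_\<mu>)
  show "AE y in \<nu>. (\<lambda>s. of_real (N s powr - \<beta>) * f (act s y)) summable_on S \<and>
    (\<forall>r\<in>S. P f (act r y) = of_real (inverse \<zeta>) * (\<Sum>\<^sub>\<infinity>s\<in>S. of_real (N s powr - \<beta>) * f (act s y)))"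
    using L2_fibres(1)[OF f] AE_\<mu>_D[OF projection_unique[OF P f]] AE_space
  proof eventually_elim
    case (elim y)
    then have y: "y \<in> Y0" and int: "integrable weights (\<lambda>s. f (act s y))"
      and eq: "\<And>r. r \<in> S \<Longrightarrow> P f (act r y) = proj f (act r y)" by (auto simp: space_\<nu>)
    show ?case
      using weights_integral[OF int] eq proj_act[OF y] by (simp add: fibre_mean_def)
  qed
qed

end

section \<open>The correspondence between states and measures\<close>

context partial_action
begin

text \<open>The mixture is obtained by choosing between the two measures with a Bernoulli
  variable.\<close>

lemma convex_combination_measure:
  assumes \<mu>1: "\<mu>1 \<in> prob_measures Y" and \<mu>2: "\<mu>2 \<in> prob_measures Y" and t: "0 \<le> t" "t \<le> 1"
  obtains \<mu> where "\<mu> \<in> prob_measures Y"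
    "\<And>B. B \<in> sets borel \<Longrightarrow> B \<subseteq> Y \<Longrightarrow> emeasure \<mu> B = ennreal t * emeasure \<mu>1 B + ennreal (1 - t) * emeasure \<mu>2 B"
    "measure_state act Y \<mu> = (\<lambda>a. of_real t * measure_state act Y \<mu>1 a + of_real (1 - t) * measure_state act Y \<mu>2 a)"
proof -
  let ?N = "restrict_space borel Y" and ?P = "measure_pmf (bernoulli_pmf t)"
  define K where "K b = (if b then \<mu>1 else \<mu>2)" for b
  define \<mu> where "\<mu> = ?P \<bind> K"
  have Kp: "K b \<in> prob_measures Y" for b using \<mu>1 \<mu>2 by (simp add: K_def)
  note Kd = prob_measuresD[OF Kp Y_borel]
  have K: "K \<in> ?P \<rightarrow>\<^sub>M subprob_algebra ?N"
    using Kd(1,5) by (auto simp: measurable_def space_subprob_algebra intro: prob_space_imp_subprob_space)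
  have sets: "sets \<mu> = sets ?N" unfolding \<mu>_def by (rule sets_bind[OF Kd(5)]) simp
  have em: "emeasure \<mu> B = ennreal t * emeasure \<mu>1 B + ennreal (1 - t) * emeasure \<mu>2 B"
    if "B \<in> sets borel" "B \<subseteq> Y" for B
  proof -
    have "emeasure \<mu> B = (\<integral>\<^sup>+b. emeasure (K b) B \<partial>?P)"
      unfolding \<mu>_def by (rule emeasure_bind[OF _ K]) (use that in \<open>auto simp: sets_restrict_borel\<close>)
    then show ?thesis using t by (simp add: K_def mult.commute)
  qed
  have sp: "space \<mu> = Y" using sets_eq_imp_space_eq[OF sets] by (simp add: space_restrict_space)
  have "emeasure \<mu> (space \<mu>) = 1"
    unfolding sp em[OF Y_borel order_refl]
    using prob_space.emeasure_space_1[OF prob_measuresD(1)[OF \<mu>1 Y_borel]]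
      prob_space.emeasure_space_1[OF prob_measuresD(1)[OF \<mu>2 Y_borel]] t
    by (simp add: prob_measuresD(2)[OF \<mu>1 Y_borel] prob_measuresD(2)[OF \<mu>2 Y_borel] flip: ennreal_plus)
  then have p: "\<mu> \<in> prob_measures Y" using sets by (simp add: prob_measures_def prob_spaceI)
  \<comment> \<open>\<open>integral_bind\<close> treats bounded real integrands;
    \<open>cond_exp a\<close> is then handled through its real and imaginary parts.\<close>
  have real: "(\<integral>x. f x \<partial>\<mu>) = t * (\<integral>x. f x \<partial>\<mu>1) + (1 - t) * (\<integral>x. f x \<partial>\<mu>2)"
    if f: "f \<in> borel_measurable ?N" "\<And>x. \<bar>f x\<bar> \<le> C" for f :: "'x \<Rightarrow> real" and C
  proof -
    have "(\<integral>x. f x \<partial>\<mu>) = (\<integral>b. (\<integral>x. f x \<partial>K b) \<partial>?P)"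
      unfolding \<mu>_def
    proof (rule integral_bind[OF f(1) f(2) K])
      show "finite_measure ?P" by unfold_locales simp
      show "AE b in ?P. emeasure (K b) (space (K b)) \<le> ennreal 1"
        using prob_space.emeasure_space_1[OF Kd(1)] by simp
    qed
    then show ?thesis using t by (simp add: K_def mult.commute)
  qed
  have "measure_state act Y \<mu> a = of_real t * measure_state act Y \<mu>1 a + of_real (1 - t) * measure_state act Y \<mu>2 a" for a
  proof (cases "a \<in> A")
    case True
    have m: "cond_exp a \<in> borel_measurable borel"
      by (rule C0_borel[OF cond_exp_C0[OF True]])
    have "(\<lambda>x. Re (cond_exp a x)) \<in> borel_measurable ?N" "(\<lambda>x. Im (cond_exp a x)) \<in> borel_measurable ?N"
      using m by (auto intro: measurable_restrict_space1)
    note r = real[OF this(1), of "norm a"] real[OF this(2), of "norm a"]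
    have b: "\<bar>Re (cond_exp a x)\<bar> \<le> norm a" "\<bar>Im (cond_exp a x)\<bar> \<le> norm a" for x
      by (rule order_trans[OF abs_Re_le_cmod cond_exp_le], rule order_trans[OF abs_Im_le_cmod cond_exp_le])
    note i = cond_exp_integrable[OF p True] cond_exp_integrable[OF \<mu>1 True] cond_exp_integrable[OF \<mu>2 True]
    have "(\<integral>x. cond_exp a x \<partial>\<mu>) = of_real t * (\<integral>x. cond_exp a x \<partial>\<mu>1) + of_real (1 - t) * (\<integral>x. cond_exp a x \<partial>\<mu>2)"
      using r(1)[OF b(1)] r(2)[OF b(2)] i by (simp add: complex_eq_iff)
    then show ?thesis using True by (simp add: measure_state_def)
  qed (simp add: measure_state_def)
  then show ?thesis using that[OF p em] by blast
qed

lemma scaling_convex_combination: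
  assumes "scaling \<beta> \<mu>1" "scaling \<beta> \<mu>2" "\<mu> \<in> prob_measures Y"
    and em: "\<And>B. B \<in> sets borel \<Longrightarrow> B \<subseteq> Y \<Longrightarrow> emeasure \<mu> B = a * emeasure \<mu>1 B + b * emeasure \<mu>2 B"
  shows "scaling \<beta> \<mu>"
  unfolding scaling_def
proof (intro conjI allI impI)
  show "emeasure \<mu> (act g ` B) = ennreal (N g powr - \<beta>) * emeasure \<mu> B"
    if B: "B \<in> sets borel" "B \<subseteq> Y" "act g ` B \<subseteq> Y" for g B
  proof -
    have "emeasure \<mu>1 (act g ` B) = ennreal (N g powr - \<beta>) * emeasure \<mu>1 B"
      "emeasure \<mu>2 (act g ` B) = ennreal (N g powr - \<beta>) * emeasure \<mu>2 B"
      using assms(1,2) B unfolding scaling_def by blast+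
    then show ?thesis
      by (simp add: em[OF B(1,2)] em[OF act_image_borel[OF B(1)] B(3)] distrib_left mult.left_commute)
  qed
qed (rule assms)

lemma state_measure_eq:
  "\<mu> \<in> prob_measures Y \<Longrightarrow> state_measure act Y (measure_state act Y \<mu>) = \<mu>"
  unfolding state_measure_def by (rule the_equality) (auto intro: measure_state_inj)

end

lemma (in wandering) restricted_measure_eq:
  "\<mu> \<in> prob_measures Y \<Longrightarrow> restricted_measure act Y Y0 N S \<beta> (measure_state act Y \<mu>) = restrict_Y0 \<mu>"
  by (simp add: restricted_measure_def restrict_Y0_def state_measure_eq)

theorem proposition1p2:
  fixes act :: "'g::{group_add, countable} \<Rightarrow> 'x::{second_countable_topology, t2_space} \<Rightarrow> 'x"
    and Y Y0 :: "'x set" and N :: "'g \<Rightarrow> real" and \<beta> :: real and S :: "'g set"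
    and Yn :: "nat \<Rightarrow> 'x set" and gn :: "nat \<Rightarrow> 'g"
  assumes X: "locally compact (UNIV :: 'x set)"
    and action: "continuous_action act"
    and Y: "open Y" "closed Y" "(\<Union>g. act g ` Y) = UNIV"
    and N: "\<And>g. 0 < N g" "\<And>g h. N (g + h) = N g * N h"
    and Yn: "\<And>n. Yn n \<in> sets borel" "\<And>n. Yn n \<subseteq> Y"
      "{x \<in> Y. \<exists>g. g \<noteq> 0 \<and> act g x = x} \<subseteq> (\<Union>n. Yn n)"
    and gn: "\<And>n. N (gn n) \<noteq> 1" "\<And>n. act (gn n) ` Yn n = Yn n"
    and \<beta>: "\<beta> \<noteq> 0"
    and Y0: "Y0 \<subseteq> Y" "Y0 \<noteq> {}" "Y0 \<in> sets borel"
    and i: "\<And>g. g \<noteq> 0 \<Longrightarrow> act g ` Y0 \<inter> Y0 = {}"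
    and ii: "(\<Union>s\<in>S. act s ` Y0) \<subseteq> Y"
    and iii: "\<And>g. act g ` Y0 \<inter> Y \<noteq> {} \<Longrightarrow> g \<in> S"
    and iv: "\<And>U. open U \<Longrightarrow> Y0 \<subseteq> U \<Longrightarrow> Y - (\<Union>s\<in>S. act s ` U) \<subseteq> (\<Union>n. Yn n)"
    and v: "(\<lambda>s. N s powr - \<beta>) summable_on S"
  shows
    \<comment> \<open>(1)\<close>
    "(\<forall>\<phi> \<in> KMS_states act Y N \<beta>. \<exists>!\<mu>. \<mu> \<in> prob_measures Y \<and> \<phi> = measure_state act Y \<mu>) \<and>
     bij_betw (restricted_measure act Y Y0 N S \<beta>) (KMS_states act Y N \<beta>) (prob_measures Y0) \<and>
     (\<forall>\<phi>\<^sub>1 \<in> KMS_states act Y N \<beta>. \<forall>\<phi>\<^sub>2 \<in> KMS_states act Y N \<beta>. \<forall>t \<in> {0..1}.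
        (\<lambda>a. of_real t * \<phi>\<^sub>1 a + of_real (1 - t) * \<phi>\<^sub>2 a) \<in> KMS_states act Y N \<beta> \<and>
        (\<forall>Z \<in> sets (restrict_space borel Y0).
           measure (restricted_measure act Y Y0 N S \<beta> (\<lambda>a. of_real t * \<phi>\<^sub>1 a + of_real (1 - t) * \<phi>\<^sub>2 a)) Z =
           t * measure (restricted_measure act Y Y0 N S \<beta> \<phi>\<^sub>1) Z + (1 - t) * measure (restricted_measure act Y Y0 N S \<beta> \<phi>\<^sub>2) Z)) \<and>
     (\<forall>\<nu> \<in> prob_measures Y0.
        induced_measure act Y Y0 N S \<beta> \<nu> \<in> prob_measures Y \<and>
        (\<forall>Z \<in> sets (restrict_space borel Y).
           emeasure (induced_measure act Y Y0 N S \<beta> \<nu>) Z =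
           ennreal (inverse (zeta N S \<beta>)) *
           (\<Sum>\<^sub>\<infinity>s\<in>S. ennreal (N s powr - \<beta>) * emeasure \<nu> (act (- s) ` Z \<inter> Y0))) \<and>
        induced_state act Y Y0 N S \<beta> \<nu> \<in> KMS_states act Y N \<beta> \<and> restricted_measure act Y Y0 N S \<beta> (induced_state act Y Y0 N S \<beta> \<nu>) = \<nu>) \<and>
     (\<forall>\<phi> \<in> KMS_states act Y N \<beta>. induced_state act Y Y0 N S \<beta> (restricted_measure act Y Y0 N S \<beta> \<phi>) = \<phi>) \<and>
    \<comment> \<open>(2)\<close>
     (\<forall>\<nu> \<in> prob_measures Y0. \<forall>\<mu>. \<mu> = induced_measure act Y Y0 N S \<beta> \<nu> \<longrightarrow>
        (\<forall>f \<in> invariant_L2 act Y0 S \<mu>.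
           (L2_norm \<mu> f)\<^sup>2 = zeta N S \<beta> * (LINT y:Y0|\<mu>. (cmod (f y))\<^sup>2)) \<and>
        (\<exists>P. is_orthogonal_projection \<mu> (invariant_L2 act Y0 S \<mu>) P) \<and>
        (\<forall>P. is_orthogonal_projection \<mu> (invariant_L2 act Y0 S \<mu>) P \<longrightarrow>
          (\<forall>f \<in> L2_functions \<mu>. AE y in \<mu>. y \<in> Y0 \<longrightarrow>
             (\<lambda>s. of_real (N s powr - \<beta>) * f (act s y)) summable_on S \<and>
             (\<forall>r\<in>S. P f (act r y) =
                of_real (inverse (zeta N S \<beta>)) *
                (\<Sum>\<^sub>\<infinity>s\<in>S. of_real (N s powr - \<beta>) * f (act s y))))))"
proof -
  interpret wandering act Y N \<beta> S Y0
    using X action Y(1,2) N Y0 i ii iii v by unfold_locales auto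
  let ?R = "restricted_measure act Y Y0 N S \<beta>" and ?I = "induced_state act Y Y0 N S \<beta>" and ?K = "KMS_states act Y N \<beta>"
  have K: "?K = measure_state act Y ` {\<mu>. scaling \<beta> \<mu>}"
    by (rule KMS_states_eq[OF \<beta> Yn gn])
  have p: "\<mu> \<in> prob_measures Y" if "scaling \<beta> \<mu>" for \<mu> using that by (simp add: scaling_def)
  \<comment> \<open>By (iv) the uncovered part of \<open>Y\<close> lies in the union of the
    \<open>Yn\<close>, each of which is null for a scaling measure.\<close>
  have cover: "emeasure \<mu> (Y - (\<Union>s\<in>S. act s ` U)) = 0"
    if \<mu>: "scaling \<beta> \<mu>" and U: "open U" "Y0 \<subseteq> U" for \<mu> U
  proof -
    have sets: "sets \<mu> = {B \<in> sets borel. B \<subseteq> Y}" by (rule prob_measuresD(3)[OF p[OF \<mu>] Y_borel])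
    have "emeasure \<mu> (Yn n) = 0" for n
      by (rule scaling_null[OF \<mu> \<beta> Yn(1,2) gn(2,1)])
    then have "emeasure \<mu> (\<Union>n. Yn n) = 0"
      by (subst emeasure_UN_eq_0) (use Yn(1,2) sets in auto)
    moreover have "(\<Union>n. Yn n) \<in> sets \<mu>" using Yn(1,2) sets by auto
    ultimately show ?thesis using emeasure_mono[OF iv[OF U], of \<mu>] by simp
  qed
  have R: "?R (measure_state act Y \<mu>) = restrict_Y0 \<mu>" if "scaling \<beta> \<mu>" for \<mu>
    by (rule restricted_measure_eq[OF p[OF that]])
  have I: "?I \<nu> = measure_state act Y (spread \<nu>)" if "\<nu> \<in> prob_measures Y0" for \<nu>
    by (simp add: induced_state_def induced_measure_eq[OF that])
  have unique: "\<exists>!\<mu>. \<mu> \<in> prob_measures Y \<and> \<phi> = measure_state act Y \<mu>" if "\<phi> \<in> ?K" for \<phi>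
    using that unfolding K by (auto intro: p measure_state_inj)
  have RI: "?I \<nu> \<in> ?K" "?R (?I \<nu>) = \<nu>" if \<nu>: "\<nu> \<in> prob_measures Y0" for \<nu>
    unfolding I[OF \<nu>] R[OF scaling_spread[OF \<nu>]] K
    using scaling_spread[OF \<nu>] restrict_spread[OF \<nu>] by auto
  have IR: "?R \<phi> \<in> prob_measures Y0" "?I (?R \<phi>) = \<phi>" if \<phi>: "\<phi> \<in> ?K" for \<phi>
  proof -
    obtain \<mu> where \<mu>: "scaling \<beta> \<mu>" "\<phi> = measure_state act Y \<mu>" using \<phi> unfolding K by blast
    note sr = spread_restrict[OF \<mu>(1) cover[OF \<mu>(1)]]
    show "?R \<phi> \<in> prob_measures Y0" using sr(1) by (simp add: \<mu>(2) R[OF \<mu>(1)])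
    show "?I (?R \<phi>) = \<phi>" using sr by (simp add: \<mu>(2) R[OF \<mu>(1)] I)
  qed
  have bij: "bij_betw ?R ?K (prob_measures Y0)"
    by (rule bij_betw_byWitness[where f' = ?I]) (use RI IR in auto)
  have affine: "(\<lambda>a. of_real t * \<phi>1 a + of_real (1 - t) * \<phi>2 a) \<in> ?K \<and>
      (\<forall>Z \<in> sets (restrict_space borel Y0).
         measure (?R (\<lambda>a. of_real t * \<phi>1 a + of_real (1 - t) * \<phi>2 a)) Z = t * measure (?R \<phi>1) Z + (1 - t) * measure (?R \<phi>2) Z)"
    if \<phi>: "\<phi>1 \<in> ?K" "\<phi>2 \<in> ?K" and t: "t \<in> {0..1}" for \<phi>1 \<phi>2 t
  proof -
    obtain \<mu>1 \<mu>2 where \<mu>: "scaling \<beta> \<mu>1" "\<phi>1 = measure_state act Y \<mu>1" "scaling \<beta> \<mu>2" "\<phi>2 = measure_state act Y \<mu>2"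
      using \<phi> unfolding K by blast
    \<comment> \<open>The mixture of the two measures is again scaling and represents the mixture of
      the states, so convexity and affinity follow together.\<close>
    obtain \<mu> where m: "\<mu> \<in> prob_measures Y"
      "\<And>B. B \<in> sets borel \<Longrightarrow> B \<subseteq> Y \<Longrightarrow> emeasure \<mu> B = ennreal t * emeasure \<mu>1 B + ennreal (1 - t) * emeasure \<mu>2 B"
      "measure_state act Y \<mu> = (\<lambda>a. of_real t * measure_state act Y \<mu>1 a + of_real (1 - t) * measure_state act Y \<mu>2 a)"
      using convex_combination_measure[OF p[OF \<mu>(1)] p[OF \<mu>(3)], of t] t by auto
    have s: "scaling \<beta> \<mu>" by (rule scaling_convex_combination[OF \<mu>(1,3) m(1,2)])
    have eq: "(\<lambda>a. of_real t * \<phi>1 a + of_real (1 - t) * \<phi>2 a) = measure_state act Y \<mu>"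
      unfolding \<mu> m(3) ..
    have "measure (restrict_Y0 \<mu>) Z = t * measure (restrict_Y0 \<mu>1) Z + (1 - t) * measure (restrict_Y0 \<mu>2) Z"
      if "Z \<in> sets (restrict_space borel Y0)" for Z
    proof -
      have Z: "Z \<in> sets borel" "Z \<subseteq> Y0" using that by (auto simp: sets_restrict_borel[OF Y0_borel])
      have rm: "measure (restrict_Y0 \<rho>) Z = \<zeta> * measure \<rho> Z" if "\<rho> \<in> prob_measures Y" for \<rho>
        using restrict_Y0_props(2)[OF that Z] zeta_pos by (simp add: measure_def enn2real_mult)
      interpret M1: prob_space \<mu>1 by (rule prob_measuresD(1)[OF p[OF \<mu>(1)] Y_borel])
      interpret M2: prob_space \<mu>2 by (rule prob_measuresD(1)[OF p[OF \<mu>(3)] Y_borel])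
      interpret M: prob_space \<mu> by (rule prob_measuresD(1)[OF m(1) Y_borel])
      have m_eq: "measure \<mu> Z = t * measure \<mu>1 Z + (1 - t) * measure \<mu>2 Z"
        using m(2)[OF Z(1) subset_trans[OF Z(2) Y0(1)]] t
        by (simp add: M.emeasure_eq_measure M1.emeasure_eq_measure M2.emeasure_eq_measure flip: ennreal_mult ennreal_plus)
      show ?thesis
        unfolding rm[OF m(1)] rm[OF p[OF \<mu>(1)]] rm[OF p[OF \<mu>(3)]] m_eq by (simp add: algebra_simps)
    qed
    then show ?thesis unfolding eq using s K \<mu> R by auto
  qed
  have ind: "induced_measure act Y Y0 N S \<beta> \<nu> \<in> prob_measures Y \<and>
      (\<forall>Z \<in> sets (restrict_space borel Y). emeasure (induced_measure act Y Y0 N S \<beta> \<nu>) Z =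
         ennreal (inverse (zeta N S \<beta>)) * (\<Sum>\<^sub>\<infinity>s\<in>S. ennreal (N s powr - \<beta>) * emeasure \<nu> (act (- s) ` Z \<inter> Y0)))"
    if \<nu>: "\<nu> \<in> prob_measures Y0" for \<nu>
    unfolding induced_measure_eq[OF \<nu>] using spread_prob[OF \<nu>] induced_formula[OF \<nu>] by (auto simp: sets_Y)
  have part2: "(\<forall>f \<in> invariant_L2 act Y0 S \<mu>.
           (L2_norm \<mu> f)\<^sup>2 = zeta N S \<beta> * (LINT y:Y0|\<mu>. (cmod (f y))\<^sup>2)) \<and>
        (\<exists>P. is_orthogonal_projection \<mu> (invariant_L2 act Y0 S \<mu>) P) \<and>
        (\<forall>P. is_orthogonal_projection \<mu> (invariant_L2 act Y0 S \<mu>) P \<longrightarrow>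
          (\<forall>f \<in> L2_functions \<mu>. AE y in \<mu>. y \<in> Y0 \<longrightarrow>
             (\<lambda>s. of_real (N s powr - \<beta>) * f (act s y)) summable_on S \<and>
             (\<forall>r\<in>S. P f (act r y) =
                of_real (inverse (zeta N S \<beta>)) *
                (\<Sum>\<^sub>\<infinity>s\<in>S. of_real (N s powr - \<beta>) * f (act s y)))))"
    if \<nu>: "\<nu> \<in> prob_measures Y0" and \<mu>: "\<mu> = induced_measure act Y Y0 N S \<beta> \<nu>" for \<nu> \<mu>
  proof -
    interpret wandering_measure act Y N \<beta> S Y0 \<nu> by unfold_locales (rule \<nu>)
    show ?thesis unfolding \<mu> induced_measure_eq[OF \<nu>]
      using invariant_norm proj_is_projection projection_formula by blast
  qed
  have indRI: "induced_measure act Y Y0 N S \<beta> \<nu> \<in> prob_measures Y \<and>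
      (\<forall>Z \<in> sets (restrict_space borel Y). emeasure (induced_measure act Y Y0 N S \<beta> \<nu>) Z =
         ennreal (inverse (zeta N S \<beta>)) * (\<Sum>\<^sub>\<infinity>s\<in>S. ennreal (N s powr - \<beta>) * emeasure \<nu> (act (- s) ` Z \<inter> Y0))) \<and>
      ?I \<nu> \<in> ?K \<and> ?R (?I \<nu>) = \<nu>"
    if \<nu>: "\<nu> \<in> prob_measures Y0" for \<nu>
    by (rule conjI[OF ind[OF \<nu>, THEN conjunct1] conjI[OF ind[OF \<nu>, THEN conjunct2] conjI[OF RI[OF \<nu>]]]])
  show ?thesis
    by (intro conjI, intro ballI, erule unique, rule bij, intro ballI, erule (2) affine,
        intro ballI, erule indRI, intro ballI, erule IR(2), intro ballI allI impI, erule (1) part2)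
qed

end
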